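(* Let $K>0$, and let $(m_n)_{n\ge 1}$ be a sequence of positive integers with $\lim_{n\to\infty} \frac{m_n}{n}=\infty$. For each $n$, let $A=A(n)$ be an $m_n\times n$ random matrix whose entries are mutually independent centered $K$-subgaussian variables of unit variances, and let $c=c(n)\in\mathbb{R}^n$ be a non-random unit vector. Assume that $\lim_{n\to\infty}\log^{3/2}(m_n/n)\,\|c(n)\|_\infty=0$. Let $z^*=z^*(n)$ be the optimal objective value of the linear program of maximizing $\langle c,x\rangle$ over $x\in\mathbb{R}^n$ subject to $Ax\le \mathbf{1}$. Then for any constant $\varepsilon>0$, $$\mathbb{P}\big\{1-\varepsilon\leq \sqrt{2\log(m_n/n)}\,z^* \leq 1+\varepsilon\big\}\geq 1-n^{-\omega(1)},$$ and, in particular, $\lim_{n\to\infty}\sqrt{2\log(m_n/n)}\,z^*=1$ almost surely.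
   Context: A random variable $\xi$ is $K$-subgaussian (for $K>0$) if $\mathbb{E}\exp(\xi^2/K^2)\le 2$. "Unit vector" means Euclidean norm one; $\mathbf{1}$ is the vector of all ones and inequalities between vectors are coordinate-wise. The optimal objective value is $z^*=\sup\{\langle c,x\rangle:\ x\in\mathbb{R}^n,\ Ax\le\mathbf{1}\}$ (possibly $+\infty$; the zero vector is always feasible). The matrices $A(n)$, $n\ge1$, are defined on a common probability space. For events $E_n$, "$\mathbb{P}(E_n)\ge 1-n^{-\omega(1)}$" means that for every $C>0$ there is $n_0$ such that $\mathbb{P}(E_n)\ge 1-n^{-C}$ for all $n\ge n_0$. *)

theory Defs
  imports "HOL-Probability.Probability"
begin

text \<open>
  Since the dimensions vary with \<open>n\<close>, a vector in \<open>\<real>\<^sup>n\<close> is a function \<open>nat \<Rightarrow> real\<close> of which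
  only the entries with index below \<open>n\<close> matter, and similarly for matrices. Indices start at 0.
\<close>

text \<open>The nonnegative integral is used because the Bochner integral of a non-integrable function
  is 0, so that a bound on it would hold vacuously.\<close>

definition subgaussian :: "'a measure \<Rightarrow> real \<Rightarrow> ('a \<Rightarrow> real) \<Rightarrow> bool" where
  "subgaussian M K X \<longleftrightarrow>
     X \<in> borel_measurable M \<and> (\<integral>\<^sup>+ \<omega>. ennreal (exp ((X \<omega>)\<^sup>2 / K\<^sup>2)) \<partial>M) \<le> 2"

text \<open>The variable \<open>x\<close> ranges over extensional functions on \<open>{..<n}\<close>, which are in bijection
  with \<open>\<real>\<^sup>n\<close>.\<close>

definition lp_feasible :: "nat \<Rightarrow> nat \<Rightarrow> (nat \<Rightarrow> nat \<Rightarrow> real) \<Rightarrow> (nat \<Rightarrow> real) set" where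
  "lp_feasible m n a = {x \<in> {..<n} \<rightarrow>\<^sub>E UNIV. \<forall>i<m. (\<Sum>j<n. a i j * x j) \<le> 1}"

definition lp_value :: "nat \<Rightarrow> nat \<Rightarrow> (nat \<Rightarrow> nat \<Rightarrow> real) \<Rightarrow> (nat \<Rightarrow> real) \<Rightarrow> ereal" where
  "lp_value m n a c = (SUP x \<in> lp_feasible m n a. ereal (\<Sum>j<n. c j * x j))"

end

theory Submission
  imports Defs "HOL-Real_Asymp.Real_Asymp"
begin

text \<open>
  Write \<open>t = sqrt (2 * ln (m / n))\<close> and let \<open>a\<^sub>i\<close> be the rows of the matrix.

  Upper bound. By weak duality it suffices to find \<open>y \<ge> 0\<close> with total mass about \<open>1 / t\<close> such that the
  residual of \<open>\<Sum>i. y\<^sub>i a\<^sub>i = c\<close> is small, together with a bound on the norm of feasible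
  points. Take \<open>y\<^sub>i\<close> proportional to \<open>exp (\<theta> \<langle>a\<^sub>i, c\<rangle>)\<close> with \<open>\<theta> = (1 - \<epsilon>) t\<close>, truncated: because \<open>c\<close> is flat, the
  tilted mean of \<open>a\<^sub>i\<close> is nearly \<open>\<theta> c\<close>, and since the truncation level is below \<open>m / n\<close>, the
  fluctuations are controlled uniformly over a grid of directions.

  Lower bound. The point \<open>(1 - \<epsilon>) c / t\<close> violates few constraints. Describe the violations by a vector
  \<open>b\<close> of natural numbers and subtract a multiple of the combination \<open>\<Sum>i. b\<^sub>i a\<^sub>i\<close> of the rows. This repairs the rows in the support of
  \<open>b\<close>, and the overshoots it creates form a strictly smaller vector, which is treated recursively with
  half the weight. There are only \<open>exp (o(n))\<close> such integer vectors, so that the near-orthogonality of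
  the two combinations of rows given by disjointly supported vectors holds for all of them at once by a union bound.
\<close>

section \<open>Subgaussian variables\<close>

text \<open>Let \<open>L = ln (m / n)\<close> and let \<open>r\<close> be the sup norm of
  \<open>c\<close>. The entries are not Gaussian, so Gaussian precision is available only along the
  flat direction \<open>c\<close>, for exponential parameters of order \<open>sqrt L\<close>;
  whatever lies beyond a cutoff \<open>R\<close> of order \<open>sqrt L\<close> is left to the
  cruder square-exponential moment. These errors vanish as soon as \<open>L * r\<close> tends to 0.
  The power 3/2 of the hypothesis has another role: a unit vector has
  \<open>r \<ge> 1 / sqrt n\<close>, so eventually \<open>L ^ 3 \<le> n\<close>. This keeps the
  budget \<open>n / L\<^sup>2\<close> for the squared norm of the violation vector above
  \<open>n powr (1 / 3)\<close>, and so makes the failure probability smaller than every power of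
  \<open>n\<close>. In the upper bound, the logarithm of the tilting density is typically \<theta>^2
  / 2 = (1 - \<epsilon>)^2 L under the tilted law. The truncation level has logarithm (1 -
  \<epsilon>) L, strictly between this and L. The lower gap makes truncation harmless; the upper
  gap, a factor exp (\<epsilon> L), pays for the union over the grid.\<close>

lemma exp_le_quadratic:
  fixes y :: real
  assumes "y \<le> 1"
  shows "exp y \<le> 1 + y + y\<^sup>2"
proof (cases "0 \<le> y")
  case True
  then show ?thesis using exp_bound assms by simp
next
  case False
  define z where "z = - y"
  have z: "z > 0" using False z_def by simp
  \<comment> \<open>By reciprocals: exp (- z) is at most 1 / (1 + z + z^2 / 2), which is at most 1 -
    z + z^2 because the product of the two polynomials is at least 1.\<close>
  have "1 + z + z\<^sup>2 / 2 \<le> exp z" using exp_lower_Taylor_quadratic[of z] z by simp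
  moreover have "0 < 1 + z + z\<^sup>2 / 2" using z by (simp add: add_pos_nonneg)
  moreover have "0 \<le> 1 - z + z\<^sup>2"
    using sum_squares_ge_zero[of "z - 1/2" 0] by (simp add: power2_eq_square algebra_simps)
  ultimately have "(1 - z + z\<^sup>2) * (1 + z + z\<^sup>2 / 2) \<le> (1 - z + z\<^sup>2) * exp z"
    by (intro mult_left_mono)
  moreover have "(1 - z + z\<^sup>2) * (1 + z + z\<^sup>2 / 2) = 1 + z\<^sup>2 / 2 + z^3 / 2 + z^4 / 2"
    by (simp add: field_simps power2_eq_square power3_eq_cube power4_eq_xxxx)
  moreover have "1 \<le> 1 + z\<^sup>2 / 2 + z^3 / 2 + z^4 / 2" using z by simp
  ultimately have "1 \<le> (1 - z + z\<^sup>2) * exp z" by linarith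
  then have "exp (- z) * 1 \<le> exp (- z) * ((1 - z + z\<^sup>2) * exp z)"
    by (intro mult_left_mono) auto
  also have "\<dots> = 1 - z + z\<^sup>2" by (simp add: exp_minus field_simps)
  finally show ?thesis by (simp add: z_def)
qed

text \<open>For a centered variable the linear term integrates to 0, so the moment generating
  function at s is bounded by the mean of exp (s^2 X^2), which is what the subgaussian hypothesis
  controls.\<close>

lemma exp_le_add_exp_square:
  fixes y :: real
  shows "exp y \<le> y + exp (y\<^sup>2)"
proof (cases "y \<le> 1")
  case True
  then show ?thesis using exp_le_quadratic[of y] exp_ge_add_one_self[of "y\<^sup>2"] by linarith
next
  case False
  then have "y \<le> y\<^sup>2" by (simp add: power2_eq_square)
  then show ?thesis using False by (smt (verit) exp_le_cancel_iff)
qed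

lemma exp_minus_linear_bound:
  fixes y :: real
  shows "\<bar>exp y - 1 - y\<bar> \<le> y\<^sup>2 * exp \<bar>y\<bar>"
  using Taylor_exp_field[of y 1] by (simp add: power2_eq_square mult.commute algebra_simps)

lemma exp_minus_quadratic_bound:
  fixes y :: real
  shows "\<bar>exp y - 1 - y - y\<^sup>2 / 2\<bar> \<le> \<bar>y\<bar>^3 * exp \<bar>y\<bar> / 2"
  using Taylor_exp_field[of y 2]
  by (simp add: power2_eq_square power3_eq_cube numeral_2_eq_2 mult.commute algebra_simps)

lemma power_le_fact_exp:
  fixes y :: real
  assumes "0 \<le> y"
  shows "y ^ k \<le> fact k * exp y"
proof -
  have "(\<Sum>i\<in>{k}. inverse (fact i) * y ^ i) \<le> (\<Sum>i. inverse (fact i) * y ^ i)"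
    using summable_exp[of y] assms by (intro sum_le_suminf) auto
  then have "y ^ k / fact k \<le> exp y"
    by (simp add: exp_def divide_inverse mult.commute)
  then show ?thesis by (simp add: field_simps)
qed

lemma abs_cube_exp_le:
  fixes y :: real
  shows "\<bar>y\<bar>^3 * exp \<bar>y\<bar> \<le> 6 * (exp (2 * y) + exp (- 2 * y))"
proof -
  have "\<bar>y\<bar>^3 \<le> 6 * exp \<bar>y\<bar>" using power_le_fact_exp[of "\<bar>y\<bar>" 3] by (simp add: eval_nat_numeral)
  then have "\<bar>y\<bar>^3 * exp \<bar>y\<bar> \<le> 6 * exp \<bar>y\<bar> * exp \<bar>y\<bar>" by (intro mult_right_mono) auto
  also have "\<dots> = 6 * exp (2 * \<bar>y\<bar>)" by (simp add: exp_add[symmetric])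
  also have "exp (2 * \<bar>y\<bar>) \<le> exp (2 * y) + exp (- 2 * y)" by (cases "0 \<le> y") auto
  finally show ?thesis by simp
qed

context prob_space
begin

lemma nn_integral_bound_imp_integrable:
  fixes f :: "'a \<Rightarrow> real"
  assumes [measurable]: "f \<in> borel_measurable M" and "\<And>x. 0 \<le> f x"
    and "(\<integral>\<^sup>+ x. ennreal (f x) \<partial>M) \<le> ennreal b" and "0 \<le> b"
  shows "integrable M f" and "expectation f \<le> b"
proof -
  show *: "integrable M f"
    using assms by (intro integrableI_bounded) (auto intro: le_less_trans)
  have "ennreal (expectation f) \<le> ennreal b"
    using assms * by (subst nn_integral_eq_integral[symmetric]) auto
  then show "expectation f \<le> b" using assms(4) by simp
qed

lemma chernoff:
  assumes [measurable]: "Y \<in> borel_measurable M"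
    and "(\<integral>\<^sup>+ x. ennreal (exp (Y x)) \<partial>M) \<le> ennreal b" and "0 \<le> b"
  shows "prob {x \<in> space M. a \<le> Y x} \<le> b * exp (- a)"
proof -
  note i = nn_integral_bound_imp_integrable[of "\<lambda>x. exp (Y x)" b]
  have "prob {x \<in> space M. exp a \<le> exp (Y x)} \<le> expectation (\<lambda>x. exp (Y x)) / exp a"
    using i assms by (intro integral_Markov_inequality_measure[where A = "{}"]) auto
  also have "\<dots> \<le> b / exp a" using i assms by (intro divide_right_mono) auto
  finally show ?thesis by (simp add: exp_minus field_simps)
qed

end

text \<open>The bound for the mean of |X|^3 exp |X| that results from \<open>abs_cube_exp_le\<close>
  and \<open>expectation_exp_le\<close> at s = 2 and s = -2. It controls every Taylor remainder of
  the moment generating function on |s| \<le> 1.\<close>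

definition cubic_const :: "real \<Rightarrow> real" where "cubic_const K = 12 * exp (4 * K\<^sup>2)"

locale std_subgaussian = prob_space M for M :: "'a measure" +
  fixes K :: real and X :: "'a \<Rightarrow> real"
  assumes K_pos: "0 < K" and subg: "subgaussian M K X"
    and mean: "expectation X = 0" and var: "variance X = 1"
begin

lemma measurable_X[measurable]: "X \<in> borel_measurable M"
  using subg by (simp add: subgaussian_def)

lemma psi2:
  shows "integrable M (\<lambda>\<omega>. exp ((X \<omega>)\<^sup>2 / K\<^sup>2))"
    and "expectation (\<lambda>\<omega>. exp ((X \<omega>)\<^sup>2 / K\<^sup>2)) \<le> 2"
  using nn_integral_bound_imp_integrable[of "\<lambda>\<omega>. exp ((X \<omega>)\<^sup>2 / K\<^sup>2)" 2] subg
  by (auto simp: subgaussian_def)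

lemma integrable_square: "integrable M (\<lambda>\<omega>. (X \<omega>)\<^sup>2)"
proof (rule Bochner_Integration.integrable_bound[OF integrable_mult_right[OF psi2(1), of "K\<^sup>2"]])
  have "x\<^sup>2 \<le> K\<^sup>2 * exp (x\<^sup>2 / K\<^sup>2)" for x
  proof -
    have "x\<^sup>2 / K\<^sup>2 \<le> exp (x\<^sup>2 / K\<^sup>2)" using exp_ge_add_one_self[of "x\<^sup>2 / K\<^sup>2"] by linarith
    then show ?thesis using K_pos by (simp add: field_simps)
  qed
  then show "AE x in M. norm ((X x)\<^sup>2) \<le> norm (K\<^sup>2 * exp ((X x)\<^sup>2 / K\<^sup>2))" by auto
qed auto

lemma integrable_X: "integrable M X"
  using square_integrable_imp_integrable[OF measurable_X integrable_square] .

lemma second_moment: "expectation (\<lambda>\<omega>. (X \<omega>)\<^sup>2) = 1"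
  using var mean by simp

text \<open>By exp y \<ge> 1 + y, unit variance forces 1 + 1 / K^2 \<le> 2. Later constants are
  simplified by comparing powers of \<open>K\<close>.\<close>

lemma K_ge_1: "1 \<le> K"
proof -
  have "expectation (\<lambda>\<omega>. 1 + (X \<omega>)\<^sup>2 / K\<^sup>2) \<le> expectation (\<lambda>\<omega>. exp ((X \<omega>)\<^sup>2 / K\<^sup>2))"
    using psi2 integrable_square by (intro integral_mono) auto
  also have "expectation (\<lambda>\<omega>. 1 + (X \<omega>)\<^sup>2 / K\<^sup>2) = 1 + 1 / K\<^sup>2"
    using integrable_square second_moment by (subst Bochner_Integration.integral_add) (auto simp: prob_space)
  finally have "1 / K\<^sup>2 \<le> 1" using psi2(2) by linarith
  then have "1 \<le> K\<^sup>2" using K_pos by (simp add: field_simps)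
  then show ?thesis using K_pos by (metis abs_of_pos abs_le_square_iff abs_1 power_one)
qed

text \<open>For K^2 s^2 \<le> 1, the linear term vanishes by centering and convexity of exp turns
  exp (s^2 x^2) into a mixture of 1 and exp (x^2 / K^2). For larger s, Young's inequality splits s x
  into K^2 s^2 / 2 and x^2 / (2 K^2); the resulting factor 3/2 is absorbed by the other half of K^2
  s^2.\<close>

lemma mgf_bound: "(\<integral>\<^sup>+ \<omega>. ennreal (exp (s * X \<omega>)) \<partial>M) \<le> ennreal (exp (K\<^sup>2 * s\<^sup>2))"
proof (cases "s\<^sup>2 * K\<^sup>2 \<le> 1")
  case True
  define p where "p = s\<^sup>2 * K\<^sup>2"
  have p: "0 \<le> p" "p \<le> 1" using True p_def by auto
  have pt: "exp (s * x) \<le> s * x + (1 - p) + p * exp (x\<^sup>2 / K\<^sup>2)" for x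
  proof -
    have "exp (s * x) \<le> s * x + exp ((s * x)\<^sup>2)" by (rule exp_le_add_exp_square)
    also have "(s * x)\<^sup>2 = (1 - p) * 0 + p * (x\<^sup>2 / K\<^sup>2)"
      using K_pos by (simp add: p_def power_mult_distrib)
    also have "exp \<dots> \<le> (1 - p) * exp 0 + p * exp (x\<^sup>2 / K\<^sup>2)"
      using convex_onD[OF exp_convex, of p 0 "x\<^sup>2 / K\<^sup>2"] p by simp
    finally show ?thesis by simp
  qed
  have int: "integrable M (\<lambda>\<omega>. s * X \<omega> + (1 - p) + p * exp ((X \<omega>)\<^sup>2 / K\<^sup>2))"
    using psi2 integrable_X by auto
  have "(\<integral>\<^sup>+ \<omega>. ennreal (exp (s * X \<omega>)) \<partial>M)
      \<le> (\<integral>\<^sup>+ \<omega>. ennreal (s * X \<omega> + (1 - p) + p * exp ((X \<omega>)\<^sup>2 / K\<^sup>2)) \<partial>M)"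
    using pt by (intro nn_integral_mono ennreal_leI) auto
  also have "\<dots> = ennreal (expectation (\<lambda>\<omega>. s * X \<omega> + (1 - p) + p * exp ((X \<omega>)\<^sup>2 / K\<^sup>2)))"
    using int pt by (intro nn_integral_eq_integral AE_I2) (auto intro: order_trans[OF exp_ge_zero])
  also have "expectation (\<lambda>\<omega>. s * X \<omega> + (1 - p) + p * exp ((X \<omega>)\<^sup>2 / K\<^sup>2))
      = (1 - p) + p * expectation (\<lambda>\<omega>. exp ((X \<omega>)\<^sup>2 / K\<^sup>2))"
    using psi2 integrable_X mean by (simp add: prob_space)
  also have "\<dots> \<le> (1 - p) + p * 2" using psi2 p by (intro add_left_mono mult_left_mono) auto
  also have "\<dots> \<le> exp p" using exp_ge_add_one_self[of p] by (simp add: add.commute)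
  finally show ?thesis by (simp add: p_def mult.commute ennreal_leI)
next
  case False
  have pt: "exp (s * x) \<le> exp (K\<^sup>2 * s\<^sup>2 / 2) * ((1 + exp (x\<^sup>2 / K\<^sup>2)) / 2)" for x
  proof -
    have "0 \<le> (K * s - x / K)\<^sup>2" by simp
    then have "s * x \<le> K\<^sup>2 * s\<^sup>2 / 2 + x\<^sup>2 / K\<^sup>2 / 2"
      using K_pos by (simp add: power2_diff power_mult_distrib power_divide)
    then have "exp (s * x) \<le> exp (K\<^sup>2 * s\<^sup>2 / 2) * exp (x\<^sup>2 / K\<^sup>2 / 2)"
      by (simp add: exp_add[symmetric])
    also have "exp (x\<^sup>2 / K\<^sup>2 / 2) \<le> (1 + exp (x\<^sup>2 / K\<^sup>2)) / 2"
    proof -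
      have "0 \<le> (exp (x\<^sup>2 / K\<^sup>2 / 2) - 1)\<^sup>2" by simp
      then have "2 * exp (x\<^sup>2 / K\<^sup>2 / 2) \<le> 1 + (exp (x\<^sup>2 / K\<^sup>2 / 2))\<^sup>2" by (simp add: power2_diff)
      moreover have "(exp (x\<^sup>2 / K\<^sup>2 / 2))\<^sup>2 = exp (x\<^sup>2 / K\<^sup>2)"
        by (simp add: power2_eq_square exp_add[symmetric])
      ultimately show ?thesis by simp
    qed
    finally show ?thesis by simp
  qed
  have int: "integrable M (\<lambda>\<omega>. exp (K\<^sup>2 * s\<^sup>2 / 2) * ((1 + exp ((X \<omega>)\<^sup>2 / K\<^sup>2)) / 2))"
    using psi2 by auto
  have "(\<integral>\<^sup>+ \<omega>. ennreal (exp (s * X \<omega>)) \<partial>M)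
      \<le> (\<integral>\<^sup>+ \<omega>. ennreal (exp (K\<^sup>2 * s\<^sup>2 / 2) * ((1 + exp ((X \<omega>)\<^sup>2 / K\<^sup>2)) / 2)) \<partial>M)"
    using pt by (intro nn_integral_mono ennreal_leI) auto
  also have "\<dots> = ennreal (expectation (\<lambda>\<omega>. exp (K\<^sup>2 * s\<^sup>2 / 2) * ((1 + exp ((X \<omega>)\<^sup>2 / K\<^sup>2)) / 2)))"
    using int by (intro nn_integral_eq_integral AE_I2) (auto intro: add_nonneg_nonneg)
  also have "expectation (\<lambda>\<omega>. exp (K\<^sup>2 * s\<^sup>2 / 2) * ((1 + exp ((X \<omega>)\<^sup>2 / K\<^sup>2)) / 2))
      = exp (K\<^sup>2 * s\<^sup>2 / 2) * ((1 + expectation (\<lambda>\<omega>. exp ((X \<omega>)\<^sup>2 / K\<^sup>2))) / 2)"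
    using psi2 by (simp add: prob_space)
  also have "\<dots> \<le> exp (K\<^sup>2 * s\<^sup>2 / 2) * (3 / 2)" using psi2 by (intro mult_left_mono) auto
  also have "\<dots> \<le> exp (K\<^sup>2 * s\<^sup>2 / 2) * exp (K\<^sup>2 * s\<^sup>2 / 2)"
  proof (rule mult_left_mono)
    have "3 / 2 \<le> 1 + K\<^sup>2 * s\<^sup>2 / 2" using False by (simp add: mult.commute)
    also have "\<dots> \<le> exp (K\<^sup>2 * s\<^sup>2 / 2)" by (rule exp_ge_add_one_self)
    finally show "3 / 2 \<le> exp (K\<^sup>2 * s\<^sup>2 / 2)" .
  qed auto
  finally show ?thesis by (simp add: exp_add[symmetric] ennreal_leI)
qed

lemma integrable_exp: "integrable M (\<lambda>\<omega>. exp (s * X \<omega>))"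
  and expectation_exp_le: "expectation (\<lambda>\<omega>. exp (s * X \<omega>)) \<le> exp (K\<^sup>2 * s\<^sup>2)"
  using nn_integral_bound_imp_integrable[OF _ _ mgf_bound] by auto

lemma cubic_moment:
  shows "integrable M (\<lambda>\<omega>. \<bar>X \<omega>\<bar>^3 * exp \<bar>X \<omega>\<bar>)"
    and "expectation (\<lambda>\<omega>. \<bar>X \<omega>\<bar>^3 * exp \<bar>X \<omega>\<bar>) \<le> cubic_const K"
proof -
  have int: "integrable M (\<lambda>\<omega>. 6 * (exp (2 * X \<omega>) + exp (- 2 * X \<omega>)))"
    using integrable_exp[of 2] integrable_exp[of "-2"] by auto
  show *: "integrable M (\<lambda>\<omega>. \<bar>X \<omega>\<bar>^3 * exp \<bar>X \<omega>\<bar>)"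
    using abs_cube_exp_le by (intro Bochner_Integration.integrable_bound[OF int] AE_I2) (auto simp: abs_mult)
  have "expectation (\<lambda>\<omega>. \<bar>X \<omega>\<bar>^3 * exp \<bar>X \<omega>\<bar>) \<le> expectation (\<lambda>\<omega>. 6 * (exp (2 * X \<omega>) + exp (- 2 * X \<omega>)))"
    using abs_cube_exp_le by (intro integral_mono * int) auto
  also have "\<dots> = 6 * (expectation (\<lambda>\<omega>. exp (2 * X \<omega>)) + expectation (\<lambda>\<omega>. exp (- 2 * X \<omega>)))"
    using integrable_exp[of 2] integrable_exp[of "-2"] by simp
  also have "\<dots> \<le> cubic_const K"
    using expectation_exp_le[of 2] expectation_exp_le[of "-2"] by (simp add: cubic_const_def mult.commute)
  finally show "expectation (\<lambda>\<omega>. \<bar>X \<omega>\<bar>^3 * exp \<bar>X \<omega>\<bar>) \<le> cubic_const K" .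
qed

lemma mgf_expansion:
  assumes "\<bar>s\<bar> \<le> 1"
  shows "\<bar>expectation (\<lambda>\<omega>. exp (s * X \<omega>)) - 1 - s\<^sup>2 / 2\<bar> \<le> cubic_const K * \<bar>s\<bar>^3"
proof -
  have pt: "\<bar>exp (s * x) - 1 - s * x - (s * x)\<^sup>2 / 2\<bar> \<le> \<bar>s\<bar>^3 * (\<bar>x\<bar>^3 * exp \<bar>x\<bar>)" for x
  proof -
    have "\<bar>s * x\<bar> \<le> \<bar>x\<bar>" using mult_right_mono[OF assms, of "\<bar>x\<bar>"] by (simp add: abs_mult)
    then have "\<bar>s * x\<bar>^3 * exp \<bar>s * x\<bar> \<le> \<bar>s * x\<bar>^3 * exp \<bar>x\<bar>"
      by (intro mult_left_mono) auto
    moreover have "0 \<le> \<bar>s * x\<bar>^3 * exp \<bar>s * x\<bar>" by simp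
    ultimately have "\<bar>s * x\<bar>^3 * exp \<bar>s * x\<bar> / 2 \<le> \<bar>s * x\<bar>^3 * exp \<bar>x\<bar>" by linarith
    moreover have "\<bar>s * x\<bar>^3 * exp \<bar>x\<bar> = \<bar>s\<bar>^3 * (\<bar>x\<bar>^3 * exp \<bar>x\<bar>)"
      by (simp add: abs_mult power_mult_distrib)
    ultimately show ?thesis using exp_minus_quadratic_bound[of "s * x"] by linarith
  qed
  have "expectation (\<lambda>\<omega>. exp (s * X \<omega>)) - 1 - s\<^sup>2 / 2 =
      expectation (\<lambda>\<omega>. exp (s * X \<omega>) - 1 - s * X \<omega> - (s * X \<omega>)\<^sup>2 / 2)"
    using integrable_exp integrable_X integrable_square mean second_moment
    by (simp add: power_mult_distrib prob_space)
  also have "\<bar>\<dots>\<bar> \<le> expectation (\<lambda>\<omega>. \<bar>s\<bar>^3 * (\<bar>X \<omega>\<bar>^3 * exp \<bar>X \<omega>\<bar>))"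
    using pt cubic_moment(1) integrable_exp integrable_X integrable_square
    by (intro order_trans[OF integral_abs_bound] integral_mono) (auto simp: power_mult_distrib)
  also have "\<dots> \<le> cubic_const K * \<bar>s\<bar>^3"
    using cubic_moment mult_right_mono[OF cubic_moment(2), of "\<bar>s\<bar>^3"] by (simp add: mult.commute)
  finally show ?thesis .
qed

lemma integrable_X_exp:
  assumes "\<bar>s\<bar> \<le> 1"
  shows "integrable M (\<lambda>\<omega>. X \<omega> * exp (s * X \<omega>))"
proof -
  have pt: "\<bar>x * exp (s * x)\<bar> \<le> exp (2 * x) + exp (- 2 * x)" for x
  proof -
    have "\<bar>x\<bar> \<le> exp \<bar>x\<bar>" using exp_ge_add_one_self[of "\<bar>x\<bar>"] by linarith
    moreover have "s * x \<le> \<bar>x\<bar>"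
      using mult_right_mono[OF assms, of "\<bar>x\<bar>"] by (metis abs_ge_self abs_ge_zero abs_mult mult_1 order_trans)
    ultimately have "\<bar>x\<bar> * exp (s * x) \<le> exp \<bar>x\<bar> * exp \<bar>x\<bar>" by (intro mult_mono) auto
    also have "\<dots> = exp (2 * \<bar>x\<bar>)" by (simp add: exp_add[symmetric])
    also have "exp (2 * \<bar>x\<bar>) \<le> exp (2 * x) + exp (- 2 * x)" by (cases "0 \<le> x") auto
    finally show ?thesis by (simp add: abs_mult)
  qed
  have int: "integrable M (\<lambda>\<omega>. exp (2 * X \<omega>) + exp (- 2 * X \<omega>))"
    using integrable_exp[of 2] integrable_exp[of "-2"] by auto
  show ?thesis using pt by (intro Bochner_Integration.integrable_bound[OF int] AE_I2) auto
qed

text \<open>To first order x exp (s x) is x + s x^2, whose mean is s by centering and unit variance.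
  Hence an exponential tilt along \<open>c\<close> shifts the mean of a row nearly along
  \<open>c\<close>, as it would for Gaussian rows.\<close>

lemma tilted_mean_expansion:
  assumes "\<bar>s\<bar> \<le> 1"
  shows "\<bar>expectation (\<lambda>\<omega>. X \<omega> * exp (s * X \<omega>)) - s\<bar> \<le> cubic_const K * s\<^sup>2"
proof -
  have pt: "\<bar>x * exp (s * x) - x - s * x\<^sup>2\<bar> \<le> s\<^sup>2 * (\<bar>x\<bar>^3 * exp \<bar>x\<bar>)" for x
  proof -
    have "\<bar>x * exp (s * x) - x - s * x\<^sup>2\<bar> = \<bar>x\<bar> * \<bar>exp (s * x) - 1 - s * x\<bar>"
      unfolding abs_mult[symmetric] by (simp add: algebra_simps power2_eq_square)
    also have "\<dots> \<le> \<bar>x\<bar> * ((s * x)\<^sup>2 * exp \<bar>s * x\<bar>)"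
      by (intro mult_left_mono exp_minus_linear_bound) auto
    also have "\<dots> \<le> \<bar>x\<bar> * ((s * x)\<^sup>2 * exp \<bar>x\<bar>)"
      using mult_right_mono[OF assms, of "\<bar>x\<bar>"] by (intro mult_left_mono) (auto simp: abs_mult)
    also have "\<dots> = s\<^sup>2 * (\<bar>x\<bar>^3 * exp \<bar>x\<bar>)"
      by (simp add: power2_eq_square power3_eq_cube abs_mult algebra_simps)
    finally show ?thesis .
  qed
  have "expectation (\<lambda>\<omega>. X \<omega> * exp (s * X \<omega>)) - s = expectation (\<lambda>\<omega>. X \<omega> * exp (s * X \<omega>) - X \<omega> - s * (X \<omega>)\<^sup>2)"
    using integrable_X_exp[OF assms] integrable_X integrable_square mean second_moment
    by (simp add: prob_space)
  also have "\<bar>\<dots>\<bar> \<le> expectation (\<lambda>\<omega>. s\<^sup>2 * (\<bar>X \<omega>\<bar>^3 * exp \<bar>X \<omega>\<bar>))"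
    using pt cubic_moment(1) integrable_X_exp[OF assms] integrable_X integrable_square
    by (intro order_trans[OF integral_abs_bound] integral_mono) auto
  also have "\<dots> \<le> cubic_const K * s\<^sup>2"
    using cubic_moment mult_right_mono[OF cubic_moment(2), of "s\<^sup>2"] by (simp add: mult.commute)
  finally show ?thesis .
qed

lemma fourth_moment:
  shows "integrable M (\<lambda>\<omega>. (X \<omega>)^4)" and "expectation (\<lambda>\<omega>. (X \<omega>)^4) \<le> 4 * K^4"
proof -
  have pt: "x^4 \<le> 2 * K^4 * exp (x\<^sup>2 / K\<^sup>2)" for x
    using power_le_fact_exp[of "x\<^sup>2 / K\<^sup>2" 2] K_pos by (simp add: field_simps power_divide power_mult[symmetric])
  have int: "integrable M (\<lambda>\<omega>. 2 * K^4 * exp ((X \<omega>)\<^sup>2 / K\<^sup>2))" using psi2 by auto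
  show *: "integrable M (\<lambda>\<omega>. (X \<omega>)^4)"
    using pt K_pos by (intro Bochner_Integration.integrable_bound[OF int] AE_I2) (auto simp: abs_mult)
  have "expectation (\<lambda>\<omega>. (X \<omega>)^4) \<le> expectation (\<lambda>\<omega>. 2 * K^4 * exp ((X \<omega>)\<^sup>2 / K\<^sup>2))"
    using pt by (intro integral_mono * int) auto
  also have "\<dots> = 2 * K^4 * expectation (\<lambda>\<omega>. exp ((X \<omega>)\<^sup>2 / K\<^sup>2))" by simp
  also have "\<dots> \<le> 2 * K^4 * 2" using psi2 K_pos by (intro mult_left_mono) auto
  finally show "expectation (\<lambda>\<omega>. (X \<omega>)^4) \<le> 4 * K^4" by simp
qed

end

section \<open>Linear forms in independent entries\<close>

lemma nn_integral_normal_density: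
  assumes "0 < \<sigma>"
  shows "(\<integral>\<^sup>+ g. ennreal (normal_density \<mu> \<sigma> g) \<partial>lborel) = 1"
  using assms by (subst nn_integral_eq_integral) auto

lemma nn_integral_std_normal_exp:
  "(\<integral>\<^sup>+ g. ennreal (std_normal_density g * exp (a * g)) \<partial>lborel) = ennreal (exp (a\<^sup>2 / 2))"
proof -
  have "std_normal_density g * exp (a * g) = exp (a\<^sup>2 / 2) * normal_density a 1 g" for g
  proof -
    have "- g\<^sup>2 / 2 + a * g = a\<^sup>2 / 2 + - (g - a)\<^sup>2 / 2"
      by (simp add: power2_eq_square algebra_simps add_divide_distrib diff_divide_distrib)
    then have "exp (- g\<^sup>2 / 2) * exp (a * g) = exp (a\<^sup>2 / 2) * exp (- (g - a)\<^sup>2 / 2)"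
      by (simp only: exp_add[symmetric])
    then show ?thesis by (simp add: normal_density_def)
  qed
  then have "(\<integral>\<^sup>+ g. ennreal (std_normal_density g * exp (a * g)) \<partial>lborel)
      = (\<integral>\<^sup>+ g. ennreal (exp (a\<^sup>2 / 2)) * ennreal (normal_density a 1 g) \<partial>lborel)"
    by (simp add: ennreal_mult)
  also have "\<dots> = ennreal (exp (a\<^sup>2 / 2))"
    by (subst nn_integral_cmult) (auto simp: nn_integral_normal_density)
  finally show ?thesis .
qed

lemma nn_integral_std_normal_exp_square:
  assumes "2 * a < 1"
  shows "(\<integral>\<^sup>+ g. ennreal (std_normal_density g * exp (a * g\<^sup>2)) \<partial>lborel) = ennreal (1 / sqrt (1 - 2 * a))"
proof -
  define \<sigma> where "\<sigma> = 1 / sqrt (1 - 2 * a)"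
  have \<sigma>: "0 < \<sigma>" "\<sigma>\<^sup>2 = 1 / (1 - 2 * a)" using assms by (auto simp: \<sigma>_def power_divide)
  have "std_normal_density g * exp (a * g\<^sup>2) = \<sigma> * normal_density 0 \<sigma> g" for g
  proof -
    have "exp (- g\<^sup>2 / 2) * exp (a * g\<^sup>2) = exp (- g\<^sup>2 / (2 * \<sigma>\<^sup>2))"
      unfolding \<sigma>(2) using assms by (simp add: exp_add[symmetric] field_simps)
    then show ?thesis using \<sigma>(1) by (simp add: normal_density_def real_sqrt_mult)
  qed
  then have "(\<integral>\<^sup>+ g. ennreal (std_normal_density g * exp (a * g\<^sup>2)) \<partial>lborel)
      = (\<integral>\<^sup>+ g. ennreal \<sigma> * ennreal (normal_density 0 \<sigma> g) \<partial>lborel)"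
    using \<sigma> by (simp add: ennreal_mult)
  also have "\<dots> = ennreal \<sigma>"
    using \<sigma> by (subst nn_integral_cmult) (auto simp: nn_integral_normal_density)
  finally show ?thesis by (simp add: \<sigma>_def)
qed

lemma inverse_sqrt_le_exp:
  fixes y :: real
  assumes "0 \<le> y" "4 * y \<le> 1"
  shows "1 / sqrt (1 - y) \<le> exp y"
proof -
  have "4 * (y * y) \<le> y" using mult_right_mono[OF assms(2,1)] by simp
  then have "1 - 2 * y + 4 * (y * y) \<le> 1 - y" by simp
  then have "exp (- 2 * y) \<le> 1 - y"
    using exp_le_quadratic[of "- 2 * y"] assms by (simp add: power2_eq_square)
  then have "sqrt (exp (- 2 * y)) \<le> sqrt (1 - y)" by simp
  moreover have "sqrt (exp (- 2 * y)) = exp (- y)"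
    by (rule real_sqrt_unique) (auto simp: power2_eq_square exp_add[symmetric])
  ultimately have "exp (- y) \<le> sqrt (1 - y)" by (simp only:)
  moreover have "0 < sqrt (1 - y)" using assms by auto
  ultimately show ?thesis by (simp add: exp_minus field_simps)
qed

context prob_space
begin

text \<open>The square in the exponent is linearized by integrating against a Gaussian.\<close>

lemma exp_square_bound:
  assumes [measurable]: "U \<in> borel_measurable M"
    and mgf: "\<And>s. (\<integral>\<^sup>+ \<omega>. ennreal (exp (s * U \<omega>)) \<partial>M) \<le> ennreal (exp (\<beta> * s\<^sup>2))"
    and "0 \<le> \<beta>" "0 \<le> \<kappa>" "16 * \<kappa> * \<beta> \<le> 1"
  shows "(\<integral>\<^sup>+ \<omega>. ennreal (exp (\<kappa> * (U \<omega>)\<^sup>2)) \<partial>M) \<le> ennreal (exp (4 * \<kappa> * \<beta>))"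
proof -
  interpret pair_sigma_finite M lborel
    by (intro pair_sigma_finite.intro sigma_finite_measure_axioms sigma_finite_lborel)
  define r where "r = sqrt (2 * \<kappa>)"
  have r: "r\<^sup>2 = 2 * \<kappa>" using assms by (simp add: r_def)
  have "(\<integral>\<^sup>+ \<omega>. ennreal (exp (\<kappa> * (U \<omega>)\<^sup>2)) \<partial>M)
      = (\<integral>\<^sup>+ \<omega>. (\<integral>\<^sup>+ g. ennreal (std_normal_density g * exp (r * U \<omega> * g)) \<partial>lborel) \<partial>M)"
    using r by (simp add: nn_integral_std_normal_exp power_mult_distrib)
  also have "\<dots> = (\<integral>\<^sup>+ g. (\<integral>\<^sup>+ \<omega>. ennreal (std_normal_density g * exp (r * U \<omega> * g)) \<partial>M) \<partial>lborel)"
    by (rule Fubini'[symmetric]) measurable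
  also have "\<dots> = (\<integral>\<^sup>+ g. ennreal (std_normal_density g) * (\<integral>\<^sup>+ \<omega>. ennreal (exp (r * g * U \<omega>)) \<partial>M) \<partial>lborel)"
    by (subst nn_integral_cmult[symmetric]) (auto simp: ennreal_mult ac_simps)
  also have "\<dots> \<le> (\<integral>\<^sup>+ g. ennreal (std_normal_density g) * ennreal (exp (\<beta> * (r * g)\<^sup>2)) \<partial>lborel)"
    by (intro nn_integral_mono mult_left_mono mgf) auto
  also have "\<dots> = (\<integral>\<^sup>+ g. ennreal (std_normal_density g * exp (2 * \<kappa> * \<beta> * g\<^sup>2)) \<partial>lborel)"
    by (simp add: ennreal_mult power_mult_distrib r mult.assoc mult.left_commute)
  also have "\<dots> = ennreal (1 / sqrt (1 - 2 * (2 * \<kappa> * \<beta>)))"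
    using assms by (intro nn_integral_std_normal_exp_square) auto
  also have "\<dots> \<le> ennreal (exp (4 * \<kappa> * \<beta>))"
    using inverse_sqrt_le_exp[of "4 * \<kappa> * \<beta>"] assms by (intro ennreal_leI) (auto simp: mult.assoc)
  finally show ?thesis .
qed

text \<open>Integrating out V with U fixed leaves the exponential of a multiple of U^2, to which
  \<open>exp_square_bound\<close> applies. This yields the near-orthogonality of two row
  combinations with disjoint supports.\<close>

lemma exp_product_bound:
  assumes ind: "indep_var borel U borel V"
    and mgfV: "\<And>s. (\<integral>\<^sup>+ \<omega>. ennreal (exp (s * V \<omega>)) \<partial>M) \<le> ennreal (exp (\<alpha> * s\<^sup>2))"
    and mgfU: "\<And>s. (\<integral>\<^sup>+ \<omega>. ennreal (exp (s * U \<omega>)) \<partial>M) \<le> ennreal (exp (\<beta> * s\<^sup>2))"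
    and "0 \<le> \<alpha>" "0 \<le> \<beta>" "16 * \<alpha> * \<beta> * s\<^sup>2 \<le> 1"
  shows "(\<integral>\<^sup>+ \<omega>. ennreal (exp (s * (U \<omega> * V \<omega>))) \<partial>M) \<le> ennreal (exp (4 * \<alpha> * \<beta> * s\<^sup>2))"
proof -
  have [measurable]: "U \<in> borel_measurable M" "V \<in> borel_measurable M"
    and eq: "distr M borel U \<Otimes>\<^sub>M distr M borel V = distr M (borel \<Otimes>\<^sub>M borel) (\<lambda>x. (U x, V x))"
    using ind unfolding indep_var_distribution_eq by auto
  interpret V: prob_space "distr M borel V" by (rule prob_space_distr) measurable
  have "(\<integral>\<^sup>+ \<omega>. ennreal (exp (s * (U \<omega> * V \<omega>))) \<partial>M)
      = (\<integral>\<^sup>+ p. ennreal (exp (s * (fst p * snd p))) \<partial>(distr M (borel \<Otimes>\<^sub>M borel) (\<lambda>x. (U x, V x))))"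
    by (subst nn_integral_distr) auto
  also have "\<dots> = (\<integral>\<^sup>+ u. (\<integral>\<^sup>+ v. ennreal (exp (s * (u * v))) \<partial>distr M borel V) \<partial>distr M borel U)"
    unfolding eq[symmetric] by (subst V.nn_integral_fst[symmetric]) auto
  also have "\<dots> = (\<integral>\<^sup>+ \<omega>. (\<integral>\<^sup>+ \<omega>'. ennreal (exp (s * U \<omega> * V \<omega>')) \<partial>M) \<partial>M)"
    by (subst nn_integral_distr) (auto simp: nn_integral_distr mult.assoc)
  also have "\<dots> \<le> (\<integral>\<^sup>+ \<omega>. ennreal (exp (\<alpha> * (s * U \<omega>)\<^sup>2)) \<partial>M)"
    by (intro nn_integral_mono mgfV)
  also have "\<dots> = (\<integral>\<^sup>+ \<omega>. ennreal (exp ((\<alpha> * s\<^sup>2) * (U \<omega>)\<^sup>2)) \<partial>M)"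
    by (simp add: power_mult_distrib mult.assoc)
  also have "\<dots> \<le> ennreal (exp (4 * (\<alpha> * s\<^sup>2) * \<beta>))"
    using assms by (intro exp_square_bound) (auto simp: algebra_simps)
  finally show ?thesis by (simp add: algebra_simps)
qed

end

locale subgaussian_family = prob_space M for M :: "'a measure" +
  fixes K :: real and I :: "'i set" and Y :: "'i \<Rightarrow> 'a \<Rightarrow> real"
  assumes finite_I: "finite I" and indep: "indep_vars (\<lambda>_. borel) Y I"
    and entry: "\<And>i. i \<in> I \<Longrightarrow> std_subgaussian M K (Y i)"
begin

definition lin :: "'i set \<Rightarrow> ('i \<Rightarrow> real) \<Rightarrow> 'a \<Rightarrow> real" where
  "lin J u \<omega> = (\<Sum>i\<in>J. u i * Y i \<omega>)"

lemma measurable_Y[measurable (raw)]: "i \<in> I \<Longrightarrow> Y i \<in> borel_measurable M"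
  using std_subgaussian.measurable_X[OF entry] .

lemma measurable_lin: "J \<subseteq> I \<Longrightarrow> lin J u \<in> borel_measurable M"
  unfolding lin_def[abs_def] by (intro borel_measurable_sum borel_measurable_times) (auto intro: measurable_Y)

lemma indep_blocks:
  assumes "finite L" and "\<And>j. j \<in> L \<Longrightarrow> B j \<subseteq> I" and "disjoint_family_on B L"
    and "\<And>j. j \<in> L \<Longrightarrow> F j \<in> borel_measurable (PiM (B j) (\<lambda>_. borel))"
  shows "indep_vars (\<lambda>_. borel) (\<lambda>j \<omega>. F j (restrict (\<lambda>i. Y i \<omega>) (B j))) L"
  using assms indep by (intro indep_vars_compose2[OF indep_vars_restrict]) auto

text \<open>Stated for arbitrary disjoint blocks because the blocks are the rows of the matrix in
  some estimates and its columns in others.\<close>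

lemma nn_integral_blocks:
  fixes F :: "'j \<Rightarrow> ('i \<Rightarrow> real) \<Rightarrow> real"
  assumes "finite L" and "\<And>j. j \<in> L \<Longrightarrow> B j \<subseteq> I" and "disjoint_family_on B L"
    and "\<And>j. j \<in> L \<Longrightarrow> F j \<in> borel_measurable (PiM (B j) (\<lambda>_. borel))"
    and "\<And>j y. j \<in> L \<Longrightarrow> 0 \<le> F j y"
  shows "(\<integral>\<^sup>+ \<omega>. ennreal (\<Prod>j\<in>L. F j (restrict (\<lambda>i. Y i \<omega>) (B j))) \<partial>M)
       = (\<Prod>j\<in>L. \<integral>\<^sup>+ \<omega>. ennreal (F j (restrict (\<lambda>i. Y i \<omega>) (B j))) \<partial>M)"
proof -
  have *: "indep_vars (\<lambda>_. borel) (\<lambda>j \<omega>. ennreal (F j (restrict (\<lambda>i. Y i \<omega>) (B j)))) L"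
    using indep_vars_compose2[OF indep_blocks[of L B F], of "\<lambda>_. ennreal" "\<lambda>_. borel"] assms by auto
  have "(\<integral>\<^sup>+ \<omega>. ennreal (\<Prod>j\<in>L. F j (restrict (\<lambda>i. Y i \<omega>) (B j))) \<partial>M)
      = (\<integral>\<^sup>+ \<omega>. (\<Prod>j\<in>L. ennreal (F j (restrict (\<lambda>i. Y i \<omega>) (B j)))) \<partial>M)"
    using assms by (simp add: prod_ennreal)
  also have "\<dots> = (\<Prod>j\<in>L. \<integral>\<^sup>+ \<omega>. ennreal (F j (restrict (\<lambda>i. Y i \<omega>) (B j))) \<partial>M)"
    using assms * by (intro indep_vars_nn_integral) auto
  finally show ?thesis .
qed

lemma indep_lin:
  assumes "J \<inter> J' = {}" "J \<subseteq> I" "J' \<subseteq> I"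
  shows "indep_var borel (lin J u) borel (lin J' v)"
proof -
  have "indep_var borel ((\<lambda>y. \<Sum>i\<in>J. u i * y i) \<circ> (\<lambda>\<omega>. restrict (\<lambda>i. Y i \<omega>) J))
                  borel ((\<lambda>y. \<Sum>i\<in>J'. v i * y i) \<circ> (\<lambda>\<omega>. restrict (\<lambda>i. Y i \<omega>) J'))"
    by (rule indep_var_compose[OF indep_var_restrict[OF indep assms]]) measurable
  then show ?thesis by (simp add: comp_def lin_def[abs_def])
qed

lemma exp_lin_prod:
  assumes "J \<subseteq> I"
  shows "(\<integral>\<^sup>+ \<omega>. ennreal (exp (s * lin J u \<omega>)) \<partial>M) = (\<Prod>i\<in>J. \<integral>\<^sup>+ \<omega>. ennreal (exp (s * u i * Y i \<omega>)) \<partial>M)"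
proof -
  have fin: "finite J" using assms finite_I finite_subset by auto
  have *: "indep_vars (\<lambda>_. borel) (\<lambda>i \<omega>. ennreal (exp (s * u i * Y i \<omega>))) J"
    using assms by (intro indep_vars_compose2[OF indep_vars_subset[OF indep]]) auto
  have "(\<integral>\<^sup>+ \<omega>. ennreal (exp (s * lin J u \<omega>)) \<partial>M) = (\<integral>\<^sup>+ \<omega>. (\<Prod>i\<in>J. ennreal (exp (s * u i * Y i \<omega>))) \<partial>M)"
    using fin by (simp add: lin_def sum_distrib_left exp_sum prod_ennreal mult.assoc)
  also have "\<dots> = (\<Prod>i\<in>J. \<integral>\<^sup>+ \<omega>. ennreal (exp (s * u i * Y i \<omega>)) \<partial>M)"
    using fin * by (intro indep_vars_nn_integral) auto
  finally show ?thesis .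
qed

lemma exp_lin_le:
  assumes "J \<subseteq> I" "(\<Sum>i\<in>J. (u i)\<^sup>2) \<le> B"
  shows "(\<integral>\<^sup>+ \<omega>. ennreal (exp (s * lin J u \<omega>)) \<partial>M) \<le> ennreal (exp (K\<^sup>2 * B * s\<^sup>2))"
proof -
  have fin: "finite J" using assms finite_I finite_subset by auto
  have "(\<integral>\<^sup>+ \<omega>. ennreal (exp (s * lin J u \<omega>)) \<partial>M) \<le> (\<Prod>i\<in>J. ennreal (exp (K\<^sup>2 * (s * u i)\<^sup>2)))"
    unfolding exp_lin_prod[OF assms(1)] using assms(1)
    by (intro prod_mono_ennreal std_subgaussian.mgf_bound entry) auto
  also have "\<dots> = ennreal (exp (\<Sum>i\<in>J. K\<^sup>2 * (s * u i)\<^sup>2))"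
    using fin by (simp add: prod_ennreal exp_sum)
  also have "(\<Sum>i\<in>J. K\<^sup>2 * (s * u i)\<^sup>2) = (K\<^sup>2 * s\<^sup>2) * (\<Sum>i\<in>J. (u i)\<^sup>2)"
    by (simp add: sum_distrib_left power_mult_distrib mult.assoc)
  also have "\<dots> \<le> (K\<^sup>2 * s\<^sup>2) * B" using assms by (intro mult_left_mono) auto
  also have "(K\<^sup>2 * s\<^sup>2) * B = K\<^sup>2 * B * s\<^sup>2" by simp
  finally show ?thesis by (simp add: ennreal_leI)
qed

lemma exp_lin_integrable: "J \<subseteq> I \<Longrightarrow> integrable M (\<lambda>\<omega>. exp (s * lin J u \<omega>))"
  using nn_integral_bound_imp_integrable(1)[OF _ _ exp_lin_le[OF _ order_refl]] measurable_lin by auto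

lemma exp_lin_square_le:
  assumes "J \<subseteq> I" "(\<Sum>i\<in>J. (u i)\<^sup>2) \<le> B" "0 \<le> \<kappa>" "16 * \<kappa> * (K\<^sup>2 * B) \<le> 1"
  shows "(\<integral>\<^sup>+ \<omega>. ennreal (exp (\<kappa> * (lin J u \<omega>)\<^sup>2)) \<partial>M) \<le> ennreal (exp (4 * \<kappa> * (K\<^sup>2 * B)))"
proof (rule exp_square_bound)
  have "0 \<le> (\<Sum>i\<in>J. (u i)\<^sup>2)" by (intro sum_nonneg) auto
  then show "0 \<le> K\<^sup>2 * B" using assms by auto
qed (use assms measurable_lin exp_lin_le in auto)

lemma exp_lin_product_le:
  assumes "J \<inter> J' = {}" "J \<subseteq> I" "J' \<subseteq> I" "(\<Sum>i\<in>J. (u i)\<^sup>2) \<le> B" "(\<Sum>i\<in>J'. (v i)\<^sup>2) \<le> B'"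
    and "16 * (K\<^sup>2 * B') * (K\<^sup>2 * B) * s\<^sup>2 \<le> 1"
  shows "(\<integral>\<^sup>+ \<omega>. ennreal (exp (s * (lin J u \<omega> * lin J' v \<omega>))) \<partial>M) \<le> ennreal (exp (4 * (K\<^sup>2 * B') * (K\<^sup>2 * B) * s\<^sup>2))"
proof (rule exp_product_bound[OF indep_lin])
  have "0 \<le> (\<Sum>i\<in>J. (u i)\<^sup>2)" "0 \<le> (\<Sum>i\<in>J'. (v i)\<^sup>2)" by (auto intro: sum_nonneg)
  then show "0 \<le> K\<^sup>2 * B" "0 \<le> K\<^sup>2 * B'" using assms by auto
qed (use assms exp_lin_le in auto)

end

text \<open>Half of 1 / (8 N) with N = 20 exp (K^2), the lower bound for the mean of |Y| obtained in
  \<open>lin_pos_part_ge\<close>.\<close>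

definition pos_part_const :: "real \<Rightarrow> real" where "pos_part_const K = 1 / (320 * exp (K\<^sup>2))"

lemma cubic_const_ge: "12 \<le> cubic_const K"
  by (simp add: cubic_const_def)

section \<open>Comparison of a single entry with the Gaussian\<close>

context std_subgaussian
begin

lemma mgf_ge_1: "1 \<le> expectation (\<lambda>\<omega>. exp (s * X \<omega>))"
proof -
  have "expectation (\<lambda>\<omega>. 1 + s * X \<omega>) \<le> expectation (\<lambda>\<omega>. exp (s * X \<omega>))"
    using integrable_exp integrable_X by (intro integral_mono) auto
  then show ?thesis using integrable_X mean by (simp add: prob_space)
qed

text \<open>The error appears as a relative change of the Gaussian exponent s^2 / 2. In this form
  the bounds multiply over the coordinates of a unit vector without loss, since the exponents add
  up.\<close>

lemma mgf_gaussian_bounds: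
  assumes "2 * (cubic_const K + 1) * \<bar>s\<bar> \<le> \<eta>" "\<eta> \<le> 1"
  shows "exp (s\<^sup>2 / 2 * (1 - \<eta>)) \<le> expectation (\<lambda>\<omega>. exp (s * X \<omega>))"
    and "expectation (\<lambda>\<omega>. exp (s * X \<omega>)) \<le> exp (s\<^sup>2 / 2 * (1 + \<eta>))"
proof -
  define C where "C = cubic_const K"
  have C: "12 \<le> C" using cubic_const_ge by (simp add: C_def)
  have h: "2 * (C * \<bar>s\<bar>) + 2 * \<bar>s\<bar> \<le> \<eta>" using assms by (simp add: C_def algebra_simps)
  have s1: "\<bar>s\<bar> \<le> 1" using h C assms(2) by (smt (verit) mult_nonneg_nonneg abs_ge_zero)
  have \<eta>0: "0 \<le> \<eta>" using h C by (smt (verit) mult_nonneg_nonneg abs_ge_zero)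
  have exps: "\<bar>expectation (\<lambda>\<omega>. exp (s * X \<omega>)) - 1 - s\<^sup>2 / 2\<bar> \<le> C * \<bar>s\<bar> * s\<^sup>2"
    using mgf_expansion[OF s1] by (simp add: C_def power3_eq_cube power2_eq_square mult.assoc)
  have "(2 * (C * \<bar>s\<bar>)) * s\<^sup>2 \<le> \<eta> * s\<^sup>2" using h by (intro mult_right_mono) auto
  then have "2 * (C * \<bar>s\<bar> * s\<^sup>2) \<le> \<eta> * s\<^sup>2" by (simp add: mult.assoc)
  then have "expectation (\<lambda>\<omega>. exp (s * X \<omega>)) \<le> 1 + s\<^sup>2 / 2 + \<eta> * s\<^sup>2 / 2"
    using exps by linarith
  also have "\<dots> = 1 + s\<^sup>2 / 2 * (1 + \<eta>)" by (simp add: algebra_simps add_divide_distrib)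
  also have "\<dots> \<le> exp (s\<^sup>2 / 2 * (1 + \<eta>))" by (rule exp_ge_add_one_self)
  finally show "expectation (\<lambda>\<omega>. exp (s * X \<omega>)) \<le> exp (s\<^sup>2 / 2 * (1 + \<eta>))" .
  \<comment> \<open>Here exp y \<le> 1 + y + y^2 and y^2 \<le> s^2 |s| / 4. The summand 1 in the
    factor \<open>cubic_const K + 1\<close> of the hypothesis pays for this term,
    \<open>cubic_const K\<close> for the Taylor error.\<close>
  define y where "y = s\<^sup>2 / 2 * (1 - \<eta>)"
  have s2: "s\<^sup>2 \<le> \<bar>s\<bar>" "s\<^sup>2 \<le> 1"
    using mult_right_mono[OF s1, of "\<bar>s\<bar>"] s1 by (auto simp: power2_eq_square abs_mult[symmetric])
  have y: "0 \<le> y" "y \<le> s\<^sup>2 / 2"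
    using assms(2) \<eta>0 mult_left_mono[of "1 - \<eta>" 1 "s\<^sup>2 / 2"] by (auto simp: y_def)
  have "y\<^sup>2 \<le> (s\<^sup>2 / 2)\<^sup>2" using y by (intro power_mono) auto
  also have "\<dots> \<le> s\<^sup>2 * \<bar>s\<bar> / 4"
    using mult_left_mono[OF s2(1), of "s\<^sup>2"] by (simp add: power2_eq_square)
  finally have y2: "y\<^sup>2 \<le> s\<^sup>2 * \<bar>s\<bar> / 4" .
  have "exp y \<le> 1 + y + y\<^sup>2" using y s2 by (intro exp_le_quadratic) auto
  also have "\<dots> \<le> 1 + s\<^sup>2 / 2 - \<eta> * s\<^sup>2 / 2 + s\<^sup>2 * \<bar>s\<bar> / 4"
    using y2 by (simp add: y_def field_simps)
  also have "\<dots> \<le> 1 + s\<^sup>2 / 2 - C * \<bar>s\<bar> * s\<^sup>2"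
  proof -
    define q where "q = \<bar>s\<bar> * s\<^sup>2"
    have "2 * (C * q) + 2 * q \<le> \<eta> * s\<^sup>2"
      using mult_right_mono[OF h, of "s\<^sup>2"] by (simp add: q_def algebra_simps)
    moreover have "0 \<le> q" by (simp add: q_def)
    ultimately have "q / 4 + C * q \<le> \<eta> * s\<^sup>2 / 2" by linarith
    then show ?thesis by (simp add: q_def algebra_simps)
  qed
  also have "\<dots> \<le> expectation (\<lambda>\<omega>. exp (s * X \<omega>))" using exps by linarith
  finally show "exp (s\<^sup>2 / 2 * (1 - \<eta>)) \<le> expectation (\<lambda>\<omega>. exp (s * X \<omega>))" by (simp add: y_def)
qed

text \<open>With numerator N and denominator D, the difference is (N - s D) / D and D is at least 1.
  The errors of N and of s D contribute C s^2 each, up to s^2 / 2, whence the constant 3 C.\<close>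

lemma tilted_mean_ratio:
  assumes "\<bar>s\<bar> \<le> 1"
  shows "\<bar>expectation (\<lambda>\<omega>. X \<omega> * exp (s * X \<omega>)) / expectation (\<lambda>\<omega>. exp (s * X \<omega>)) - s\<bar> \<le> 3 * cubic_const K * s\<^sup>2"
proof -
  define C where "C = cubic_const K"
  define D where "D = expectation (\<lambda>\<omega>. exp (s * X \<omega>))"
  define N where "N = expectation (\<lambda>\<omega>. X \<omega> * exp (s * X \<omega>))"
  have C: "12 \<le> C" using cubic_const_ge by (simp add: C_def)
  have D: "1 \<le> D" using mgf_ge_1 by (simp add: D_def)
  have "\<bar>D - 1 - s\<^sup>2 / 2\<bar> \<le> C * \<bar>s\<bar>^3" using mgf_expansion[OF assms] by (simp add: D_def C_def)
  moreover have "C * \<bar>s\<bar>^3 \<le> C * s\<^sup>2"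
    using assms C mult_right_mono[OF assms, of "s\<^sup>2"]
    by (intro mult_left_mono) (auto simp: power3_eq_cube power2_eq_square mult.assoc)
  ultimately have "\<bar>D - 1\<bar> \<le> C * s\<^sup>2 + s\<^sup>2 / 2" using zero_le_power2[of s] by linarith
  then have sD: "\<bar>s\<bar> * \<bar>D - 1\<bar> \<le> 1 * (C * s\<^sup>2 + s\<^sup>2 / 2)" using assms by (intro mult_mono) auto
  have Ns: "\<bar>N - s\<bar> \<le> C * s\<^sup>2" using tilted_mean_expansion[OF assms] by (simp add: N_def C_def)
  have "N - s * D = (N - s) - s * (D - 1)" by (simp add: algebra_simps)
  then have "\<bar>N - s * D\<bar> \<le> \<bar>N - s\<bar> + \<bar>s\<bar> * \<bar>D - 1\<bar>" by (metis abs_mult abs_triangle_ineq4)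
  also have "\<dots> \<le> C * s\<^sup>2 + 1 * (C * s\<^sup>2 + s\<^sup>2 / 2)" using sD Ns by (rule add_mono[rotated])
  also have "\<dots> \<le> 3 * (C * s\<^sup>2)" using C mult_right_mono[of "1/2" C "s\<^sup>2"] by simp
  finally have "\<bar>N - s * D\<bar> \<le> 3 * (C * s\<^sup>2)" .
  then have "\<bar>N - s * D\<bar> \<le> 3 * C * s\<^sup>2" by simp
  then have "\<bar>N - s * D\<bar> / D \<le> 3 * C * s\<^sup>2 / 1" using D by (intro frac_le) auto
  moreover have "N / D - s = (N - s * D) / D" using D by (simp add: field_simps)
  ultimately show ?thesis using D unfolding C_def[symmetric] D_def[symmetric] N_def[symmetric]
    by (simp add: abs_divide)
qed

end

section \<open>Moments and tilts of linear forms\<close>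

context subgaussian_family
begin

lemma integrable_Y: "i \<in> I \<Longrightarrow> integrable M (Y i)"
  using std_subgaussian.integrable_X[OF entry] .

lemma expectation_Y: "i \<in> I \<Longrightarrow> expectation (Y i) = 0"
  using std_subgaussian.mean[OF entry] .

lemma integrable_lin: "J \<subseteq> I \<Longrightarrow> integrable M (lin J u)"
  unfolding lin_def[abs_def] by (intro Bochner_Integration.integrable_sum integrable_mult_right) (auto intro: integrable_Y)

lemma expectation_lin: "J \<subseteq> I \<Longrightarrow> expectation (lin J u) = 0"
  unfolding lin_def[abs_def]
  by (subst Bochner_Integration.integral_sum) (auto intro!: integrable_Y sum.neutral simp: expectation_Y subset_iff)

lemma expectation_Y_times_Y:
  assumes "i \<in> I" "j \<in> I"
  shows "integrable M (\<lambda>\<omega>. Y i \<omega> * Y j \<omega>)"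
    and "expectation (\<lambda>\<omega>. Y i \<omega> * Y j \<omega>) = (if i = j then 1 else 0)"
proof -
  have "integrable M (\<lambda>\<omega>. Y i \<omega> * Y j \<omega>) \<and> expectation (\<lambda>\<omega>. Y i \<omega> * Y j \<omega>) = (if i = j then 1 else 0)"
  proof (cases "i = j")
    case True
    then show ?thesis
      using std_subgaussian.integrable_square[OF entry[OF assms(1)]] std_subgaussian.second_moment[OF entry[OF assms(1)]]
      by (simp add: power2_eq_square)
  next
    case False
    then have "indep_var borel (lin {i} (\<lambda>_. 1)) borel (lin {j} (\<lambda>_. 1))"
      using assms by (intro indep_lin) auto
    moreover have "lin {i} (\<lambda>_. 1) = Y i" "lin {j} (\<lambda>_. 1) = Y j" by (auto simp: lin_def)
    ultimately have "indep_var borel (Y i) borel (Y j)" by simp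
    then show ?thesis
      using indep_var_lebesgue_integral[of "Y i" "Y j"] indep_var_integrable[of "Y i" "Y j"] assms False
      by (simp add: integrable_Y expectation_Y)
  qed
  then show "integrable M (\<lambda>\<omega>. Y i \<omega> * Y j \<omega>)"
    and "expectation (\<lambda>\<omega>. Y i \<omega> * Y j \<omega>) = (if i = j then 1 else 0)" by auto
qed

lemma lin_second_moment:
  assumes "J \<subseteq> I"
  shows "integrable M (\<lambda>\<omega>. (lin J u \<omega>)\<^sup>2)"
    and "expectation (\<lambda>\<omega>. (lin J u \<omega>)\<^sup>2) = (\<Sum>i\<in>J. (u i)\<^sup>2)"
proof -
  have fin: "finite J" using assms finite_I finite_subset by auto
  have eq: "(lin J u \<omega>)\<^sup>2 = (\<Sum>i\<in>J. \<Sum>j\<in>J. (u i * u j) * (Y i \<omega> * Y j \<omega>))" for \<omega>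
    unfolding lin_def power2_eq_square sum_product by (intro sum.cong) auto
  have int: "integrable M (\<lambda>\<omega>. (u i * u j) * (Y i \<omega> * Y j \<omega>))" if "i \<in> J" "j \<in> J" for i j
    using that assms by (intro integrable_mult_right expectation_Y_times_Y) auto
  show "integrable M (\<lambda>\<omega>. (lin J u \<omega>)\<^sup>2)"
    unfolding eq by (intro Bochner_Integration.integrable_sum int)
  have "expectation (\<lambda>\<omega>. (lin J u \<omega>)\<^sup>2)
      = (\<Sum>i\<in>J. \<Sum>j\<in>J. expectation (\<lambda>\<omega>. (u i * u j) * (Y i \<omega> * Y j \<omega>)))"
    unfolding eq using int by (simp add: Bochner_Integration.integral_sum)
  also have "\<dots> = (\<Sum>i\<in>J. \<Sum>j\<in>J. if i = j then u i * u j else 0)"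
    using assms by (intro sum.cong) (auto simp: expectation_Y_times_Y(2) subset_iff)
  also have "\<dots> = (\<Sum>i\<in>J. (u i)\<^sup>2)" using fin by (simp add: power2_eq_square)
  finally show "expectation (\<lambda>\<omega>. (lin J u \<omega>)\<^sup>2) = (\<Sum>i\<in>J. (u i)\<^sup>2)" .
qed

lemma expectation_exp_lin_le:
  assumes "J \<subseteq> I" "(\<Sum>i\<in>J. (u i)\<^sup>2) \<le> B"
  shows "expectation (\<lambda>\<omega>. exp (s * lin J u \<omega>)) \<le> exp (K\<^sup>2 * B * s\<^sup>2)"
  using nn_integral_bound_imp_integrable(2)[OF _ _ exp_lin_le[OF assms]] measurable_lin[OF assms(1)] by auto

lemma lin_fourth_moment:
  assumes "J \<subseteq> I" "(\<Sum>i\<in>J. (u i)\<^sup>2) \<le> 1"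
  shows "integrable M (\<lambda>\<omega>. (lin J u \<omega>)^4)"
    and "expectation (\<lambda>\<omega>. (lin J u \<omega>)^4) \<le> 48 * exp (K\<^sup>2)"
proof -
  have pt: "y^4 \<le> 24 * (exp (1 * y) + exp (- 1 * y))" for y :: real
  proof -
    have "\<bar>y\<bar>^4 \<le> 24 * exp \<bar>y\<bar>" using power_le_fact_exp[of "\<bar>y\<bar>" 4] by (simp add: fact_numeral)
    also have "exp \<bar>y\<bar> \<le> exp (1 * y) + exp (- 1 * y)" by (cases "0 \<le> y") auto
    finally show ?thesis by simp
  qed
  have int: "integrable M (\<lambda>\<omega>. 24 * (exp (1 * lin J u \<omega>) + exp (- 1 * lin J u \<omega>)))"
    using exp_lin_integrable[OF assms(1), of 1 u] exp_lin_integrable[OF assms(1), of "-1" u] by auto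
  show *: "integrable M (\<lambda>\<omega>. (lin J u \<omega>)^4)"
  proof (rule Bochner_Integration.integrable_bound[OF int])
    show "AE \<omega> in M. norm ((lin J u \<omega>)^4) \<le> norm (24 * (exp (1 * lin J u \<omega>) + exp (- 1 * lin J u \<omega>)))"
      using pt by (intro AE_I2) (metis abs_of_nonneg order_trans real_norm_def zero_le_even_power even_numeral)
  qed (use measurable_lin[OF assms(1)] in auto)
  have "expectation (\<lambda>\<omega>. (lin J u \<omega>)^4) \<le> expectation (\<lambda>\<omega>. 24 * (exp (1 * lin J u \<omega>) + exp (- 1 * lin J u \<omega>)))"
    using pt by (intro integral_mono * int)
  also have "\<dots> = 24 * (expectation (\<lambda>\<omega>. exp (1 * lin J u \<omega>)) + expectation (\<lambda>\<omega>. exp (- 1 * lin J u \<omega>)))"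
    using exp_lin_integrable[OF assms(1), of 1 u] exp_lin_integrable[OF assms(1), of "-1" u] by simp
  also have "\<dots> \<le> 48 * exp (K\<^sup>2)"
    using expectation_exp_lin_le[OF assms, of 1] expectation_exp_lin_le[OF assms, of "-1"] by simp
  finally show "expectation (\<lambda>\<omega>. (lin J u \<omega>)^4) \<le> 48 * exp (K\<^sup>2)" .
qed

text \<open>Since the form is centered, its positive part has half the mean of |Y|, and |y| \<ge>
  y^2 / N - y^4 / N^3 for every N > 0. For the chosen N the second moment, at least 1/4, outweighs
  the fourth moment.\<close>

lemma lin_pos_part_ge:
  assumes "J \<subseteq> I" "(\<Sum>i\<in>J. (u i)\<^sup>2) \<le> 1" "1 / 4 \<le> (\<Sum>i\<in>J. (u i)\<^sup>2)"
  shows "pos_part_const K \<le> expectation (\<lambda>\<omega>. max 0 (lin J u \<omega>))"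
proof -
  define N where "N = 20 * exp (K\<^sup>2)"
  have N: "0 < N" by (simp add: N_def)
  have pt: "y\<^sup>2 / N - y^4 / N^3 \<le> \<bar>y\<bar>" for y :: real
  proof (cases "\<bar>y\<bar> \<le> N")
    case True
    have "y\<^sup>2 \<le> N * \<bar>y\<bar>" using mult_right_mono[OF True, of "\<bar>y\<bar>"] by (simp add: power2_eq_square)
    then have "y\<^sup>2 / N \<le> \<bar>y\<bar>" using N by (simp add: field_simps)
    moreover have "0 \<le> y^4 / N^3" using N by simp
    ultimately show ?thesis by linarith
  next
    case False
    then have "N\<^sup>2 \<le> \<bar>y\<bar>\<^sup>2" using N by (intro power_mono) auto
    then have "N\<^sup>2 * y\<^sup>2 \<le> y\<^sup>2 * y\<^sup>2" by (intro mult_right_mono) auto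
    then have "y\<^sup>2 / N \<le> y^4 / N^3" using N
      by (simp add: field_simps power2_eq_square power3_eq_cube power4_eq_xxxx)
    then show ?thesis by linarith
  qed
  have "1 / (8 * N) \<le> (1/4) / N - 48 * exp (K\<^sup>2) / N^3"
  proof -
    have "8 * 48 * exp (K\<^sup>2) \<le> N\<^sup>2"
    proof -
      have "1 \<le> exp (K\<^sup>2)" by simp
      then have "384 \<le> 400 * exp (K\<^sup>2)" by linarith
      then have "384 * exp (K\<^sup>2) \<le> 400 * exp (K\<^sup>2) * exp (K\<^sup>2)" by (intro mult_right_mono) auto
      then show ?thesis by (simp add: N_def power2_eq_square)
    qed
    then have "8 * (48 * exp (K\<^sup>2)) * N \<le> N\<^sup>2 * N" using N by (intro mult_right_mono) auto
    then show ?thesis using N by (simp add: field_simps power2_eq_square power3_eq_cube)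
  qed
  also have "\<dots> \<le> (\<Sum>i\<in>J. (u i)\<^sup>2) / N - expectation (\<lambda>\<omega>. (lin J u \<omega>)^4) / N^3"
    using assms lin_fourth_moment[OF assms(1,2)] N by (intro diff_mono divide_right_mono) auto
  also have "\<dots> = expectation (\<lambda>\<omega>. (lin J u \<omega>)\<^sup>2 / N - (lin J u \<omega>)^4 / N^3)"
    using lin_second_moment[OF assms(1)] lin_fourth_moment[OF assms(1,2)] by simp
  also have "\<dots> \<le> expectation (\<lambda>\<omega>. \<bar>lin J u \<omega>\<bar>)"
    using lin_second_moment[OF assms(1)] lin_fourth_moment[OF assms(1,2)] integrable_lin[OF assms(1)] pt
    by (intro integral_mono) auto
  also have "\<dots> = expectation (\<lambda>\<omega>. 2 * max 0 (lin J u \<omega>) - lin J u \<omega>)"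
    by (intro Bochner_Integration.integral_cong) (auto simp: max_def)
  also have "\<dots> = 2 * expectation (\<lambda>\<omega>. max 0 (lin J u \<omega>))"
    using integrable_lin[OF assms(1)] expectation_lin[OF assms(1)] by simp
  finally show ?thesis by (simp add: N_def pos_part_const_def)
qed

lemma expectation_exp_lin_prod:
  assumes "J \<subseteq> I"
  shows "expectation (\<lambda>\<omega>. exp (s * lin J u \<omega>)) = (\<Prod>i\<in>J. expectation (\<lambda>\<omega>. exp (s * u i * Y i \<omega>)))"
proof -
  have fin: "finite J" using assms finite_I finite_subset by auto
  have *: "indep_vars (\<lambda>_. borel) (\<lambda>i \<omega>. exp (s * u i * Y i \<omega>)) J"
    using assms by (intro indep_vars_compose2[OF indep_vars_subset[OF indep]]) auto
  have "expectation (\<lambda>\<omega>. exp (s * lin J u \<omega>)) = expectation (\<lambda>\<omega>. \<Prod>i\<in>J. exp (s * u i * Y i \<omega>))"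
    using fin by (simp add: lin_def sum_distrib_left exp_sum mult.assoc)
  also have "\<dots> = (\<Prod>i\<in>J. expectation (\<lambda>\<omega>. exp (s * u i * Y i \<omega>)))"
    using fin * assms std_subgaussian.integrable_exp[OF entry]
    by (intro indep_vars_lebesgue_integral) auto
  finally show ?thesis .
qed

lemma exp_lin_gaussian_bounds:
  assumes "J \<subseteq> I" "(\<Sum>i\<in>J. (u i)\<^sup>2) = 1" "\<eta> \<le> 1"
    and "\<And>i. i \<in> J \<Longrightarrow> 2 * (cubic_const K + 1) * \<bar>s * u i\<bar> \<le> \<eta>"
  shows "exp (s\<^sup>2 / 2 * (1 - \<eta>)) \<le> expectation (\<lambda>\<omega>. exp (s * lin J u \<omega>))"
    and "expectation (\<lambda>\<omega>. exp (s * lin J u \<omega>)) \<le> exp (s\<^sup>2 / 2 * (1 + \<eta>))"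
proof -
  have fin: "finite J" using assms finite_I finite_subset by auto
  have *: "exp (s\<^sup>2 / 2 * a) = (\<Prod>i\<in>J. exp ((s * u i)\<^sup>2 / 2 * a))" for a
  proof -
    have "(\<Sum>i\<in>J. (s * u i)\<^sup>2 / 2 * a) = s\<^sup>2 / 2 * a * (\<Sum>i\<in>J. (u i)\<^sup>2)"
      by (simp add: sum_distrib_left power_mult_distrib algebra_simps)
    then show ?thesis using fin assms(2) by (simp add: exp_sum[symmetric])
  qed
  have e: "std_subgaussian M K (Y i)" if "i \<in> J" for i using that assms(1) entry by auto
  note b = std_subgaussian.mgf_gaussian_bounds[OF e assms(4) assms(3)]
  show "exp (s\<^sup>2 / 2 * (1 - \<eta>)) \<le> expectation (\<lambda>\<omega>. exp (s * lin J u \<omega>))"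
    unfolding * expectation_exp_lin_prod[OF assms(1)] using b(1) by (intro prod_mono conjI) auto
  show "expectation (\<lambda>\<omega>. exp (s * lin J u \<omega>)) \<le> exp (s\<^sup>2 / 2 * (1 + \<eta>))"
    unfolding * expectation_exp_lin_prod[OF assms(1)] using b(2) by (intro prod_mono conjI) auto
qed

lemma exp_lin_pos: "J \<subseteq> I \<Longrightarrow> 1 \<le> expectation (\<lambda>\<omega>. exp (s * lin J u \<omega>))"
  unfolding expectation_exp_lin_prod using std_subgaussian.mgf_ge_1[OF entry]
  by (intro prod_ge_1) auto

text \<open>Tilting by a linear form preserves independence, so the factors of all coordinates other
  than j cancel against the normalization.\<close>

lemma tilted_entry:
  assumes "J \<subseteq> I" "j \<in> J" "\<bar>s * u j\<bar> \<le> 1"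
  shows "integrable M (\<lambda>\<omega>. exp (s * lin J u \<omega>) * Y j \<omega>)"
    and "expectation (\<lambda>\<omega>. exp (s * lin J u \<omega>) * Y j \<omega>) = expectation (\<lambda>\<omega>. exp (s * lin J u \<omega>)) *
      (expectation (\<lambda>\<omega>. Y j \<omega> * exp (s * u j * Y j \<omega>)) / expectation (\<lambda>\<omega>. exp (s * u j * Y j \<omega>)))"
proof -
  have fin: "finite J" using assms finite_I finite_subset by auto
  define f where "f i \<omega> = (if i = j then Y j \<omega> else 1) * exp (s * u i * Y i \<omega>)" for i \<omega>
  have *: "indep_vars (\<lambda>_. borel) f J"
  proof -
    have "indep_vars (\<lambda>_. borel) (\<lambda>i \<omega>. (\<lambda>i y. (if i = j then y else 1) * exp (s * u i * y)) i (Y i \<omega>)) J"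
      using assms by (intro indep_vars_compose2[OF indep_vars_subset[OF indep]]) auto
    then show ?thesis by (rule iffD1[OF indep_vars_cong, rotated 3]) (auto simp: f_def fun_eq_iff)
  qed
  have int: "integrable M (f i)" if "i \<in> J" for i
    using that assms std_subgaussian.integrable_exp[OF entry] std_subgaussian.integrable_X_exp[OF entry]
    by (cases "i = j") (auto simp: f_def[abs_def])
  have eq: "exp (s * lin J u \<omega>) * Y j \<omega> = (\<Prod>i\<in>J. f i \<omega>)" for \<omega>
    using fin assms by (simp add: lin_def sum_distrib_left exp_sum f_def prod.distrib prod.delta mult.assoc)
  show "integrable M (\<lambda>\<omega>. exp (s * lin J u \<omega>) * Y j \<omega>)"
    unfolding eq using fin * int by (intro indep_vars_integrable) auto
  have "expectation (\<lambda>\<omega>. exp (s * lin J u \<omega>) * Y j \<omega>) = (\<Prod>i\<in>J. expectation (f i))"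
    unfolding eq using fin * int by (intro indep_vars_lebesgue_integral) auto
  also have "\<dots> = expectation (f j) * (\<Prod>i\<in>J - {j}. expectation (\<lambda>\<omega>. exp (s * u i * Y i \<omega>)))"
    using fin assms by (subst prod.remove[of J j]) (auto simp: f_def[abs_def] intro!: prod.cong)
  also have "\<dots> = expectation (f j) * ((\<Prod>i\<in>J. expectation (\<lambda>\<omega>. exp (s * u i * Y i \<omega>))) / expectation (\<lambda>\<omega>. exp (s * u j * Y j \<omega>)))"
  proof -
    have "expectation (\<lambda>\<omega>. exp (s * u j * Y j \<omega>)) \<noteq> 0"
      using std_subgaussian.mgf_ge_1[OF entry, of j "s * u j"] assms by auto
    then show ?thesis using fin assms by (simp add: prod.remove[of J j])
  qed
  finally show "expectation (\<lambda>\<omega>. exp (s * lin J u \<omega>) * Y j \<omega>) = expectation (\<lambda>\<omega>. exp (s * lin J u \<omega>)) *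
      (expectation (\<lambda>\<omega>. Y j \<omega> * exp (s * u j * Y j \<omega>)) / expectation (\<lambda>\<omega>. exp (s * u j * Y j \<omega>)))"
    by (simp add: expectation_exp_lin_prod[OF assms(1)] f_def[abs_def] mult.commute)
qed

text \<open>Coordinate j errs by order (s u_j)^2 |v_j|. One factor |u_j| is bounded by
  \<open>r\<close>, and Cauchy-Schwarz bounds the sum of |u_j| |v_j| by 1. Flatness of the tilting
  direction is thus what replaces Gaussianity, uniformly in v.\<close>

lemma tilted_lin:
  assumes "J \<subseteq> I" "(\<Sum>i\<in>J. (u i)\<^sup>2) \<le> 1" "(\<Sum>i\<in>J. (v i)\<^sup>2) \<le> 1"
    and r: "\<And>i. i \<in> J \<Longrightarrow> \<bar>u i\<bar> \<le> r" "0 \<le> r" "\<bar>s\<bar> * r \<le> 1"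
  shows "integrable M (\<lambda>\<omega>. exp (s * lin J u \<omega>) * lin J v \<omega>)"
    and "\<bar>expectation (\<lambda>\<omega>. exp (s * lin J u \<omega>) * lin J v \<omega>) / expectation (\<lambda>\<omega>. exp (s * lin J u \<omega>))
        - s * (\<Sum>i\<in>J. u i * v i)\<bar> \<le> 3 * cubic_const K * s\<^sup>2 * r"
proof -
  have fin: "finite J" using assms finite_I finite_subset by auto
  define P where "P = expectation (\<lambda>\<omega>. exp (s * lin J u \<omega>))"
  define \<mu> where "\<mu> j = expectation (\<lambda>\<omega>. Y j \<omega> * exp (s * u j * Y j \<omega>)) / expectation (\<lambda>\<omega>. exp (s * u j * Y j \<omega>))" for j
  have P: "1 \<le> P" using exp_lin_pos[OF assms(1)] by (simp add: P_def)
  have su: "\<bar>s * u j\<bar> \<le> 1" if "j \<in> J" for j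
    using mult_left_mono[OF r(1)[OF that], of "\<bar>s\<bar>"] r(3) by (simp add: abs_mult)
  have eq: "exp (s * lin J u \<omega>) * lin J v \<omega> = (\<Sum>j\<in>J. v j * (exp (s * lin J u \<omega>) * Y j \<omega>))" for \<omega>
    by (simp add: lin_def[of J v] sum_distrib_left algebra_simps)
  have int: "integrable M (\<lambda>\<omega>. v j * (exp (s * lin J u \<omega>) * Y j \<omega>))" if "j \<in> J" for j
    using that assms(1) su by (intro integrable_mult_right tilted_entry(1)) auto
  show "integrable M (\<lambda>\<omega>. exp (s * lin J u \<omega>) * lin J v \<omega>)"
    unfolding eq using int by (intro Bochner_Integration.integrable_sum) auto
  have "expectation (\<lambda>\<omega>. exp (s * lin J u \<omega>) * lin J v \<omega>) = (\<Sum>j\<in>J. v j * (P * \<mu> j))"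
    unfolding eq using int su assms(1) by (simp add: Bochner_Integration.integral_sum tilted_entry(2) P_def \<mu>_def)
  also have "\<dots> = P * (\<Sum>j\<in>J. v j * \<mu> j)" by (simp add: sum_distrib_left algebra_simps)
  finally have "expectation (\<lambda>\<omega>. exp (s * lin J u \<omega>) * lin J v \<omega>) / P = (\<Sum>j\<in>J. v j * \<mu> j)"
    using P by simp
  then have "expectation (\<lambda>\<omega>. exp (s * lin J u \<omega>) * lin J v \<omega>) / P - s * (\<Sum>i\<in>J. u i * v i)
      = (\<Sum>j\<in>J. v j * (\<mu> j - s * u j))"
    by (simp add: sum_distrib_left sum_subtractf algebra_simps)
  also have "\<bar>\<dots>\<bar> \<le> (\<Sum>j\<in>J. 3 * cubic_const K * s\<^sup>2 * r * (\<bar>u j\<bar> * \<bar>v j\<bar>))"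
  proof (intro order_trans[OF sum_abs] sum_mono)
    fix j assume j: "j \<in> J"
    have "\<bar>v j * (\<mu> j - s * u j)\<bar> \<le> \<bar>v j\<bar> * (3 * cubic_const K * (s * u j)\<^sup>2)"
      unfolding abs_mult using std_subgaussian.tilted_mean_ratio[OF entry su[OF j], of j] j assms(1)
      by (intro mult_left_mono) (auto simp: \<mu>_def)
    also have "\<dots> = 3 * cubic_const K * s\<^sup>2 * \<bar>u j\<bar> * (\<bar>u j\<bar> * \<bar>v j\<bar>)"
      by (simp add: power2_eq_square algebra_simps)
    also have "\<dots> \<le> 3 * cubic_const K * s\<^sup>2 * r * (\<bar>u j\<bar> * \<bar>v j\<bar>)"
      using r(1)[OF j] cubic_const_ge[of K] by (intro mult_right_mono mult_left_mono) auto
    finally show "\<bar>v j * (\<mu> j - s * u j)\<bar> \<le> 3 * cubic_const K * s\<^sup>2 * r * (\<bar>u j\<bar> * \<bar>v j\<bar>)" .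
  qed
  also have "\<dots> = 3 * cubic_const K * s\<^sup>2 * r * (\<Sum>j\<in>J. \<bar>u j\<bar> * \<bar>v j\<bar>)" by (simp add: sum_distrib_left)
  also have "\<dots> \<le> 3 * cubic_const K * s\<^sup>2 * r * 1"
  proof (intro mult_left_mono)
    have "(\<Sum>j\<in>J. \<bar>u j\<bar> * \<bar>v j\<bar>) \<le> L2_set u J * L2_set v J" by (rule L2_set_mult_ineq)
    also have "\<dots> \<le> 1 * 1" using assms by (intro mult_mono) (auto simp: L2_set_def intro: sum_nonneg)
    finally show "(\<Sum>j\<in>J. \<bar>u j\<bar> * \<bar>v j\<bar>) \<le> 1" by simp
    show "0 \<le> 3 * cubic_const K * s\<^sup>2 * r" using cubic_const_ge[of K] r by simp
  qed
  finally show "\<bar>expectation (\<lambda>\<omega>. exp (s * lin J u \<omega>) * lin J v \<omega>) / expectation (\<lambda>\<omega>. exp (s * lin J u \<omega>))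
        - s * (\<Sum>i\<in>J. u i * v i)\<bar> \<le> 3 * cubic_const K * s\<^sup>2 * r" by (simp add: P_def)
qed

end

section \<open>Repairing violated constraints\<close>

text \<open>A decoupling step: it replaces a sum over distinct pairs by a sum between disjoint sets,
  where independence can be used. Each new vertex is put on the side that catches at least half of
  its connections to the earlier ones; the weights may have any sign.\<close>

lemma max_cut:
  fixes g :: "'i \<Rightarrow> 'i \<Rightarrow> real"
  assumes "finite S"
  shows "\<exists>T\<subseteq>S. (\<Sum>i\<in>S. \<Sum>k\<in>S - {i}. g i k) / 2 \<le> (\<Sum>i\<in>T. \<Sum>k\<in>S - T. g i k + g k i)"
  using assms
proof (induction S rule: finite_induct)
  case empty
  then show ?case by auto
next
  case (insert v S)
  then obtain T where T: "T \<subseteq> S" "(\<Sum>i\<in>S. \<Sum>k\<in>S - {i}. g i k) / 2 \<le> (\<Sum>i\<in>T. \<Sum>k\<in>S - T. g i k + g k i)"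
    by blast
  let ?cut = "\<lambda>S T. (\<Sum>i\<in>T. \<Sum>k\<in>S - T. g i k + g k i)"
  have finT: "finite T" using T insert finite_subset by auto
  have vT: "v \<notin> T" using T insert by auto
  have "(\<Sum>i\<in>insert v S. \<Sum>k\<in>insert v S - {i}. g i k)
      = (\<Sum>k\<in>S. g v k) + (\<Sum>i\<in>S. \<Sum>k\<in>insert v (S - {i}). g i k)"
  proof -
    have "insert v S - {i} = insert v (S - {i})" if "i \<in> S" for i using that insert by auto
    moreover have "insert v S - {v} = S" using insert by auto
    ultimately show ?thesis using insert by (simp cong: sum.cong)
  qed
  also have "\<dots> = (\<Sum>i\<in>S. \<Sum>k\<in>S - {i}. g i k) + (\<Sum>k\<in>S. g v k + g k v)"
    using insert by (simp add: sum.distrib)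
  also have "(\<Sum>k\<in>S. g v k + g k v) = (\<Sum>k\<in>S - T. g v k + g k v) + (\<Sum>k\<in>T. g v k + g k v)"
    using T insert by (intro sum.subset_diff) auto
  finally have tot: "(\<Sum>i\<in>insert v S. \<Sum>k\<in>insert v S - {i}. g i k) = (\<Sum>i\<in>S. \<Sum>k\<in>S - {i}. g i k)
      + ((\<Sum>k\<in>S - T. g v k + g k v) + (\<Sum>k\<in>T. g v k + g k v))" .
  have "insert v S - insert v T = S - T" using insert vT by auto
  then have c1: "?cut (insert v S) (insert v T) = ?cut S T + (\<Sum>k\<in>S - T. g v k + g k v)"
    using finT vT by simp
  have "insert v S - T = insert v (S - T)" using vT by auto
  then have c2: "?cut (insert v S) T = ?cut S T + (\<Sum>k\<in>T. g v k + g k v)"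
    using insert by (simp add: sum.distrib algebra_simps)
  show ?case
  proof (cases "(\<Sum>k\<in>T. g v k + g k v) \<le> (\<Sum>k\<in>S - T. g v k + g k v)")
    case True
    then have "(\<Sum>i\<in>insert v S. \<Sum>k\<in>insert v S - {i}. g i k) / 2 \<le> ?cut (insert v S) (insert v T)"
      unfolding tot c1 using T(2) by argo
    then show ?thesis using T(1) by (intro exI[of _ "insert v T"]) auto
  next
    case False
    then have "(\<Sum>i\<in>insert v S. \<Sum>k\<in>insert v S - {i}. g i k) / 2 \<le> ?cut (insert v S) T"
      unfolding tot c2 using T(2) by argo
    then show ?thesis using T(1) by (intro exI[of _ T]) auto
  qed
qed

text \<open>Lowering one positive entry by one cannot carry the squared norm from above 4 Q to below
  Q, so the descent cannot jump over this window. In \<open>lp_correction\<close> it brings a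
  hypothetically large overshoot vector back into the range covered by the union bound.\<close>

lemma nat_vector_truncate:
  fixes b :: "'i \<Rightarrow> nat"
  assumes "finite S" "1 \<le> Q" "Q \<le> (\<Sum>i\<in>S. (b i)\<^sup>2)"
  shows "\<exists>d. (\<forall>i. d i \<le> b i) \<and> Q \<le> (\<Sum>i\<in>S. (d i)\<^sup>2) \<and> (\<Sum>i\<in>S. (d i)\<^sup>2) \<le> 4 * Q"
  using assms(3)
proof (induction "\<Sum>i\<in>S. b i" arbitrary: b rule: less_induct)
  case less
  show ?case
  proof (cases "(\<Sum>i\<in>S. (b i)\<^sup>2) \<le> 4 * Q")
    case True
    then show ?thesis using less.prems by blast
  next
    case False
    then have "(\<Sum>i\<in>S. (b i)\<^sup>2) \<noteq> 0" by simp
    then obtain i where i: "i \<in> S" "b i \<noteq> 0" using assms(1) by auto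
    define e where "e = b(i := b i - 1)"
    have split: "(\<Sum>k\<in>S. f (b k)) = f (b i) + (\<Sum>k\<in>S - {i}. f (b k))"
      "(\<Sum>k\<in>S. f (e k)) = f (b i - 1) + (\<Sum>k\<in>S - {i}. f (b k))" for f :: "nat \<Rightarrow> nat"
      using i assms(1) by (simp_all add: sum.remove[of S i] e_def)
    have "(\<Sum>k\<in>S. e k) < (\<Sum>k\<in>S. b k)"
      using i split(1)[of "\<lambda>x. x"] split(2)[of "\<lambda>x. x"] by simp
    moreover have "Q \<le> (\<Sum>k\<in>S. (e k)\<^sup>2)"
    proof -
      define R where "R = (\<Sum>k\<in>S - {i}. (b k)\<^sup>2)"
      obtain x where x: "b i = Suc x" using i by (cases "b i") auto
      have "4 * Q < (Suc x)\<^sup>2 + R" using False split(1)[of "\<lambda>x. x\<^sup>2"] x by (simp add: R_def)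
      moreover have "(\<Sum>k\<in>S. (e k)\<^sup>2) = x\<^sup>2 + R" using split(2)[of "\<lambda>x. x\<^sup>2"] x by (simp add: R_def)
      moreover have "2 * x \<le> x\<^sup>2 + 1"
        using zero_le_power2[of "int x - 1"] by (simp add: power2_eq_square algebra_simps flip: of_nat_mult)
      ultimately show ?thesis using assms(2) by (simp add: power2_eq_square)
    qed
    ultimately obtain d where "\<forall>i. d i \<le> e i" "Q \<le> (\<Sum>i\<in>S. (d i)\<^sup>2)" "(\<Sum>i\<in>S. (d i)\<^sup>2) \<le> 4 * Q"
      using less.hyps by blast
    moreover have "e k \<le> b k" for k by (simp add: e_def)
    ultimately show ?thesis by (meson le_trans)
  qed
qed

text \<open>Applying minus a multiple of the transpose to \<open>b\<close> lowers the violated rows by \<open>b\<close>; the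
  overshoots it creates in other rows form a vector of smaller norm, which is corrected
  recursively with half the weight.\<close>

lemma lp_correction:
  fixes a :: "nat \<Rightarrow> nat \<Rightarrow> real" and b :: "nat \<Rightarrow> nat" and B0 :: real
  assumes "0 < n"
    and row: "\<And>i. i < m \<Longrightarrow> real n / 2 \<le> (\<Sum>j<n. (a i j)\<^sup>2)"
    and cross: "\<And>b b' :: nat \<Rightarrow> nat. (\<And>i. b i = 0 \<or> b' i = 0) \<Longrightarrow>
      real (\<Sum>i<m. (b i)\<^sup>2) \<le> 4 * B0 \<Longrightarrow> real (\<Sum>i<m. (b' i)\<^sup>2) \<le> 4 * B0 \<Longrightarrow>
      - (real n / 25 * sqrt (real (\<Sum>i<m. (b i)\<^sup>2) * real (\<Sum>i<m. (b' i)\<^sup>2)))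
        \<le> (\<Sum>j<n. (\<Sum>i<m. real (b i) * a i j) * (\<Sum>i<m. real (b' i) * a i j))"
    and obj: "\<And>b :: nat \<Rightarrow> nat. real (\<Sum>i<m. (b i)\<^sup>2) \<le> B0 \<Longrightarrow>
      (\<Sum>i<m. real (b i) * (\<Sum>j<n. a i j * c j)) \<le> sqrt (real n * B0)"
    and "real (\<Sum>i<m. (b i)\<^sup>2) \<le> B0"
  shows "\<exists>H. (\<forall>i<m. (\<Sum>j<n. a i j * H j) \<le> 2 - real (b i)) \<and> - (4 * sqrt (B0 / real n)) \<le> (\<Sum>j<n. c j * H j)"
  using assms(5)
proof (induction "\<Sum>i<m. (b i)\<^sup>2" arbitrary: b rule: less_induct)
  case less
  define Q where "Q = (\<Sum>i<m. (b i)\<^sup>2)"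
  have QB: "real Q \<le> B0" using less.prems by (simp add: Q_def)
  then have B0: "0 \<le> B0" using of_nat_0_le_iff[of Q] by linarith
  show ?case
  proof (cases "Q = 0")
    case True
    then have "b i = 0" if "i < m" for i using that by (auto simp: Q_def)
    then show ?thesis using B0 by (intro exI[of _ "\<lambda>_. 0"]) auto
  next
    case False
    define ip where "ip i k = (\<Sum>j<n. a i j * a k j)" for i k
    \<comment> \<open>Rows have squared norm at least n / 2, so the factor 2 / n lowers row i by at
      least \<open>b i\<close>; the cross terms with other rows form \<open>ov i\<close>.\<close>
    define h where "h j = - (2 / real n) * (\<Sum>k<m. real (b k) * a k j)" for j
    define ov where "ov i = - (2 / real n) * (\<Sum>k\<in>{..<m} - {i}. real (b k) * ip i k)" for i
    \<comment> \<open>The recursive correction has weight 1/2, hence the doubling. An overshoot of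
      at most 1, together with half of the recursive slack 2, stays within the slack 2 and needs no
      repair. Above 1, rounding up costs less than another \<open>ov i\<close>, hence the factor 3
      below.\<close>
    define b' where "b' i = (if 1 < ov i then nat \<lceil>2 * ov i\<rceil> else 0)" for i
    have b'_bounds: "real (b' i) \<le> 3 * ov i" "2 * ov i \<le> real (b' i)" if "1 < ov i" for i
      using that unfolding b'_def by simp_all linarith+
    have row_h: "(\<Sum>j<n. a i j * h j) \<le> - real (b i) + ov i" if "i < m" for i
    proof -
      have "(\<Sum>j<n. a i j * h j) = - (2 / real n) * (\<Sum>j<n. \<Sum>k<m. real (b k) * (a i j * a k j))"
        by (simp add: h_def sum_distrib_left algebra_simps)
      also have "(\<Sum>j<n. \<Sum>k<m. real (b k) * (a i j * a k j)) = (\<Sum>k<m. real (b k) * ip i k)"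
        unfolding ip_def sum_distrib_left by (rule sum.swap)
      also have "\<dots> = real (b i) * ip i i + (\<Sum>k\<in>{..<m} - {i}. real (b k) * ip i k)"
        using that by (subst sum.remove[of _ i]) auto
      finally have eq: "(\<Sum>j<n. a i j * h j) = - (2 / real n) * (real (b i) * ip i i) + ov i"
        by (simp add: ov_def algebra_simps)
      have "real n / 2 \<le> ip i i" using row[OF that] by (simp add: ip_def power2_eq_square)
      then have "real (b i) * (real n / 2) \<le> real (b i) * ip i i" by (intro mult_left_mono) auto
      then have "2 / real n * (real (b i) * (real n / 2)) \<le> 2 / real n * (real (b i) * ip i i)"
        by (rule mult_left_mono) simp
      moreover have "2 / real n * (real (b i) * (real n / 2)) = real (b i)" using assms(1) by simp
      ultimately have "real (b i) \<le> 2 / real n * (real (b i) * ip i i)" by (simp only:)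
      then show ?thesis using eq by simp
    qed
    \<comment> \<open>A factor 3 comes from rounding, 2 from the step size 2 / n, 2 from the cut,
      and 2 from its two orientations. The constant 25 in \<open>cross\<close> is chosen so that the
      total 24 / 25 is below 1, which contradicts a norm that fails to decrease.\<close>
    have shrink: "(\<Sum>i<m. (b' i)\<^sup>2) < Q"
    proof (rule ccontr)
      assume "\<not> ?thesis"
      then have "Q \<le> (\<Sum>i<m. (b' i)\<^sup>2)" by simp
      moreover have "1 \<le> Q" using False by simp
      ultimately obtain d where d: "\<And>i. d i \<le> b' i" "Q \<le> (\<Sum>i<m. (d i)\<^sup>2)" "(\<Sum>i<m. (d i)\<^sup>2) \<le> 4 * Q"
        using nat_vector_truncate[of "{..<m}" Q b'] by auto
      define D where "D = (\<Sum>i<m. (d i)\<^sup>2)"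
      define g where "g i k = - (real (d i) * real (b k) * ip i k)" for i k
      obtain T where T: "T \<subseteq> {..<m}"
        "(\<Sum>i<m. \<Sum>k\<in>{..<m} - {i}. g i k) / 2 \<le> (\<Sum>i\<in>T. \<Sum>k\<in>{..<m} - T. g i k + g k i)"
        using max_cut[of "{..<m}" g] by auto
      \<comment> \<open>Extending \<open>d\<close> and \<open>b\<close> by zero from disjoint sets
        makes \<open>cross\<close> applicable; the truncation of \<open>d\<close> to squared norm 4
        Q keeps it in range.\<close>
      have part: "(\<Sum>i\<in>U. \<Sum>k\<in>V. g i k) \<le> real n / 25 * sqrt (real D * real Q)"
        if UV: "U \<subseteq> {..<m}" "V \<subseteq> {..<m}" "U \<inter> V = {}" for U V
      proof -
        define dU where "dU i = (if i \<in> U then d i else 0)" for i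
        define bV where "bV i = (if i \<in> V then b i else 0)" for i
        have dU: "(\<Sum>i<m. (dU i)\<^sup>2) \<le> D" unfolding D_def dU_def by (intro sum_mono) auto
        have bV: "(\<Sum>i<m. (bV i)\<^sup>2) \<le> Q" unfolding Q_def bV_def by (intro sum_mono) auto
        have "real D \<le> 4 * real Q" using d(3) by (simp add: D_def flip: of_nat_sum)
        then have "real (\<Sum>i<m. (dU i)\<^sup>2) \<le> 4 * B0" using dU QB by linarith
        moreover have "real (\<Sum>i<m. (bV i)\<^sup>2) \<le> 4 * B0" using bV QB B0 by linarith
        ultimately have "- (real n / 25 * sqrt (real (\<Sum>i<m. (dU i)\<^sup>2) * real (\<Sum>i<m. (bV i)\<^sup>2)))
            \<le> (\<Sum>j<n. (\<Sum>i<m. real (dU i) * a i j) * (\<Sum>i<m. real (bV i) * a i j))"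
          using UV(3) by (intro cross) (auto simp: dU_def bV_def)
        also have "(\<Sum>j<n. (\<Sum>i<m. real (dU i) * a i j) * (\<Sum>i<m. real (bV i) * a i j))
            = (\<Sum>j<n. \<Sum>i\<in>U. \<Sum>k\<in>V. real (d i) * real (b k) * (a i j * a k j))"
        proof (rule sum.cong)
          fix j
          have "(\<Sum>i<m. real (dU i) * a i j) = (\<Sum>i\<in>U. real (d i) * a i j)"
            using UV by (intro sum.mono_neutral_cong_right) (auto simp: dU_def)
          moreover have "(\<Sum>i<m. real (bV i) * a i j) = (\<Sum>i\<in>V. real (b i) * a i j)"
            using UV by (intro sum.mono_neutral_cong_right) (auto simp: bV_def)
          ultimately show "(\<Sum>i<m. real (dU i) * a i j) * (\<Sum>i<m. real (bV i) * a i j)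
              = (\<Sum>i\<in>U. \<Sum>k\<in>V. real (d i) * real (b k) * (a i j * a k j))"
            by (simp only: sum_product) (simp add: ac_simps)
        qed simp
        also have "\<dots> = (\<Sum>i\<in>U. \<Sum>j<n. \<Sum>k\<in>V. real (d i) * real (b k) * (a i j * a k j))"
          by (rule sum.swap)
        also have "\<dots> = (\<Sum>i\<in>U. \<Sum>k\<in>V. \<Sum>j<n. real (d i) * real (b k) * (a i j * a k j))"
          by (rule sum.cong[OF refl sum.swap])
        also have "\<dots> = - (\<Sum>i\<in>U. \<Sum>k\<in>V. g i k)"
          by (simp add: g_def ip_def sum_distrib_left sum_negf)
        finally have "(\<Sum>i\<in>U. \<Sum>k\<in>V. g i k)
            \<le> real n / 25 * sqrt (real (\<Sum>i<m. (dU i)\<^sup>2) * real (\<Sum>i<m. (bV i)\<^sup>2))" by linarith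
        also have "\<dots> \<le> real n / 25 * sqrt (real D * real Q)"
          using dU bV by (intro mult_left_mono real_sqrt_le_mono mult_mono) (auto simp del: of_nat_sum)
        finally show ?thesis .
      qed
      have "(\<Sum>i\<in>T. \<Sum>k\<in>{..<m} - T. g i k + g k i)
          = (\<Sum>i\<in>T. \<Sum>k\<in>{..<m} - T. g i k) + (\<Sum>k\<in>{..<m} - T. \<Sum>i\<in>T. g k i)"
        by (simp add: sum.distrib sum.swap[of _ _ T])
      also have "\<dots> \<le> real n / 25 * sqrt (real D * real Q) + real n / 25 * sqrt (real D * real Q)"
        using T(1) by (intro add_mono part) auto
      finally have tot: "(\<Sum>i<m. \<Sum>k\<in>{..<m} - {i}. g i k) \<le> 4 * (real n / 25 * sqrt (real D * real Q))"
        using T(2) by argo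
      have "real D \<le> (\<Sum>i<m. 3 * real (d i) * ov i)"
        unfolding D_def of_nat_sum
      proof (rule sum_mono)
        fix i
        show "real ((d i)\<^sup>2) \<le> 3 * real (d i) * ov i"
        proof (cases "1 < ov i")
          case True
          have "real (d i) \<le> 3 * ov i" using d(1)[of i] b'_bounds(1)[OF True] by linarith
          then have "real (d i) * real (d i) \<le> real (d i) * (3 * ov i)" by (intro mult_left_mono) auto
          then show ?thesis by (simp add: power2_eq_square algebra_simps)
        next
          case False
          then show ?thesis using d(1)[of i] by (simp add: b'_def)
        qed
      qed
      also have "\<dots> = 6 / real n * (\<Sum>i<m. \<Sum>k\<in>{..<m} - {i}. g i k)"
        by (simp add: ov_def g_def sum_distrib_left sum_negf algebra_simps)
      also have "\<dots> \<le> 6 / real n * (4 * (real n / 25 * sqrt (real D * real Q)))"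
        using tot by (intro mult_left_mono) auto
      also have "\<dots> = 24 / 25 * sqrt (real D * real Q)" using assms(1) by simp
      also have "sqrt (real D * real Q) \<le> sqrt (real D * real D)"
        using d(2) by (intro real_sqrt_le_mono mult_left_mono) (auto simp: D_def simp del: of_nat_sum)
      finally have "real D \<le> 24 / 25 * real D" by simp
      moreover have "1 \<le> real D" using d(2) \<open>1 \<le> Q\<close> by (simp add: D_def del: of_nat_sum)
      ultimately show False by simp
    qed
    have "real (\<Sum>i<m. (b' i)\<^sup>2) \<le> real Q" using shrink by (simp del: of_nat_sum)
    also have "\<dots> \<le> B0" by (rule QB)
    finally obtain H' where H': "\<And>i. i < m \<Longrightarrow> (\<Sum>j<n. a i j * H' j) \<le> 2 - real (b' i)"
      "- (4 * sqrt (B0 / real n)) \<le> (\<Sum>j<n. c j * H' j)"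
      using less.hyps[of b'] shrink unfolding Q_def by blast
    define H where "H j = h j + H' j / 2" for j
    have "(\<Sum>j<n. a i j * H j) \<le> 2 - real (b i)" if i: "i < m" for i
    proof -
      have "(\<Sum>j<n. a i j * H j) = (\<Sum>j<n. a i j * h j) + (\<Sum>j<n. a i j * H' j) / 2"
        by (simp add: H_def sum.distrib distrib_left sum_divide_distrib)
      also have "\<dots> \<le> (- real (b i) + ov i) + (2 - real (b' i)) / 2"
        using row_h[OF i] H'(1)[OF i] by (intro add_mono) auto
      also have "\<dots> \<le> 2 - real (b i)"
      proof (cases "1 < ov i")
        case True
        then show ?thesis using b'_bounds(2)[OF True] by argo
      qed (simp add: b'_def)
      finally show ?thesis .
    qed
    \<comment> \<open>The constant 4 is the fixed point of x = 2 + x / 2: this round costs at most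
      2, and the recursive cost is halved.\<close>
    moreover have "- (4 * sqrt (B0 / real n)) \<le> (\<Sum>j<n. c j * H j)"
    proof -
      have "(\<Sum>j<n. c j * h j) = - (2 / real n) * (\<Sum>j<n. \<Sum>k<m. real (b k) * (a k j * c j))"
        by (simp add: h_def sum_distrib_left algebra_simps)
      also have "(\<Sum>j<n. \<Sum>k<m. real (b k) * (a k j * c j)) = (\<Sum>k<m. real (b k) * (\<Sum>j<n. a k j * c j))"
        unfolding sum_distrib_left by (rule sum.swap)
      finally have eq: "(\<Sum>j<n. c j * h j) = - (2 / real n * (\<Sum>k<m. real (b k) * (\<Sum>j<n. a k j * c j)))"
        by simp
      have "2 / real n * (\<Sum>k<m. real (b k) * (\<Sum>j<n. a k j * c j)) \<le> 2 / real n * sqrt (real n * B0)"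
        using obj[of b] less.prems by (intro mult_left_mono) auto
      also have "2 / real n * sqrt (real n * B0) = 2 * sqrt (B0 / real n)"
        using assms(1) by (simp add: real_sqrt_mult real_sqrt_divide field_simps)
      finally have "- (2 * sqrt (B0 / real n)) \<le> (\<Sum>j<n. c j * h j)" using eq by linarith
      moreover have "(\<Sum>j<n. c j * H j) = (\<Sum>j<n. c j * h j) + (\<Sum>j<n. c j * H' j) / 2"
        by (simp add: H_def sum.distrib distrib_left sum_divide_distrib)
      ultimately show ?thesis using H'(2) by linarith
    qed
    ultimately show ?thesis by blast
  qed
qed

section \<open>Tail bounds for random matrices\<close>

text \<open>The Chernoff bound for counting measure: every counted function has exponential weight
  at least 1, and the total weight factors over the coordinates. It counts both the integer vectors
  of the lower bound and the grid of the upper bound.\<close>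

lemma card_PiE_weighted_le:
  fixes \<phi> :: "'b \<Rightarrow> real"
  assumes "finite A" "finite F" "0 \<le> s"
  shows "real (card {b \<in> A \<rightarrow>\<^sub>E F. (\<Sum>i\<in>A. \<phi> (b i)) \<le> N}) \<le> exp (s * N) * (\<Sum>v\<in>F. exp (- s * \<phi> v)) ^ card A"
proof -
  let ?S = "{b \<in> A \<rightarrow>\<^sub>E F. (\<Sum>i\<in>A. \<phi> (b i)) \<le> N}"
  have fin: "finite (A \<rightarrow>\<^sub>E F)" using assms by (intro finite_PiE) auto
  have "real (card ?S) = (\<Sum>b\<in>?S. 1)" by simp
  also have "\<dots> \<le> (\<Sum>b\<in>?S. exp (s * (N - (\<Sum>i\<in>A. \<phi> (b i)))))"
    using assms by (intro sum_mono) auto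
  also have "\<dots> \<le> (\<Sum>b\<in>A \<rightarrow>\<^sub>E F. exp (s * (N - (\<Sum>i\<in>A. \<phi> (b i)))))"
    using fin by (intro sum_mono2) auto
  also have "\<dots> = (\<Sum>b\<in>A \<rightarrow>\<^sub>E F. exp (s * N) * (\<Prod>i\<in>A. exp (- s * \<phi> (b i))))"
    using assms(1)
    by (intro sum.cong refl) (simp add: exp_sum[symmetric] exp_add[symmetric] sum_negf sum_distrib_left algebra_simps)
  also have "\<dots> = exp (s * N) * (\<Prod>i\<in>A. \<Sum>v\<in>F. exp (- s * \<phi> v))"
    using assms by (subst prod_sum_PiE) (simp_all add: sum_distrib_left)
  finally show ?thesis by simp
qed

lemma card_nat_vectors_le:
  fixes m :: nat and B :: real
  assumes "0 < B" "2 * B \<le> real m"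
  defines "S \<equiv> {b \<in> {..<m} \<rightarrow>\<^sub>E UNIV. real (\<Sum>i<m. (b i)\<^sup>2) \<le> 4 * B}"
  shows "finite S" and "real (card S) \<le> exp (4 * B * ln (real m / B) + 2 * B)"
proof -
  define N where "N = nat \<lfloor>4 * B\<rfloor>"
  \<comment> \<open>With this parameter the geometric ratio is q = B / m, so the m coordinates
    contribute only exp (2 B) and the main factor is (m / B) to the power 4 B.\<close>
  define s where "s = ln (real m / B)"
  define q where "q = B / real m"
  have m: "0 < real m" using assms by linarith
  have q: "0 < q" "q \<le> 1 / 2" using assms m by (auto simp: q_def field_simps)
  have s: "exp (- s) = q" "0 \<le> s"
    using assms m by (auto simp: s_def q_def exp_minus ln_ge_zero)
  let ?T = "{b \<in> {..<m} \<rightarrow>\<^sub>E {..N}. (\<Sum>i<m. real (b i)) \<le> 4 * B}"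
  have sub: "S \<subseteq> ?T"
  proof
    fix b assume b: "b \<in> S"
    have sq: "x \<le> x\<^sup>2" for x :: nat by (simp add: power2_eq_square)
    have "(\<Sum>i<m. real (b i)) \<le> real (\<Sum>i<m. (b i)\<^sup>2)"
      unfolding of_nat_sum[symmetric] using sq by (intro of_nat_mono sum_mono)
    then have le: "(\<Sum>i<m. real (b i)) \<le> 4 * B" using b by (simp add: S_def del: of_nat_sum)
    have "b i \<le> N" if "i < m" for i
    proof -
      have "real (b i) \<le> (\<Sum>i<m. real (b i))" using that by (intro member_le_sum) auto
      then show ?thesis using le unfolding N_def by (simp add: le_nat_floor)
    qed
    then show "b \<in> ?T" using b le by (auto simp: S_def PiE_def)
  qed
  have finT: "finite ?T" by (rule finite_subset[of _ "{..<m} \<rightarrow>\<^sub>E {..N}"]) (auto intro!: finite_PiE)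
  then show "finite S" using sub finite_subset by auto
  have geo: "(\<Sum>v\<le>N. exp (- s * real v)) \<le> exp (2 * q)"
  proof -
    have "(\<Sum>v\<le>N. exp (- s * real v)) = (\<Sum>v\<le>N. q ^ v)"
      by (simp add: s(1)[symmetric] exp_of_nat_mult[symmetric] mult.commute)
    also have "\<dots> \<le> (\<Sum>v. q ^ v)" using q by (intro sum_le_suminf summable_geometric) auto
    also have "\<dots> = 1 / (1 - q)" using q by (intro suminf_geometric) auto
    also have "\<dots> \<le> 1 + 2 * q"
    proof -
      have "q * q \<le> q * (1 / 2)" using q by (intro mult_left_mono) auto
      then have "1 \<le> (1 + 2 * q) * (1 - q)" by (simp add: algebra_simps)
      then show ?thesis using q by (simp add: divide_le_eq)
    qed
    also have "\<dots> \<le> exp (2 * q)" by (rule exp_ge_add_one_self)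
    finally show ?thesis .
  qed
  have "real (card S) \<le> real (card ?T)" using card_mono[OF finT sub] by simp
  also have "\<dots> \<le> exp (s * (4 * B)) * (\<Sum>v\<in>{..N}. exp (- s * real v)) ^ card {..<m}"
    using s by (intro card_PiE_weighted_le) auto
  also have "\<dots> \<le> exp (s * (4 * B)) * exp (2 * q) ^ m"
    unfolding card_lessThan using geo by (intro mult_left_mono power_mono sum_nonneg) auto
  also have "exp (2 * q) ^ m = exp (2 * B)"
    using m by (simp add: exp_of_nat_mult[symmetric] q_def)
  finally show "real (card S) \<le> exp (4 * B * ln (real m / B) + 2 * B)"
    by (simp add: exp_add s_def algebra_simps)
qed

context prob_space
begin

lemma prob_finite_union_le:
  assumes "finite S" and "\<And>x. x \<in> S \<Longrightarrow> {\<omega> \<in> space M. P x \<omega>} \<in> events"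
    and "\<And>x. x \<in> S \<Longrightarrow> prob {\<omega> \<in> space M. P x \<omega>} \<le> p"
  shows "prob {\<omega> \<in> space M. \<exists>x\<in>S. P x \<omega>} \<le> real (card S) * p"
proof -
  have "{\<omega> \<in> space M. \<exists>x\<in>S. P x \<omega>} = (\<Union>x\<in>S. {\<omega> \<in> space M. P x \<omega>})" by auto
  then have "prob {\<omega> \<in> space M. \<exists>x\<in>S. P x \<omega>} \<le> (\<Sum>x\<in>S. prob {\<omega> \<in> space M. P x \<omega>})"
    using assms by (auto intro!: finite_measure_subadditive_finite)
  also have "\<dots> \<le> (\<Sum>x\<in>S. p)" using assms by (intro sum_mono)
  finally show ?thesis by simp
qed

end

section \<open>Deviation bounds for one fixed vector or pair of vectors\<close>

locale random_matrix = subgaussian_family M K "{..<m} \<times> {..<n}" "\<lambda>(i, j). X i j"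
  for M :: "'a measure" and K :: real and m n :: nat and X :: "nat \<Rightarrow> nat \<Rightarrow> 'a \<Rightarrow> real" +
  assumes m_pos: "0 < m" and n_pos: "0 < n"
begin

definition row :: "nat \<Rightarrow> (nat \<Rightarrow> real) \<Rightarrow> 'a \<Rightarrow> real" where
  "row i u \<omega> = (\<Sum>j<n. X i j \<omega> * u j)"

lemma sum_row_index: "(\<Sum>p\<in>{i} \<times> {..<n}. f p) = (\<Sum>j<n. f (i, j))"
proof -
  have "{i} \<times> {..<n} = Pair i ` {..<n}" by auto
  then show ?thesis by (simp add: sum.reindex inj_on_def)
qed

lemma row_lin: "row i u = lin ({i} \<times> {..<n}) (\<lambda>(i, j). u j)"
  by (simp add: row_def lin_def sum_row_index fun_eq_iff mult.commute)

lemma row_subset: "i < m \<Longrightarrow> {i} \<times> {..<n} \<subseteq> {..<m} \<times> {..<n}" by auto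

lemma measurable_X[measurable (raw)]: "i < m \<Longrightarrow> j < n \<Longrightarrow> X i j \<in> borel_measurable M"
  using measurable_Y[of "(i, j)"] by auto

lemma measurable_row[measurable (raw)]: "i < m \<Longrightarrow> row i u \<in> borel_measurable M"
  unfolding row_lin by (intro measurable_lin row_subset)

lemma X_std: "i < m \<Longrightarrow> j < n \<Longrightarrow> std_subgaussian M K (X i j)"
  using entry[of "(i, j)"] by auto

lemma K_ge_1: "1 \<le> K"
  using std_subgaussian.K_ge_1[OF X_std[OF m_pos n_pos]] .

text \<open>Two linear forms of the same row are allowed because in the dual certificate the weight
  of a row depends on its product with \<open>c\<close>, while the weighted quantity is its product
  with another direction.\<close>

lemma rows_chernoff:
  fixes \<psi> :: "nat \<Rightarrow> real \<Rightarrow> real \<Rightarrow> real"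
  assumes [measurable]: "\<And>i. i < m \<Longrightarrow> case_prod (\<psi> i) \<in> borel_measurable (borel \<Otimes>\<^sub>M borel)"
    and q: "\<And>i. i < m \<Longrightarrow> (\<integral>\<^sup>+ \<omega>. ennreal (exp (\<psi> i (row i u \<omega>) (row i v \<omega>))) \<partial>M) \<le> ennreal q" "0 \<le> q"
  shows "prob {\<omega> \<in> space M. a \<le> (\<Sum>i<m. \<psi> i (row i u \<omega>) (row i v \<omega>))} \<le> q ^ m * exp (- a)"
proof (rule chernoff)
  show "(\<lambda>\<omega>. \<Sum>i<m. \<psi> i (row i u \<omega>) (row i v \<omega>)) \<in> borel_measurable M" by measurable
  define F where "F i y = exp (\<psi> i (\<Sum>j<n. y (i, j) * u j) (\<Sum>j<n. y (i, j) * v j))" for i and y :: "nat \<times> nat \<Rightarrow> real"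
  have F: "F i (restrict (\<lambda>p. (case p of (i, j) \<Rightarrow> X i j) \<omega>) ({i} \<times> {..<n})) = exp (\<psi> i (row i u \<omega>) (row i v \<omega>))" for i \<omega>
    unfolding F_def row_def by (intro arg_cong[of _ _ exp] arg_cong2[of _ _ _ _ "\<psi> i"] sum.cong) auto
  have "(\<integral>\<^sup>+ \<omega>. ennreal (exp (\<Sum>i<m. \<psi> i (row i u \<omega>) (row i v \<omega>))) \<partial>M)
      = (\<integral>\<^sup>+ \<omega>. ennreal (\<Prod>i<m. F i (restrict (\<lambda>p. (case p of (i, j) \<Rightarrow> X i j) \<omega>) ({i} \<times> {..<n}))) \<partial>M)"
    by (simp add: F exp_sum)
  also have "\<dots> = (\<Prod>i<m. \<integral>\<^sup>+ \<omega>. ennreal (F i (restrict (\<lambda>p. (case p of (i, j) \<Rightarrow> X i j) \<omega>) ({i} \<times> {..<n}))) \<partial>M)"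
  proof (rule nn_integral_blocks)
    show "disjoint_family_on (\<lambda>i. {i} \<times> {..<n}) {..<m}" by (auto simp: disjoint_family_on_def)
    show "F i \<in> borel_measurable (Pi\<^sub>M ({i} \<times> {..<n}) (\<lambda>_. borel))" if "i \<in> {..<m}" for i
    proof -
      have [measurable]: "case_prod (\<psi> i) \<in> borel_measurable (borel \<Otimes>\<^sub>M borel)" using assms(1) that by auto
      show ?thesis unfolding F_def by measurable
    qed
  qed (auto simp: F_def)
  also have "\<dots> \<le> (\<Prod>i<m. ennreal q)"
    unfolding F using q by (intro prod_mono_ennreal) auto
  finally show "(\<integral>\<^sup>+ \<omega>. ennreal (exp (\<Sum>i<m. \<psi> i (row i u \<omega>) (row i v \<omega>))) \<partial>M) \<le> ennreal (q ^ m)"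
    using q by (simp add: ennreal_power)
  show "0 \<le> q ^ m" using q by simp
qed

lemma short_row_prob:
  assumes "i < m"
  shows "prob {\<omega> \<in> space M. \<not> real n / 2 \<le> (\<Sum>j<n. (X i j \<omega>)\<^sup>2)} \<le> exp (- (real n / (64 * K^4)))"
proof -
  \<comment> \<open>The fourth moment is at most 4 K^4, so this s makes the quadratic term s / 4:
    each entry gains 3 s / 4 while the threshold n / 2 costs s / 2 per entry.\<close>
  define s where "s = 1 / (16 * K^4)"
  have s: "0 < s" using K_ge_1 by (simp add: s_def)
  have one: "(\<integral>\<^sup>+ \<omega>. ennreal (exp (- s * (X i j \<omega>)\<^sup>2)) \<partial>M) \<le> ennreal (exp (- (3 / 4 * s)))" if "j < n" for j
  proof -
    interpret std_subgaussian M K "X i j" using X_std[OF assms that] .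
    have "exp (- s * x\<^sup>2) \<le> 1 + (- s * x\<^sup>2) + s\<^sup>2 * x^4" for x
    proof -
      have "0 \<le> s * x\<^sup>2" using s by simp
      then have "- s * x\<^sup>2 \<le> 1" by linarith
      then have "exp (- s * x\<^sup>2) \<le> 1 + (- s * x\<^sup>2) + (- s * x\<^sup>2)\<^sup>2" by (rule exp_le_quadratic)
      then show ?thesis by (simp add: power_mult_distrib power_mult[symmetric])
    qed note pt = this
    have int: "integrable M (\<lambda>\<omega>. 1 + (- s * (X i j \<omega>)\<^sup>2) + s\<^sup>2 * (X i j \<omega>)^4)"
      using integrable_square fourth_moment(1) by auto
    have "(\<integral>\<^sup>+ \<omega>. ennreal (exp (- s * (X i j \<omega>)\<^sup>2)) \<partial>M) \<le> (\<integral>\<^sup>+ \<omega>. ennreal (1 + (- s * (X i j \<omega>)\<^sup>2) + s\<^sup>2 * (X i j \<omega>)^4) \<partial>M)"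
      using pt by (intro nn_integral_mono ennreal_leI)
    also have "\<dots> = ennreal (expectation (\<lambda>\<omega>. 1 + (- s * (X i j \<omega>)\<^sup>2) + s\<^sup>2 * (X i j \<omega>)^4))"
      using order_trans[OF exp_ge_zero pt] by (intro nn_integral_eq_integral int AE_I2)
    also have "expectation (\<lambda>\<omega>. 1 + (- s * (X i j \<omega>)\<^sup>2) + s\<^sup>2 * (X i j \<omega>)^4)
        = 1 - s + s\<^sup>2 * expectation (\<lambda>\<omega>. (X i j \<omega>)^4)"
      using integrable_square fourth_moment(1) second_moment by (simp add: prob_space)
    also have "\<dots> \<le> 1 - s + s\<^sup>2 * (4 * K^4)"
      using fourth_moment(2) by (intro add_left_mono mult_left_mono) auto
    also have "s\<^sup>2 * (4 * K^4) = s / 4"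
    proof -
      have "s * K^4 = 1 / 16" using K_pos by (simp add: s_def)
      then show ?thesis by (simp add: power2_eq_square)
    qed
    also have "1 - s + s / 4 \<le> exp (- (3 / 4 * s))" using exp_ge_add_one_self[of "- (3 / 4 * s)"] by simp
    finally show ?thesis by (simp add: ennreal_leI)
  qed
  have "{\<omega> \<in> space M. \<not> real n / 2 \<le> (\<Sum>j<n. (X i j \<omega>)\<^sup>2)}
      \<subseteq> {\<omega> \<in> space M. - (s * (real n / 2)) \<le> (\<Sum>j<n. - s * (X i j \<omega>)\<^sup>2)}"
  proof safe
    fix \<omega> assume "\<not> real n / 2 \<le> (\<Sum>j<n. (X i j \<omega>)\<^sup>2)"
    then have "s * (\<Sum>j<n. (X i j \<omega>)\<^sup>2) \<le> s * (real n / 2)" using s by (intro mult_left_mono) auto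
    then show "- (s * (real n / 2)) \<le> (\<Sum>j<n. - s * (X i j \<omega>)\<^sup>2)"
      by (simp add: sum_distrib_left sum_negf)
  qed
  then have "prob {\<omega> \<in> space M. \<not> real n / 2 \<le> (\<Sum>j<n. (X i j \<omega>)\<^sup>2)}
      \<le> prob {\<omega> \<in> space M. - (s * (real n / 2)) \<le> (\<Sum>j<n. - s * (X i j \<omega>)\<^sup>2)}"
    using assms by (intro finite_measure_mono) auto
  also have "\<dots> \<le> exp (- (3 / 4 * s)) ^ n * exp (- (- (s * (real n / 2))))"
  proof (rule chernoff)
    show "(\<lambda>\<omega>. \<Sum>j<n. - s * (X i j \<omega>)\<^sup>2) \<in> borel_measurable M" using assms by measurable
    have ind: "indep_vars (\<lambda>_. borel) (\<lambda>p \<omega>. ennreal (exp (- s * ((case p of (i, j) \<Rightarrow> X i j) \<omega>)\<^sup>2))) ({i} \<times> {..<n})"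
      using assms by (intro indep_vars_compose2[OF indep_vars_subset[OF indep]]) auto
    have "(\<integral>\<^sup>+ \<omega>. ennreal (exp (\<Sum>j<n. - s * (X i j \<omega>)\<^sup>2)) \<partial>M)
        = (\<integral>\<^sup>+ \<omega>. (\<Prod>p\<in>{i} \<times> {..<n}. ennreal (exp (- s * ((case p of (i, j) \<Rightarrow> X i j) \<omega>)\<^sup>2))) \<partial>M)"
      by (simp add: prod_ennreal exp_sum[symmetric] sum_row_index)
    also have "\<dots> = (\<Prod>p\<in>{i} \<times> {..<n}. \<integral>\<^sup>+ \<omega>. ennreal (exp (- s * ((case p of (i, j) \<Rightarrow> X i j) \<omega>)\<^sup>2)) \<partial>M)"
      using ind by (intro indep_vars_nn_integral) auto
    also have "\<dots> \<le> (\<Prod>p\<in>{i} \<times> {..<n}. ennreal (exp (- (3 / 4 * s))))"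
      by (intro prod_mono_ennreal) (use one in auto)
    finally show "(\<integral>\<^sup>+ \<omega>. ennreal (exp (\<Sum>j<n. - s * (X i j \<omega>)\<^sup>2)) \<partial>M) \<le> ennreal (exp (- (3 / 4 * s)) ^ n)"
      by (simp add: ennreal_power card_cartesian_product)
  qed simp
  also have "\<dots> = exp (- (s * real n / 4))"
    by (simp add: exp_of_nat_mult[symmetric] exp_add[symmetric] algebra_simps)
  also have "s * real n / 4 = real n / (64 * K^4)" by (simp add: s_def)
  finally show ?thesis .
qed

text \<open>In each column the two sums use disjoint sets of entries, so their product obeys
  \<open>exp_lin_product_le\<close>, and the columns are independent. The case of a zero vector is
  separate because the exponential parameter is normalized by the product of the norms.\<close>

lemma cross_term_prob:
  fixes b b' :: "nat \<Rightarrow> nat"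
  assumes disj: "\<And>i. i < m \<Longrightarrow> b i = 0 \<or> b' i = 0"
  shows "prob {\<omega> \<in> space M. \<not> - (real n / 25 * sqrt (real (\<Sum>i<m. (b i)\<^sup>2) * real (\<Sum>i<m. (b' i)\<^sup>2)))
        \<le> (\<Sum>j<n. (\<Sum>i<m. real (b i) * X i j \<omega>) * (\<Sum>i<m. real (b' i) * X i j \<omega>))}
      \<le> exp (- (real n / (10000 * K^4)))"
proof -
  define B where "B = real (\<Sum>i<m. (b i)\<^sup>2)"
  define B' where "B' = real (\<Sum>i<m. (b' i)\<^sup>2)"
  show ?thesis
  proof (cases "B = 0 \<or> B' = 0")
    case True
    then have "(\<forall>i<m. b i = 0) \<or> (\<forall>i<m. b' i = 0)"
      by (auto simp: B_def B'_def simp del: of_nat_sum)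
    then have "(\<Sum>j<n. (\<Sum>i<m. real (b i) * X i j \<omega>) * (\<Sum>i<m. real (b' i) * X i j \<omega>)) = 0" for \<omega> by auto
    then have e: "{\<omega> \<in> space M. \<not> - (real n / 25 * sqrt (B * B'))
        \<le> (\<Sum>j<n. (\<Sum>i<m. real (b i) * X i j \<omega>) * (\<Sum>i<m. real (b' i) * X i j \<omega>))} = {}"
      by (simp add: B_def B'_def del: of_nat_sum)
    show ?thesis unfolding B_def[symmetric] B'_def[symmetric] e by simp
  next
    case False
    have B: "0 < B" "0 < B'" using False unfolding B_def B'_def using of_nat_0_le_iff by (metis less_eq_real_def)+
    define w where "w = sqrt (B * B')"
    have w: "0 < w" "w\<^sup>2 = B * B'" using B by (auto simp: w_def)
    \<comment> \<open>The second-order term 4 K^4 s0^2 equals s0 / 50, half of the gain s0 / 25 from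
      the threshold; the difference is the exponent 1 / (10000 K^4).\<close>
    define s0 where "s0 = 1 / (200 * K^4)"
    define s where "s = - (s0 / w)"
    have K: "1 \<le> K^4" using K_ge_1 by simp
    have s0: "0 < s0" using K_ge_1 by (simp add: s0_def)
    have Ks: "K^4 * s0\<^sup>2 = s0 / 200"
    proof -
      have "K^4 * s0 = 1 / 200" using K_ge_1 by (simp add: s0_def)
      then have "(K^4 * s0) * s0 = 1 / 200 * s0" by (simp only:)
      then show ?thesis by (simp add: power2_eq_square mult.assoc)
    qed
    have "s0 * 1 \<le> s0 * K^4" using K s0 by (intro mult_left_mono) auto
    moreover have "s0 * K^4 = 1 / 200" using K_ge_1 by (simp add: s0_def)
    ultimately have "s0 \<le> 1 / 200" by simp
    then have Ks': "16 * (K^4 * s0\<^sup>2) \<le> 1" unfolding Ks by simp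
    have s2: "(K\<^sup>2 * B') * (K\<^sup>2 * B) * s\<^sup>2 = K^4 * s0\<^sup>2"
    proof -
      have "(K\<^sup>2 * B') * (K\<^sup>2 * B) * s\<^sup>2 = K^4 * (B * B') * (s0\<^sup>2 / w\<^sup>2)"
        by (simp add: s_def power_divide power2_eq_square power4_eq_xxxx)
      then show ?thesis using w B by simp
    qed
    define P where "P j \<omega> = (\<Sum>i<m. real (b i) * X i j \<omega>) * (\<Sum>i<m. real (b' i) * X i j \<omega>)" for j \<omega>
    have col: "(\<integral>\<^sup>+ \<omega>. ennreal (exp (s * P j \<omega>)) \<partial>M) \<le> ennreal (exp (4 * (K^4 * s0\<^sup>2)))" if j: "j < n" for j
    proof -
      define J where "J = {i. i < m \<and> b i \<noteq> 0} \<times> {j}"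
      define J' where "J' = {i. i < m \<and> b' i \<noteq> 0} \<times> {j}"
      have image: "(\<lambda>i. (i, j)) ` U = U \<times> {j}" for U :: "nat set" by auto
      have e1: "(\<Sum>i<m. f (real (b i)) * g i) = (\<Sum>p\<in>J. f (real (b (fst p))) * g (fst p))"
        if "f 0 = 0" for f :: "real \<Rightarrow> real" and g
      proof -
        have "(\<Sum>p\<in>J. f (real (b (fst p))) * g (fst p)) = (\<Sum>i\<in>{i. i < m \<and> b i \<noteq> 0}. f (real (b i)) * g i)"
          unfolding J_def by (subst image[symmetric], subst sum.reindex) (auto simp: inj_on_def)
        also have "\<dots> = (\<Sum>i<m. f (real (b i)) * g i)" using that by (intro sum.mono_neutral_left) auto
        finally show ?thesis by simp
      qed
      have e2: "(\<Sum>i<m. f (real (b' i)) * g i) = (\<Sum>p\<in>J'. f (real (b' (fst p))) * g (fst p))"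
        if "f 0 = 0" for f :: "real \<Rightarrow> real" and g
      proof -
        have "(\<Sum>p\<in>J'. f (real (b' (fst p))) * g (fst p)) = (\<Sum>i\<in>{i. i < m \<and> b' i \<noteq> 0}. f (real (b' i)) * g i)"
          unfolding J'_def by (subst image[symmetric], subst sum.reindex) (auto simp: inj_on_def)
        also have "\<dots> = (\<Sum>i<m. f (real (b' i)) * g i)" using that by (intro sum.mono_neutral_left) auto
        finally show ?thesis by simp
      qed
      have snd: "snd p = j" if "p \<in> J \<or> p \<in> J'" for p using that by (auto simp: J_def J'_def)
      have P: "P j \<omega> = lin J (\<lambda>p. real (b (fst p))) \<omega> * lin J' (\<lambda>p. real (b' (fst p))) \<omega>" for \<omega>
        unfolding P_def lin_def using snd
        by (subst e1[of "\<lambda>x. x"], simp, subst e2[of "\<lambda>x. x"], simp) (auto simp: case_prod_unfold intro!: arg_cong2[of _ _ _ _ "(*)"] sum.cong)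
      have "(\<integral>\<^sup>+ \<omega>. ennreal (exp (s * P j \<omega>)) \<partial>M) \<le> ennreal (exp (4 * (K\<^sup>2 * B') * (K\<^sup>2 * B) * s\<^sup>2))"
        unfolding P
      proof (rule exp_lin_product_le)
        show "J \<inter> J' = {}" using disj by (fastforce simp: J_def J'_def)
        show "J \<subseteq> {..<m} \<times> {..<n}" "J' \<subseteq> {..<m} \<times> {..<n}" using j by (auto simp: J_def J'_def)
        show "(\<Sum>p\<in>J. (real (b (fst p)))\<^sup>2) \<le> B" using e1[of "\<lambda>x. x\<^sup>2" "\<lambda>_. 1"] by (simp add: B_def)
        show "(\<Sum>p\<in>J'. (real (b' (fst p)))\<^sup>2) \<le> B'" using e2[of "\<lambda>x. x\<^sup>2" "\<lambda>_. 1"] by (simp add: B'_def)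
        show "16 * (K\<^sup>2 * B') * (K\<^sup>2 * B) * s\<^sup>2 \<le> 1" using Ks' s2 by (simp add: mult.assoc)
      qed
      then show ?thesis using s2 by (simp add: mult.assoc)
    qed
    have "{\<omega> \<in> space M. \<not> - (real n / 25 * w) \<le> (\<Sum>j<n. P j \<omega>)}
        \<subseteq> {\<omega> \<in> space M. s0 * (real n / 25) \<le> (\<Sum>j<n. s * P j \<omega>)}"
    proof safe
      fix \<omega> assume "\<not> - (real n / 25 * w) \<le> (\<Sum>j<n. P j \<omega>)"
      then have "s0 / w * (real n / 25 * w) \<le> s0 / w * (- (\<Sum>j<n. P j \<omega>))"
        using s0 w by (intro mult_left_mono) auto
      moreover have "(\<Sum>j<n. s * P j \<omega>) = s0 / w * (- (\<Sum>j<n. P j \<omega>))"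
        by (simp add: s_def sum_distrib_left sum_negf)
      moreover have "s0 / w * (real n / 25 * w) = s0 * (real n / 25)" using w by simp
      ultimately show "s0 * (real n / 25) \<le> (\<Sum>j<n. s * P j \<omega>)" by simp
    qed
    moreover have P_meas: "P j \<in> borel_measurable M" if "j < n" for j unfolding P_def using that by measurable
    ultimately have "prob {\<omega> \<in> space M. \<not> - (real n / 25 * w) \<le> (\<Sum>j<n. P j \<omega>)}
        \<le> prob {\<omega> \<in> space M. s0 * (real n / 25) \<le> (\<Sum>j<n. s * P j \<omega>)}"
      by (intro finite_measure_mono) auto
    also have "\<dots> \<le> exp (4 * (K^4 * s0\<^sup>2)) ^ n * exp (- (s0 * (real n / 25)))"
    proof (rule chernoff)
      show "(\<lambda>\<omega>. \<Sum>j<n. s * P j \<omega>) \<in> borel_measurable M" using P_meas by measurable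
      define F where "F j y = exp (s * ((\<Sum>i<m. real (b i) * y (i, j)) * (\<Sum>i<m. real (b' i) * y (i, j))))"
        for j and y :: "nat \<times> nat \<Rightarrow> real"
      have F: "F j (restrict (\<lambda>p. (case p of (i, j) \<Rightarrow> X i j) \<omega>) ({..<m} \<times> {j})) = exp (s * P j \<omega>)" for j \<omega>
        unfolding F_def P_def
        by (intro arg_cong[of _ _ exp] arg_cong2[of _ _ _ _ "(*)"] sum.cong) auto
      have "(\<integral>\<^sup>+ \<omega>. ennreal (exp (\<Sum>j<n. s * P j \<omega>)) \<partial>M)
          = (\<integral>\<^sup>+ \<omega>. ennreal (\<Prod>j<n. F j (restrict (\<lambda>p. (case p of (i, j) \<Rightarrow> X i j) \<omega>) ({..<m} \<times> {j}))) \<partial>M)"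
        by (simp add: F exp_sum)
      also have "\<dots> = (\<Prod>j<n. \<integral>\<^sup>+ \<omega>. ennreal (F j (restrict (\<lambda>p. (case p of (i, j) \<Rightarrow> X i j) \<omega>) ({..<m} \<times> {j}))) \<partial>M)"
      proof (rule nn_integral_blocks)
        show "disjoint_family_on (\<lambda>j. {..<m} \<times> {j}) {..<n}" by (auto simp: disjoint_family_on_def)
        show "F j \<in> borel_measurable (Pi\<^sub>M ({..<m} \<times> {j}) (\<lambda>_. borel))" for j
          unfolding F_def by measurable
      qed (auto simp: F_def)
      also have "\<dots> \<le> (\<Prod>j<n. ennreal (exp (4 * (K^4 * s0\<^sup>2))))"
        unfolding F using col by (intro prod_mono_ennreal) auto
      finally show "(\<integral>\<^sup>+ \<omega>. ennreal (exp (\<Sum>j<n. s * P j \<omega>)) \<partial>M) \<le> ennreal (exp (4 * (K^4 * s0\<^sup>2)) ^ n)"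
        by (simp add: ennreal_power)
    qed simp
    also have "\<dots> = exp (real n * (4 * (K^4 * s0\<^sup>2) - s0 / 25))"
      by (simp add: exp_of_nat_mult[symmetric] exp_add[symmetric] algebra_simps)
    also have "4 * (K^4 * s0\<^sup>2) - s0 / 25 = - (1 / (10000 * K^4))"
      unfolding Ks using K by (simp add: s0_def)
    finally show ?thesis unfolding P_def w_def B_def B'_def by simp
  qed
qed

text \<open>The weighted sum is a single linear form in all entries with coefficients
  \<open>b i * c j\<close>; its squared norm is the product of the two squared norms.\<close>

lemma weighted_objective_prob:
  fixes b :: "nat \<Rightarrow> nat"
  assumes "(\<Sum>j<n. (c j)\<^sup>2) = 1" "real (\<Sum>i<m. (b i)\<^sup>2) \<le> B" "0 < B"
  shows "prob {\<omega> \<in> space M. \<not> (\<Sum>i<m. real (b i) * row i c \<omega>) \<le> sqrt (real n * B)} \<le> exp (- (real n / (4 * K\<^sup>2)))"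
proof -
  \<comment> \<open>The minimizer of K^2 B s^2 - s sqrt (n B).\<close>
  define s where "s = sqrt (real n / B) / (2 * K\<^sup>2)"
  have s: "0 < s" using n_pos assms(3) K_ge_1 by (simp add: s_def)
  define Z where "Z = lin ({..<m} \<times> {..<n}) (\<lambda>(i, j). real (b i) * c j)"
  have Z: "(\<Sum>i<m. real (b i) * row i c \<omega>) = Z \<omega>" for \<omega>
    unfolding Z_def lin_def row_def sum_distrib_left sum.cartesian_product by (intro sum.cong) auto
  have Zm: "Z \<in> borel_measurable M" unfolding Z_def by (rule measurable_lin) simp
  have "(\<Sum>p\<in>{..<m} \<times> {..<n}. ((\<lambda>(i, j). real (b i) * c j) p)\<^sup>2) = (\<Sum>i<m. \<Sum>j<n. (real (b i) * c j)\<^sup>2)"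
    by (simp add: sum.cartesian_product case_prod_unfold)
  also have "\<dots> = (\<Sum>i<m. (real (b i))\<^sup>2) * (\<Sum>j<n. (c j)\<^sup>2)"
    by (simp only: sum_product power_mult_distrib)
  also have "\<dots> \<le> B" using assms by simp
  finally have le: "(\<Sum>p\<in>{..<m} \<times> {..<n}. ((\<lambda>(i, j). real (b i) * c j) p)\<^sup>2) \<le> B" .
  have "{\<omega> \<in> space M. \<not> (\<Sum>i<m. real (b i) * row i c \<omega>) \<le> sqrt (real n * B)}
      \<subseteq> {\<omega> \<in> space M. s * sqrt (real n * B) \<le> s * Z \<omega>}"
    using s by (auto simp: Z)
  then have "prob {\<omega> \<in> space M. \<not> (\<Sum>i<m. real (b i) * row i c \<omega>) \<le> sqrt (real n * B)}
      \<le> prob {\<omega> \<in> space M. s * sqrt (real n * B) \<le> s * Z \<omega>}"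
    using Zm by (intro finite_measure_mono) auto
  also have "\<dots> \<le> exp (K\<^sup>2 * B * s\<^sup>2) * exp (- (s * sqrt (real n * B)))"
    using Zm le unfolding Z_def by (intro chernoff exp_lin_le) auto
  also have "\<dots> = exp (K\<^sup>2 * B * s\<^sup>2 - s * sqrt (real n * B))" by (simp add: exp_add[symmetric])
  also have "K\<^sup>2 * B * s\<^sup>2 = real n / (4 * K\<^sup>2)"
    using assms(3) K_ge_1 by (simp add: s_def power_divide field_simps power2_eq_square)
  also have "s * sqrt (real n * B) = real n / (2 * K\<^sup>2)"
  proof -
    have "sqrt (real n / B) * sqrt (real n * B) = real n"
      using assms(3) by (simp add: real_sqrt_mult[symmetric] power2_eq_square[symmetric])
    then show ?thesis by (simp add: s_def)
  qed
  finally show ?thesis by (simp add: field_simps)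
qed

end

section \<open>Exponential moments of rows and the event for the lower bound\<close>

context random_matrix
begin

lemma row_exp_gaussian_bounds:
  assumes "i < m" "(\<Sum>j<n. (c j)\<^sup>2) = 1" "\<eta> \<le> 1"
    and "\<And>j. j < n \<Longrightarrow> 2 * (cubic_const K + 1) * \<bar>s * c j\<bar> \<le> \<eta>"
  shows "exp (s\<^sup>2 / 2 * (1 - \<eta>)) \<le> expectation (\<lambda>\<omega>. exp (s * row i c \<omega>))"
    and "expectation (\<lambda>\<omega>. exp (s * row i c \<omega>)) \<le> exp (s\<^sup>2 / 2 * (1 + \<eta>))"
    and "(\<integral>\<^sup>+ \<omega>. ennreal (exp (s * row i c \<omega>)) \<partial>M) \<le> ennreal (exp (s\<^sup>2 / 2 * (1 + \<eta>)))"
proof -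
  have *: "(\<Sum>p\<in>{i} \<times> {..<n}. ((\<lambda>(i, j). c j) p)\<^sup>2) = 1"
    "\<And>p. p \<in> {i} \<times> {..<n} \<Longrightarrow> 2 * (cubic_const K + 1) * \<bar>s * (\<lambda>(i, j). c j) p\<bar> \<le> \<eta>"
    using assms by (auto simp: sum_row_index)
  note b = exp_lin_gaussian_bounds[OF row_subset[OF assms(1)] *(1) assms(3) *(2)]
  show "exp (s\<^sup>2 / 2 * (1 - \<eta>)) \<le> expectation (\<lambda>\<omega>. exp (s * row i c \<omega>))"
    using b(1) by (simp add: row_lin)
  show u: "expectation (\<lambda>\<omega>. exp (s * row i c \<omega>)) \<le> exp (s\<^sup>2 / 2 * (1 + \<eta>))"
    using b(2) by (simp add: row_lin)
  have "integrable M (\<lambda>\<omega>. exp (s * row i c \<omega>))"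
    unfolding row_lin by (intro exp_lin_integrable row_subset assms)
  then show "(\<integral>\<^sup>+ \<omega>. ennreal (exp (s * row i c \<omega>)) \<partial>M) \<le> ennreal (exp (s\<^sup>2 / 2 * (1 + \<eta>)))"
    using u by (subst nn_integral_eq_integral) (auto intro: ennreal_leI)
qed

lemma row_exp_le:
  assumes "i < m" "(\<Sum>j<n. (u j)\<^sup>2) \<le> B"
  shows "(\<integral>\<^sup>+ \<omega>. ennreal (exp (s * row i u \<omega>)) \<partial>M) \<le> ennreal (exp (K\<^sup>2 * B * s\<^sup>2))"
  unfolding row_lin using assms by (intro exp_lin_le row_subset) (auto simp: sum_row_index)

text \<open>The exponent 1 / (16 K^2) is the largest that \<open>exp_lin_square_le\<close> admits in
  the unit ball. Half of it is kept for integrability and half for decay beyond a cutoff, which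
  explains the recurring 32 K^2.\<close>

lemma row_exp_square_le:
  assumes "i < m" "(\<Sum>j<n. (u j)\<^sup>2) \<le> 1"
  shows "(\<integral>\<^sup>+ \<omega>. ennreal (exp ((row i u \<omega>)\<^sup>2 / (16 * K\<^sup>2))) \<partial>M) \<le> ennreal 2"
proof -
  have K: "0 < K\<^sup>2" using K_ge_1 by simp
  have "(\<integral>\<^sup>+ \<omega>. ennreal (exp (1 / (16 * K\<^sup>2) * (row i u \<omega>)\<^sup>2)) \<partial>M) \<le> ennreal (exp (4 * (1 / (16 * K\<^sup>2)) * (K\<^sup>2 * 1)))"
    unfolding row_lin using assms K by (intro exp_lin_square_le row_subset) (auto simp: sum_row_index)
  also have "4 * (1 / (16 * K\<^sup>2)) * (K\<^sup>2 * 1) = 1 / 4" using K by simp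
  also have "exp (1 / 4 :: real) \<le> 2"
    using exp_le_quadratic[of "1 / 4"] by (simp add: power2_eq_square)
  finally show ?thesis by (simp add: ennreal_leI)
qed

text \<open>Here \<open>f\<close> turns the product g of a row with \<open>c\<close> into its
  violation count. One row has exponential moment at most 1 + p, so the total squared count behaves
  like a sum with mean m p and exceeds a larger budget \<open>B\<close> only with exponentially
  small probability.\<close>

lemma excess_prob:
  fixes f :: "real \<Rightarrow> nat"
  assumes c: "(\<Sum>j<n. (c j)\<^sup>2) = 1"
    and f0: "\<And>g. g \<le> \<tau> \<Longrightarrow> f g = 0"
    and f1: "\<And>g. \<tau> < g \<Longrightarrow> (real (f g))\<^sup>2 \<le> \<eta> * g\<^sup>2"
    and [measurable]: "f \<in> borel \<rightarrow>\<^sub>M count_space UNIV"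
    and \<eta>: "0 \<le> \<eta>" "32 * K\<^sup>2 * \<eta> \<le> 1" and \<tau>: "0 < \<tau>" "\<zeta> \<le> 1" "0 \<le> R"
    and small: "\<And>j. j < n \<Longrightarrow> 2 * (cubic_const K + 1) * \<bar>\<tau> * c j\<bar> \<le> \<zeta>"
  shows "prob {\<omega> \<in> space M. \<not> real (\<Sum>i<m. (f (row i c \<omega>))\<^sup>2) \<le> B}
    \<le> exp (real m * (exp (\<eta> * R\<^sup>2 - \<tau>\<^sup>2 / 2 * (1 - \<zeta>)) + 2 * exp (- R\<^sup>2 / (32 * K\<^sup>2))) - B)"
proof -
  define \<kappa> where "\<kappa> = 1 / (32 * K\<^sup>2)"
  have \<kappa>: "\<eta> \<le> \<kappa>" "0 < \<kappa>" using \<eta> K_ge_1 by (auto simp: \<kappa>_def field_simps)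
  define p where "p = exp (\<eta> * R\<^sup>2 - \<tau>\<^sup>2 / 2 * (1 - \<zeta>)) + 2 * exp (- \<kappa> * R\<^sup>2)"
  have p: "0 \<le> p" by (simp add: p_def)
  \<comment> \<open>The three summands serve g \<le> \<tau>, \<tau> < g \<le> R and g > R. In the
    middle range the moment at parameter \<tau>, the optimal one for a Gaussian tail at \<tau>, is
    used with quadratic growth frozen at \<open>R\<close>; beyond \<open>R\<close> the
    square-exponential moment takes over.\<close>
  have pt: "exp ((real (f g))\<^sup>2) \<le> 1 + exp (\<eta> * R\<^sup>2 - \<tau>\<^sup>2) * exp (\<tau> * g) + exp (- \<kappa> * R\<^sup>2) * exp (g\<^sup>2 / (16 * K\<^sup>2))" for g
  proof (cases "g \<le> \<tau>")
    case True
    then show ?thesis using f0 by (simp add: add_nonneg_nonneg)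
  next
    case False
    then have le: "exp ((real (f g))\<^sup>2) \<le> exp (\<eta> * g\<^sup>2)" using f1 by simp
    show ?thesis
    proof (cases "g \<le> R")
      case True
      have "\<eta> * g\<^sup>2 \<le> \<eta> * R\<^sup>2" using True False \<tau> \<eta> by (intro mult_left_mono power_mono) auto
      moreover have "\<tau> * \<tau> \<le> \<tau> * g" using False \<tau> by (intro mult_left_mono) auto
      ultimately have "\<eta> * g\<^sup>2 \<le> (\<eta> * R\<^sup>2 - \<tau>\<^sup>2) + \<tau> * g" by (simp add: power2_eq_square)
      then have "exp (\<eta> * g\<^sup>2) \<le> exp (\<eta> * R\<^sup>2 - \<tau>\<^sup>2) * exp (\<tau> * g)" by (simp add: exp_add[symmetric])
      moreover have "0 \<le> exp (- \<kappa> * R\<^sup>2) * exp (g\<^sup>2 / (16 * K\<^sup>2))" by simp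
      ultimately show ?thesis using le by linarith
    next
      case False
      then have "R\<^sup>2 \<le> g\<^sup>2" using \<tau> by (intro power_mono) auto
      then have "\<kappa> * R\<^sup>2 \<le> \<kappa> * g\<^sup>2" using \<kappa> by (intro mult_left_mono) auto
      moreover have "\<eta> * g\<^sup>2 \<le> \<kappa> * g\<^sup>2" using \<kappa> by (intro mult_right_mono) auto
      moreover have "g\<^sup>2 / (16 * K\<^sup>2) = 2 * (\<kappa> * g\<^sup>2)" by (simp add: \<kappa>_def)
      ultimately have "\<eta> * g\<^sup>2 \<le> - \<kappa> * R\<^sup>2 + g\<^sup>2 / (16 * K\<^sup>2)" by simp
      then have "exp (\<eta> * g\<^sup>2) \<le> exp (- \<kappa> * R\<^sup>2) * exp (g\<^sup>2 / (16 * K\<^sup>2))" by (simp only: exp_add[symmetric] exp_le_cancel_iff)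
      moreover have "0 \<le> exp (\<eta> * R\<^sup>2 - \<tau>\<^sup>2) * exp (\<tau> * g)" by simp
      ultimately show ?thesis using le by linarith
    qed
  qed
  have one: "(\<integral>\<^sup>+ \<omega>. ennreal (exp ((real (f (row i c \<omega>)))\<^sup>2)) \<partial>M) \<le> ennreal (1 + p)" if i: "i < m" for i
  proof -
    have [measurable]: "row i c \<in> borel_measurable M" using i by measurable
    have "(\<integral>\<^sup>+ \<omega>. ennreal (exp ((real (f (row i c \<omega>)))\<^sup>2)) \<partial>M)
      \<le> (\<integral>\<^sup>+ \<omega>. ennreal 1 + ennreal (exp (\<eta> * R\<^sup>2 - \<tau>\<^sup>2)) * ennreal (exp (\<tau> * row i c \<omega>))
            + ennreal (exp (- \<kappa> * R\<^sup>2)) * ennreal (exp ((row i c \<omega>)\<^sup>2 / (16 * K\<^sup>2))) \<partial>M)"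
    proof (rule nn_integral_mono)
      fix \<omega>
      show "ennreal (exp ((real (f (row i c \<omega>)))\<^sup>2)) \<le> ennreal 1 + ennreal (exp (\<eta> * R\<^sup>2 - \<tau>\<^sup>2)) * ennreal (exp (\<tau> * row i c \<omega>))
            + ennreal (exp (- \<kappa> * R\<^sup>2)) * ennreal (exp ((row i c \<omega>)\<^sup>2 / (16 * K\<^sup>2)))"
        using ennreal_leI[OF pt[of "row i c \<omega>"]] by (simp add: ennreal_plus ennreal_mult add_nonneg_nonneg del: ennreal_1)
    qed
    also have "\<dots> = ennreal 1 + ennreal (exp (\<eta> * R\<^sup>2 - \<tau>\<^sup>2)) * (\<integral>\<^sup>+ \<omega>. ennreal (exp (\<tau> * row i c \<omega>)) \<partial>M)
        + ennreal (exp (- \<kappa> * R\<^sup>2)) * (\<integral>\<^sup>+ \<omega>. ennreal (exp ((row i c \<omega>)\<^sup>2 / (16 * K\<^sup>2))) \<partial>M)"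
      by (simp add: nn_integral_add nn_integral_cmult emeasure_space_1)
    also have "\<dots> \<le> ennreal 1 + ennreal (exp (\<eta> * R\<^sup>2 - \<tau>\<^sup>2)) * ennreal (exp (\<tau>\<^sup>2 / 2 * (1 + \<zeta>)))
        + ennreal (exp (- \<kappa> * R\<^sup>2)) * ennreal 2"
      using c i \<tau> small by (intro add_mono mult_left_mono row_exp_gaussian_bounds(3) row_exp_square_le order_refl) auto
    also have "\<dots> = ennreal (1 + exp (\<eta> * R\<^sup>2 - \<tau>\<^sup>2) * exp (\<tau>\<^sup>2 / 2 * (1 + \<zeta>)) + exp (- \<kappa> * R\<^sup>2) * 2)"
      by (simp add: ennreal_plus ennreal_mult add_nonneg_nonneg del: ennreal_1)
    also have "exp (\<eta> * R\<^sup>2 - \<tau>\<^sup>2) * exp (\<tau>\<^sup>2 / 2 * (1 + \<zeta>)) = exp (\<eta> * R\<^sup>2 - \<tau>\<^sup>2 / 2 * (1 - \<zeta>))"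
      by (simp add: exp_add[symmetric] algebra_simps add_divide_distrib diff_divide_distrib)
    finally show ?thesis by (simp add: p_def algebra_simps)
  qed
  have "{\<omega> \<in> space M. \<not> real (\<Sum>i<m. (f (row i c \<omega>))\<^sup>2) \<le> B}
      \<subseteq> {\<omega> \<in> space M. B \<le> (\<Sum>i<m. (real (f (row i c \<omega>)))\<^sup>2)}"
    by auto
  then have "prob {\<omega> \<in> space M. \<not> real (\<Sum>i<m. (f (row i c \<omega>))\<^sup>2) \<le> B}
      \<le> prob {\<omega> \<in> space M. B \<le> (\<Sum>i<m. (real (f (row i c \<omega>)))\<^sup>2)}"
    by (intro finite_measure_mono) measurable
  also have "\<dots> \<le> (1 + p) ^ m * exp (- B)"
    using one p by (intro rows_chernoff[where \<psi> = "\<lambda>_ x y. (real (f x))\<^sup>2"]) auto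
  also have "\<dots> \<le> exp p ^ m * exp (- B)"
    using p exp_ge_add_one_self[of p] by (intro mult_right_mono power_mono) auto
  also have "\<dots> = exp (real m * p - B)" by (simp add: exp_of_nat_mult[symmetric] exp_add[symmetric])
  finally show ?thesis by (simp add: p_def \<kappa>_def)
qed

text \<open>The four summands bound the chances that some row is short, that two integer
  combinations of rows are too negatively correlated, that a combination has too large an objective,
  and that the violations of \<beta> c exceed the budget \<open>B\<close>. Otherwise
  \<open>lp_correction\<close> repairs \<beta> c.\<close>

lemma lower_bound_event:
  fixes B \<beta> \<delta> :: real
  assumes c: "(\<Sum>j<n. (c j)\<^sup>2) = 1"
    and B: "0 < B" "2 * B \<le> real m"
    and par: "0 < \<beta>" "0 < \<delta>" "3 * \<delta> \<le> 1" "32 * K\<^sup>2 * (\<beta> / \<delta>)\<^sup>2 \<le> 1"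
    and small: "\<And>j. j < n \<Longrightarrow> 2 * (cubic_const K + 1) * \<bar>(1 - 2 * \<delta>) / \<beta> * c j\<bar> \<le> \<zeta>" and \<zeta>: "\<zeta> \<le> 1"
    and R: "0 \<le> R"
  defines "N \<equiv> exp (4 * B * ln (real m / B) + 2 * B)"
  shows "\<exists>E\<in>events. prob E \<le> real m * exp (- (real n / (64 * K^4))) + N * N * exp (- (real n / (10000 * K^4)))
      + N * exp (- (real n / (4 * K\<^sup>2)))
      + exp (real m * (exp ((\<beta> / \<delta>)\<^sup>2 * R\<^sup>2 - ((1 - 2 * \<delta>) / \<beta>)\<^sup>2 / 2 * (1 - \<zeta>)) + 2 * exp (- R\<^sup>2 / (32 * K\<^sup>2))) - B)
    \<and> (\<forall>\<omega>\<in>space M - E. \<exists>x\<in>lp_feasible m n (\<lambda>i j. X i j \<omega>). \<beta> - 4 * \<delta> * sqrt (B / real n) \<le> (\<Sum>j<n. c j * x j))"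
proof -
  \<comment> \<open>The factor 4 matches the range in which \<open>lp_correction\<close> compares
    pairs of vectors. Extensional functions make the family finite.\<close>
  define S where "S = {b \<in> {..<m} \<rightarrow>\<^sub>E (UNIV :: nat set). real (\<Sum>i<m. (b i)\<^sup>2) \<le> 4 * B}"
  have finS: "finite S" and cardS: "real (card S) \<le> N"
    using card_nat_vectors_le[OF B] by (simp_all add: S_def N_def)
  \<comment> \<open>Adding \<delta> H raises a row by at most \<delta> (2 - f), so 2 \<delta> is
    reserved from the right-hand side 1 and what exceeds the rest is counted in units of \<delta>,
    rounded up.\<close>
  define f where "f g = nat \<lceil>(\<beta> * g - (1 - 2 * \<delta>)) / \<delta>\<rceil>" for g
  have [measurable]: "f \<in> borel \<rightarrow>\<^sub>M count_space UNIV" unfolding f_def by measurable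
  define \<tau> where "\<tau> = (1 - 2 * \<delta>) / \<beta>"
  define E1 where "E1 = {\<omega> \<in> space M. \<exists>i\<in>{..<m}. \<not> real n / 2 \<le> (\<Sum>j<n. (X i j \<omega>)\<^sup>2)}"
  define P2 where "P2 = (\<lambda>(b, b') \<omega>. (\<forall>i<m. b i = 0 \<or> b' i = 0) \<and>
      \<not> - (real n / 25 * sqrt (real (\<Sum>i<m. (b i)\<^sup>2) * real (\<Sum>i<m. (b' i)\<^sup>2)))
        \<le> (\<Sum>j<n. (\<Sum>i<m. real (b i) * X i j \<omega>) * (\<Sum>i<m. real (b' i) * X i j \<omega>)))"
  define E2 where "E2 = {\<omega> \<in> space M. \<exists>b\<in>S \<times> S. P2 b \<omega>}"
  define P3 where "P3 b \<omega> \<longleftrightarrow> real (\<Sum>i<m. (b i)\<^sup>2) \<le> B \<and> \<not> (\<Sum>i<m. real (b i) * row i c \<omega>) \<le> sqrt (real n * B)"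
    for b :: "nat \<Rightarrow> nat" and \<omega>
  define E3 where "E3 = {\<omega> \<in> space M. \<exists>b\<in>S. P3 b \<omega>}"
  define E4 where "E4 = {\<omega> \<in> space M. \<not> real (\<Sum>i<m. (f (row i c \<omega>))\<^sup>2) \<le> B}"
  have P2m: "{\<omega> \<in> space M. P2 b \<omega>} \<in> events" for b unfolding P2_def case_prod_unfold by measurable
  have P3m: "{\<omega> \<in> space M. P3 b \<omega>} \<in> events" for b unfolding P3_def by measurable
  have m1: "E1 \<in> events" unfolding E1_def by measurable
  have m2: "E2 \<in> events" unfolding E2_def using P2m finS by (intro sets.sets_Collect_finite_Ex) auto
  have m3: "E3 \<in> events" unfolding E3_def using P3m finS by (intro sets.sets_Collect_finite_Ex) auto
  have m4: "E4 \<in> events" unfolding E4_def by measurable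
  have p1: "prob E1 \<le> real m * exp (- (real n / (64 * K^4)))"
    using prob_finite_union_le[of "{..<m}" "\<lambda>i \<omega>. \<not> real n / 2 \<le> (\<Sum>j<n. (X i j \<omega>)\<^sup>2)", OF _ _ short_row_prob]
    unfolding E1_def by auto
  have p2: "prob E2 \<le> N * N * exp (- (real n / (10000 * K^4)))"
  proof -
    have "prob {\<omega> \<in> space M. P2 p \<omega>} \<le> exp (- (real n / (10000 * K^4)))" for p
    proof (cases "\<forall>i<m. fst p i = 0 \<or> snd p i = 0")
      case True
      then show ?thesis using cross_term_prob[of "fst p" "snd p"]
        by (simp add: P2_def case_prod_unfold)
    next
      case False
      then have "{\<omega> \<in> space M. P2 p \<omega>} = {}" by (auto simp: P2_def case_prod_unfold)
      then show ?thesis by (simp only: measure_empty exp_ge_zero)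
    qed
    then have "prob E2 \<le> real (card (S \<times> S)) * exp (- (real n / (10000 * K^4)))"
      unfolding E2_def using finS P2m by (intro prob_finite_union_le) auto
    also have "\<dots> \<le> N * N * exp (- (real n / (10000 * K^4)))"
      unfolding card_cartesian_product of_nat_mult using cardS by (intro mult_right_mono mult_mono) (auto simp: N_def)
    finally show ?thesis .
  qed
  have p3: "prob E3 \<le> N * exp (- (real n / (4 * K\<^sup>2)))"
  proof -
    have "prob {\<omega> \<in> space M. P3 b \<omega>} \<le> exp (- (real n / (4 * K\<^sup>2)))" for b
    proof (cases "real (\<Sum>i<m. (b i)\<^sup>2) \<le> B")
      case True
      then show ?thesis using weighted_objective_prob[OF c True B(1)] by (simp add: P3_def del: of_nat_sum)
    next
      case False
      then have "{\<omega> \<in> space M. P3 b \<omega>} = {}" by (auto simp: P3_def simp del: of_nat_sum)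
      then show ?thesis by (simp only: measure_empty exp_ge_zero)
    qed
    then have "prob E3 \<le> real (card S) * exp (- (real n / (4 * K\<^sup>2)))"
      unfolding E3_def using finS P3m by (intro prob_finite_union_le) auto
    also have "\<dots> \<le> N * exp (- (real n / (4 * K\<^sup>2)))" using cardS by (intro mult_right_mono) auto
    finally show ?thesis .
  qed
  have f_ge: "(\<beta> * g - (1 - 2 * \<delta>)) / \<delta> \<le> real (f g)" for g
    unfolding f_def by linarith
  have p4: "prob E4 \<le> exp (real m * (exp ((\<beta> / \<delta>)\<^sup>2 * R\<^sup>2 - \<tau>\<^sup>2 / 2 * (1 - \<zeta>)) + 2 * exp (- R\<^sup>2 / (32 * K\<^sup>2))) - B)"
    unfolding E4_def
  proof (rule excess_prob[OF c])
    fix g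
    show "f g = 0" if "g \<le> \<tau>"
    proof -
      have "\<beta> * g \<le> 1 - 2 * \<delta>" using that par by (simp add: \<tau>_def field_simps)
      then have "(\<beta> * g - (1 - 2 * \<delta>)) / \<delta> \<le> 0" using par by (simp add: divide_le_0_iff)
      then show ?thesis by (simp add: f_def)
    qed
    show "(real (f g))\<^sup>2 \<le> (\<beta> / \<delta>)\<^sup>2 * g\<^sup>2" if "\<tau> < g"
    proof -
      have "1 - 2 * \<delta> < \<beta> * g" using that par by (simp add: \<tau>_def field_simps)
      then have "0 < (\<beta> * g - (1 - 2 * \<delta>)) / \<delta>" using par by simp
      \<comment> \<open>Rounding adds one unit \<delta>; since 3 \<delta> \<le> 1 the count is still
        bounded by a multiple of g itself, as \<open>excess_prob\<close> requires.\<close>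
      then have "real (f g) \<le> (\<beta> * g - (1 - 2 * \<delta>)) / \<delta> + 1" unfolding f_def by linarith
      also have "\<dots> = (\<beta> * g - (1 - 3 * \<delta>)) / \<delta>" using par by (simp add: field_simps)
      also have "\<dots> \<le> \<beta> * g / \<delta>" using par by (intro divide_right_mono) auto
      finally have "(real (f g))\<^sup>2 \<le> (\<beta> * g / \<delta>)\<^sup>2" by (intro power_mono) auto
      then show ?thesis by (simp add: power_divide power_mult_distrib)
    qed
    show "2 * (cubic_const K + 1) * \<bar>\<tau> * c j\<bar> \<le> \<zeta>" if "j < n" for j
      using small[OF that] by (simp add: \<tau>_def)
    show "0 < \<tau>" using par by (simp add: \<tau>_def)
  qed (use par \<zeta> R in auto)
  have good: "\<exists>x\<in>lp_feasible m n (\<lambda>i j. X i j \<omega>). \<beta> - 4 * \<delta> * sqrt (B / real n) \<le> (\<Sum>j<n. c j * x j)"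
    if \<omega>: "\<omega> \<in> space M" "\<omega> \<notin> E1" "\<omega> \<notin> E2" "\<omega> \<notin> E3" "\<omega> \<notin> E4" for \<omega>
  proof -
    have inS: "restrict b {..<m} \<in> S" if "real (\<Sum>i<m. (b i)\<^sup>2) \<le> 4 * B" for b
      using that by (simp add: S_def del: of_nat_sum)
    have "\<exists>H. (\<forall>i<m. (\<Sum>j<n. X i j \<omega> * H j) \<le> 2 - real (f (row i c \<omega>))) \<and> - (4 * sqrt (B / real n)) \<le> (\<Sum>j<n. c j * H j)"
    proof (rule lp_correction)
      show "0 < n" by (rule n_pos)
      show "real n / 2 \<le> (\<Sum>j<n. (X i j \<omega>)\<^sup>2)" if "i < m" for i
        using \<omega> that by (auto simp: E1_def)
      show "real (\<Sum>i<m. (f (row i c \<omega>))\<^sup>2) \<le> B" using \<omega> by (simp add: E4_def del: of_nat_sum)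
      fix b b' :: "nat \<Rightarrow> nat"
      show "(\<Sum>i<m. real (b i) * (\<Sum>j<n. X i j \<omega> * c j)) \<le> sqrt (real n * B)"
        if b: "real (\<Sum>i<m. (b i)\<^sup>2) \<le> B"
      proof -
        have "real (\<Sum>i<m. (b i)\<^sup>2) \<le> 4 * B" using b B by linarith
        then have "\<not> P3 (restrict b {..<m}) \<omega>" using inS \<omega> by (auto simp: E3_def simp del: of_nat_sum)
        then show ?thesis using b by (simp add: P3_def row_def del: of_nat_sum)
      qed
      assume dis: "\<And>i. b i = 0 \<or> b' i = 0"
        and b: "real (\<Sum>i<m. (b i)\<^sup>2) \<le> 4 * B" and b': "real (\<Sum>i<m. (b' i)\<^sup>2) \<le> 4 * B"
      have "\<not> P2 (restrict b {..<m}, restrict b' {..<m}) \<omega>"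
        using inS[OF b] inS[OF b'] \<omega> by (auto simp: E2_def)
      then show "- (real n / 25 * sqrt (real (\<Sum>i<m. (b i)\<^sup>2) * real (\<Sum>i<m. (b' i)\<^sup>2)))
        \<le> (\<Sum>j<n. (\<Sum>i<m. real (b i) * X i j \<omega>) * (\<Sum>i<m. real (b' i) * X i j \<omega>))"
        using dis by (simp add: P2_def del: of_nat_sum)
    qed
    then obtain H where H: "\<And>i. i < m \<Longrightarrow> (\<Sum>j<n. X i j \<omega> * H j) \<le> 2 - real (f (row i c \<omega>))"
      "- (4 * sqrt (B / real n)) \<le> (\<Sum>j<n. c j * H j)" by blast
    define x where "x = restrict (\<lambda>j. \<beta> * c j + \<delta> * H j) {..<n}"
    have "(\<Sum>j<n. X i j \<omega> * x j) \<le> 1" if "i < m" for i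
    proof -
      have "(\<Sum>j<n. X i j \<omega> * x j) = \<beta> * row i c \<omega> + \<delta> * (\<Sum>j<n. X i j \<omega> * H j)"
        by (simp add: x_def row_def sum_distrib_left sum.distrib algebra_simps)
      also have "\<dots> \<le> \<beta> * row i c \<omega> + \<delta> * (2 - real (f (row i c \<omega>)))"
        using H(1)[OF that] par by (intro add_left_mono mult_left_mono) auto
      also have "\<dots> \<le> 1" using f_ge[of "row i c \<omega>"] par by (simp add: field_simps)
      finally show ?thesis .
    qed
    moreover have "\<beta> - 4 * \<delta> * sqrt (B / real n) \<le> (\<Sum>j<n. c j * x j)"
    proof -
      have "(\<Sum>j<n. c j * x j) = \<beta> * (\<Sum>j<n. (c j)\<^sup>2) + \<delta> * (\<Sum>j<n. c j * H j)"
        by (simp add: x_def sum_distrib_left sum.distrib algebra_simps power2_eq_square)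
      moreover have "\<delta> * - (4 * sqrt (B / real n)) \<le> \<delta> * (\<Sum>j<n. c j * H j)"
        using H(2) par by (intro mult_left_mono) auto
      ultimately show ?thesis using c by simp
    qed
    ultimately show ?thesis by (intro bexI[of _ x]) (auto simp: lp_feasible_def x_def)
  qed
  show ?thesis
  proof (intro bexI[of _ "E1 \<union> E2 \<union> E3 \<union> E4"] conjI ballI)
    have "prob (E1 \<union> E2 \<union> E3 \<union> E4) \<le> prob E1 + prob E2 + prob E3 + prob E4"
      using m1 m2 m3 m4 by (intro order_trans[OF measure_Un_le] add_mono) auto
    then show "prob (E1 \<union> E2 \<union> E3 \<union> E4) \<le> real m * exp (- (real n / (64 * K^4))) + N * N * exp (- (real n / (10000 * K^4)))
      + N * exp (- (real n / (4 * K\<^sup>2)))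
      + exp (real m * (exp ((\<beta> / \<delta>)\<^sup>2 * R\<^sup>2 - ((1 - 2 * \<delta>) / \<beta>)\<^sup>2 / 2 * (1 - \<zeta>)) + 2 * exp (- R\<^sup>2 / (32 * K\<^sup>2))) - B)"
      using p1 p2 p3 p4 unfolding \<tau>_def by linarith
  qed (use m1 m2 m3 m4 good in auto)
qed

end

section \<open>Dual certificates\<close>

definition grid_point :: "nat \<Rightarrow> real \<Rightarrow> (nat \<Rightarrow> int) \<Rightarrow> nat \<Rightarrow> real" where
  "grid_point n \<delta> k j = \<delta> * real_of_int (k j) / sqrt (real n)"

definition grid :: "nat \<Rightarrow> real \<Rightarrow> (nat \<Rightarrow> int) set" where
  "grid n \<delta> = {k \<in> {..<n} \<rightarrow>\<^sub>E UNIV. (\<Sum>j<n. \<bar>real_of_int (k j)\<bar>) \<le> real n / \<delta> \<and> (\<Sum>j<n. (grid_point n \<delta> k j)\<^sup>2) \<le> 1}"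

lemma sum_exp_neg_abs_int_le: "(\<Sum>v\<in>{- int N..int N}. exp (- 1 * \<bar>real_of_int v\<bar>)) \<le> 4"
proof -
  define q where "q = exp (- 1 :: real)"
  have q: "0 < q" "q \<le> 1 / 2"
    using exp_ge_add_one_self[of 1] by (auto simp: q_def exp_minus field_simps)
  have geo: "(\<Sum>v\<le>N. q ^ v) \<le> 2"
  proof -
    have "(\<Sum>v\<le>N. q ^ v) \<le> (\<Sum>v. q ^ v)" using q by (intro sum_le_suminf summable_geometric) auto
    also have "\<dots> = 1 / (1 - q)" using q by (intro suminf_geometric) auto
    also have "\<dots> \<le> 2" using q by (simp add: divide_le_eq)
    finally show ?thesis .
  qed
  have qv: "exp (- 1 * real v) = q ^ v" for v by (simp add: q_def exp_of_nat_mult[symmetric])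
  have sub: "{- int N..int N} \<subseteq> int ` {..N} \<union> (\<lambda>v. - int v) ` {..N}"
  proof
    fix x assume x: "x \<in> {- int N..int N}"
    show "x \<in> int ` {..N} \<union> (\<lambda>v. - int v) ` {..N}"
    proof (cases "0 \<le> x")
      case True
      then show ?thesis using x by (intro UnI1 image_eqI[of _ _ "nat x"]) auto
    next
      case False
      then show ?thesis using x by (intro UnI2 image_eqI[of _ _ "nat (- x)"]) auto
    qed
  qed
  have "(\<Sum>v\<in>{- int N..int N}. exp (- 1 * \<bar>real_of_int v\<bar>))
      \<le> (\<Sum>v\<in>int ` {..N} \<union> (\<lambda>v. - int v) ` {..N}. exp (- 1 * \<bar>real_of_int v\<bar>))"
    using sub by (intro sum_mono2) auto
  also have "\<dots> \<le> (\<Sum>v\<in>int ` {..N}. exp (- 1 * \<bar>real_of_int v\<bar>)) + (\<Sum>v\<in>(\<lambda>v. - int v) ` {..N}. exp (- 1 * \<bar>real_of_int v\<bar>))"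
    by (subst sum_Un) (auto intro!: sum_nonneg)
  also have "\<dots> = (\<Sum>v\<le>N. q ^ v) + (\<Sum>v\<le>N. q ^ v)"
    by (simp add: sum.reindex inj_on_def qv[simplified])
  finally show ?thesis using geo by linarith
qed

text \<open>Rounding is towards zero, so that a grid point lies in the unit ball and the integer vector
  has $\ell_1$ norm at most \<open>n / \<delta>\<close>; this keeps the grid exponentially small in \<open>n\<close>.\<close>

lemma card_grid_le:
  assumes "0 < \<delta>"
  shows "finite (grid n \<delta>)" and "real (card (grid n \<delta>)) \<le> exp (real n / \<delta> + 2 * real n)"
proof -
  define N where "N = nat \<lfloor>real n / \<delta>\<rfloor>"
  let ?T = "{k \<in> {..<n} \<rightarrow>\<^sub>E {- int N..int N}. (\<Sum>j<n. \<bar>real_of_int (k j)\<bar>) \<le> real n / \<delta>}"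
  have sub: "grid n \<delta> \<subseteq> ?T"
  proof
    fix k assume k: "k \<in> grid n \<delta>"
    then have le: "(\<Sum>j<n. \<bar>real_of_int (k j)\<bar>) \<le> real n / \<delta>" by (simp add: grid_def)
    have "k j \<in> {- int N..int N}" if "j < n" for j
    proof -
      have "\<bar>real_of_int (k j)\<bar> \<le> (\<Sum>j<n. \<bar>real_of_int (k j)\<bar>)" using that by (intro member_le_sum) auto
      then have "\<bar>real_of_int (k j)\<bar> \<le> real n / \<delta>" using le by linarith
      then have "\<bar>k j\<bar> \<le> \<lfloor>real n / \<delta>\<rfloor>" by (simp add: le_floor_iff)
      also have "\<dots> = int N" using assms by (simp add: N_def)
      finally show ?thesis by auto
    qed
    then show "k \<in> ?T" using k le by (auto simp: grid_def PiE_def Pi_def)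
  qed
  have finT: "finite ?T" by (rule finite_subset[of _ "{..<n} \<rightarrow>\<^sub>E {- int N..int N}"]) (auto intro!: finite_PiE)
  then show "finite (grid n \<delta>)" using sub finite_subset by auto
  have "real (card (grid n \<delta>)) \<le> real (card ?T)" using card_mono[OF finT sub] by simp
  also have "\<dots> \<le> exp (1 * (real n / \<delta>)) * (\<Sum>v\<in>{- int N..int N}. exp (- 1 * \<bar>real_of_int v\<bar>)) ^ card {..<n}"
    by (intro card_PiE_weighted_le) auto
  also have "\<dots> \<le> exp (1 * (real n / \<delta>)) * exp 2 ^ n"
  proof -
    have "4 \<le> exp (2 :: real)"
    proof -
      have "2 \<le> exp (1 :: real)" using exp_ge_add_one_self[of 1] by simp
      then have "2 * 2 \<le> exp (1 :: real) * exp 1" by (intro mult_mono) auto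
      then show ?thesis by (simp add: exp_add[symmetric])
    qed
    then show ?thesis unfolding card_lessThan
      using sum_exp_neg_abs_int_le[of N] by (intro mult_left_mono power_mono sum_nonneg) auto
  qed
  also have "\<dots> = exp (real n / \<delta> + 2 * real n)"
    by (simp add: exp_add exp_of_nat_mult[symmetric] mult.commute)
  finally show "real (card (grid n \<delta>)) \<le> exp (real n / \<delta> + 2 * real n)" .
qed

lemma grid_approximation:
  assumes "0 < n" "0 < \<delta>" "(\<Sum>j<n. (u j)\<^sup>2) \<le> 1"
  shows "\<exists>k\<in>grid n \<delta>. (\<Sum>j<n. (u j - grid_point n \<delta> k j)\<^sup>2) \<le> \<delta>\<^sup>2"
proof -
  define t where "t = sqrt (real n) / \<delta>"
  have t: "0 < t" using assms by (simp add: t_def)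
  define k where "k = restrict (\<lambda>j. if 0 \<le> u j then \<lfloor>u j * t\<rfloor> else - \<lfloor>- u j * t\<rfloor>) {..<n}"
  have gp: "grid_point n \<delta> k j = real_of_int (k j) / t" for j
    by (simp add: grid_point_def t_def)
  have k1: "\<bar>real_of_int (k j)\<bar> \<le> \<bar>u j\<bar> * t" and k2: "\<bar>u j * t - real_of_int (k j)\<bar> \<le> 1" if "j < n" for j
  proof -
    have fl: "\<bar>real_of_int \<lfloor>y\<rfloor>\<bar> \<le> y" "\<bar>y - real_of_int \<lfloor>y\<rfloor>\<bar> \<le> 1" if "0 \<le> y" for y
    proof -
      have "0 \<le> real_of_int \<lfloor>y\<rfloor>" using that by simp
      then show "\<bar>real_of_int \<lfloor>y\<rfloor>\<bar> \<le> y" by simp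
      have "real_of_int \<lfloor>y\<rfloor> \<le> y" "y \<le> real_of_int \<lfloor>y\<rfloor> + 1" by linarith+
      then show "\<bar>y - real_of_int \<lfloor>y\<rfloor>\<bar> \<le> 1" unfolding abs_le_iff by linarith
    qed
    have "\<bar>real_of_int (k j)\<bar> \<le> \<bar>u j\<bar> * t \<and> \<bar>u j * t - real_of_int (k j)\<bar> \<le> 1"
    proof (cases "0 \<le> u j")
      case True
      then show ?thesis using fl[of "u j * t"] t that by (simp add: k_def)
    next
      case False
      define y where "y = - u j * t"
      have y: "0 \<le> y" using False t by (simp add: y_def mult_nonpos_nonneg)
      have kj: "real_of_int (k j) = - real_of_int \<lfloor>y\<rfloor>" using False that by (simp add: k_def y_def)
      have "\<bar>u j\<bar> * t = y" "u j * t - real_of_int (k j) = - (y - real_of_int \<lfloor>y\<rfloor>)"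
        using False by (simp_all add: y_def kj)
      then show ?thesis using fl[OF y] unfolding kj abs_minus_cancel by (simp only: abs_minus_cancel)
    qed
    then show "\<bar>real_of_int (k j)\<bar> \<le> \<bar>u j\<bar> * t" "\<bar>u j * t - real_of_int (k j)\<bar> \<le> 1" by auto
  qed
  have "(\<Sum>j<n. (grid_point n \<delta> k j)\<^sup>2) \<le> (\<Sum>j<n. (u j)\<^sup>2)"
  proof (rule sum_mono)
    fix j assume "j \<in> {..<n}"
    then have "\<bar>grid_point n \<delta> k j\<bar> \<le> \<bar>u j\<bar>" using k1[of j] t by (simp add: gp abs_divide divide_le_eq)
    then show "(grid_point n \<delta> k j)\<^sup>2 \<le> (u j)\<^sup>2" by (simp add: abs_le_square_iff)
  qed
  moreover have "(\<Sum>j<n. \<bar>real_of_int (k j)\<bar>) \<le> real n / \<delta>"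
  proof -
    have "(\<Sum>j<n. \<bar>real_of_int (k j)\<bar>) \<le> (\<Sum>j<n. \<bar>u j\<bar> * t)" using k1 by (intro sum_mono) auto
    also have "\<dots> = (\<Sum>j<n. \<bar>u j\<bar> * \<bar>1\<bar>) * t" by (simp add: sum_distrib_right)
    also have "\<dots> \<le> (L2_set u {..<n} * L2_set (\<lambda>_. 1) {..<n}) * t"
      using t by (intro mult_right_mono L2_set_mult_ineq) auto
    also have "\<dots> \<le> (1 * sqrt (real n)) * t"
      using t assms by (intro mult_right_mono mult_mono) (auto simp: L2_set_def intro: sum_nonneg)
    also have "\<dots> = real n / \<delta>" by (simp add: t_def)
    finally show ?thesis .
  qed
  ultimately have "k \<in> grid n \<delta>" using assms by (auto simp: grid_def k_def)
  moreover have "(\<Sum>j<n. (u j - grid_point n \<delta> k j)\<^sup>2) \<le> \<delta>\<^sup>2"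
  proof -
    have "(\<Sum>j<n. (u j - grid_point n \<delta> k j)\<^sup>2) \<le> (\<Sum>j<n. (1 / t)\<^sup>2)"
    proof (rule sum_mono)
      fix j assume "j \<in> {..<n}"
      then have "\<bar>u j * t - real_of_int (k j)\<bar> / t \<le> 1 / t" using k2[of j] t by (intro divide_right_mono) auto
      moreover have "u j - grid_point n \<delta> k j = (u j * t - real_of_int (k j)) / t" using t by (simp add: gp field_simps)
      ultimately have "\<bar>u j - grid_point n \<delta> k j\<bar> \<le> 1 / t" using t by (simp add: abs_divide)
      then show "(u j - grid_point n \<delta> k j)\<^sup>2 \<le> (1 / t)\<^sup>2" using t by (simp only: abs_le_square_iff[symmetric])
    qed
    also have "\<dots> = \<delta>\<^sup>2" using assms by (simp add: t_def power_divide)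
    finally show ?thesis .
  qed
  ultimately show ?thesis by blast
qed

text \<open>The supremum P over the ball satisfies P \<le> C + P / 2, since the rounding error of
  any point is \<delta> times a point of the ball. The a priori bound \<open>D\<close> only ensures
  that P is finite, so that it can be subtracted.\<close>

lemma sublinear_grid_bound:
  fixes f :: "(nat \<Rightarrow> real) \<Rightarrow> real"
  assumes "0 < n" "0 < \<delta>" "\<delta> \<le> 1 / 2"
    and add: "\<And>u v. f (\<lambda>j. u j + v j) \<le> f u + f v"
    and scale: "\<And>r u. 0 \<le> r \<Longrightarrow> f (\<lambda>j. r * u j) = r * f u"
    and bdd: "\<And>u. (\<Sum>j<n. (u j)\<^sup>2) \<le> 1 \<Longrightarrow> f u \<le> D"
    and grd: "\<And>k. k \<in> grid n \<delta> \<Longrightarrow> f (grid_point n \<delta> k) \<le> C"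
    and u: "(\<Sum>j<n. (u j)\<^sup>2) \<le> 1"
  shows "f u \<le> 2 * C"
proof -
  let ?B = "{u. (\<Sum>j<n. (u j)\<^sup>2) \<le> (1::real)}"
  define P where "P = (SUP u\<in>?B. f u)"
  have bd: "bdd_above (f ` ?B)" using bdd by (intro bdd_aboveI2) auto
  have le: "f v \<le> P" if "(\<Sum>j<n. (v j)\<^sup>2) \<le> 1" for v
    unfolding P_def using that by (intro cSUP_upper bd) auto
  have f0: "f (\<lambda>_. 0) = 0" using scale[of 0 "\<lambda>_. 0"] by simp
  have P0: "0 \<le> P" using le[of "\<lambda>_. 0"] f0 by simp
  have "f v \<le> C + P / 2" if v: "(\<Sum>j<n. (v j)\<^sup>2) \<le> 1" for v
  proof -
    obtain k where k: "k \<in> grid n \<delta>" "(\<Sum>j<n. (v j - grid_point n \<delta> k j)\<^sup>2) \<le> \<delta>\<^sup>2"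
      using grid_approximation[OF assms(1,2) v] by blast
    define w where "w j = (v j - grid_point n \<delta> k j) / \<delta>" for j
    have "(\<Sum>j<n. (w j)\<^sup>2) = (\<Sum>j<n. (v j - grid_point n \<delta> k j)\<^sup>2) / \<delta>\<^sup>2"
      by (simp add: w_def power_divide sum_divide_distrib)
    then have w: "(\<Sum>j<n. (w j)\<^sup>2) \<le> 1" using k(2) assms(2) by (simp add: divide_le_eq)
    have "v = (\<lambda>j. grid_point n \<delta> k j + \<delta> * w j)" using assms(2) by (auto simp: w_def)
    then have "f v \<le> f (grid_point n \<delta> k) + f (\<lambda>j. \<delta> * w j)" using add[of "grid_point n \<delta> k" "\<lambda>j. \<delta> * w j"] by simp
    also have "\<dots> = f (grid_point n \<delta> k) + \<delta> * f w" using scale[of \<delta> w] assms(2) by simp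
    also have "\<dots> \<le> C + \<delta> * P" using grd[OF k(1)] le[OF w] assms(2) by (intro add_mono mult_left_mono) auto
    also have "\<dots> \<le> C + P / 2" using mult_right_mono[OF assms(3) P0] by simp
    finally show ?thesis .
  qed
  then have "P \<le> C + P / 2" unfolding P_def by (intro cSUP_least) (auto intro: exI[of _ "\<lambda>_. 0"])
  then show ?thesis using le[OF u] by linarith
qed

text \<open>The weights \<open>w\<close> form an approximate dual solution; the last two grid conditions bound the
  norm of feasible points, which controls the effect of the dual residual.\<close>

lemma lp_upper_certificate:
  fixes a :: "nat \<Rightarrow> nat \<Rightarrow> real"
  assumes "0 < m" "0 < n" "0 < \<delta>" "\<delta> \<le> 1 / 2" "0 < c1" "0 \<le> \<kappa>" "4 * \<delta> * C1 \<le> c1"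
    and w: "\<And>i. i < m \<Longrightarrow> 0 \<le> w i" "(\<Sum>i<m. w i) \<le> real m * (1 + \<kappa>)"
    and resid: "\<And>k. k \<in> grid n \<delta> \<Longrightarrow> (\<Sum>i<m. w i * - (\<Sum>j<n. a i j * grid_point n \<delta> k j))
        \<le> real m * (\<kappa> - \<theta> * (\<Sum>j<n. c j * grid_point n \<delta> k j))"
    and upper: "\<And>k. k \<in> grid n \<delta> \<Longrightarrow> (\<Sum>i<m. max 0 (\<Sum>j<n. a i j * grid_point n \<delta> k j)) \<le> C1 * real m"
    and lower: "\<And>k. k \<in> grid n \<delta> \<Longrightarrow> 1 / 4 \<le> (\<Sum>j<n. (grid_point n \<delta> k j)\<^sup>2) \<Longrightarrow>
        c1 * real m \<le> (\<Sum>i<m. max 0 (\<Sum>j<n. a i j * grid_point n \<delta> k j))"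
    and x: "x \<in> lp_feasible m n a"
  shows "\<theta> * (\<Sum>j<n. c j * x j) \<le> 1 + \<kappa> + 4 * \<kappa> / c1"
proof -
  define dt where "dt i u = (\<Sum>j<n. a i j * u j)" for i and u :: "nat \<Rightarrow> real"
  define p where "p u = (\<Sum>i<m. max 0 (dt i u))" for u
  \<comment> \<open>The pairing of u with the dual residual, scaled by m. It is linear, so a
    one-sided bound on the ball suffices.\<close>
  define V where "V u = (\<Sum>i<m. w i * - dt i u) + real m * (\<theta> * (\<Sum>j<n. c j * u j))" for u
  have dt_add: "dt i (\<lambda>j. u j + v j) = dt i u + dt i v" for i u v
    by (simp add: dt_def distrib_left sum.distrib)
  have dt_scale: "dt i (\<lambda>j. r * u j) = r * dt i u" for i u r
    by (simp add: dt_def sum_distrib_left algebra_simps)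
  have ball: "\<bar>u j\<bar> \<le> 1" if "(\<Sum>j<n. (u j)\<^sup>2) \<le> 1" "j < n" for u :: "nat \<Rightarrow> real" and j
  proof -
    have "(u j)\<^sup>2 \<le> (\<Sum>j<n. (u j)\<^sup>2)" using that by (intro member_le_sum) auto
    then have "(u j)\<^sup>2 \<le> 1\<^sup>2" using that by simp
    then show ?thesis using abs_le_square_iff[of "u j" 1] by simp
  qed
  have lin_bd: "\<bar>\<Sum>j<n. b j * u j\<bar> \<le> (\<Sum>j<n. \<bar>b j\<bar>)" if "(\<Sum>j<n. (u j)\<^sup>2) \<le> 1" for b u :: "nat \<Rightarrow> real"
    using ball[OF that] by (intro order_trans[OF sum_abs] sum_mono) (auto simp: abs_mult intro: mult_left_le)
  have p_add: "p (\<lambda>j. u j + v j) \<le> p u + p v" for u v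
    unfolding p_def dt_add sum.distrib[symmetric] by (intro sum_mono) auto
  have p_scale: "p (\<lambda>j. r * u j) = r * p u" if "0 \<le> r" for r u
    unfolding p_def dt_scale sum_distrib_left using that
    by (intro sum.cong) (auto simp: max_def mult_le_0_iff zero_le_mult_iff)
  have p_le: "p u \<le> 2 * (C1 * real m)" if "(\<Sum>j<n. (u j)\<^sup>2) \<le> 1" for u
  proof (rule sublinear_grid_bound[where f = p, OF assms(2-4) p_add p_scale _ _ that])
    show "p u \<le> (\<Sum>i<m. \<Sum>j<n. \<bar>a i j\<bar>)" if "(\<Sum>j<n. (u j)\<^sup>2) \<le> 1" for u
      unfolding p_def dt_def using lin_bd[OF that]
      by (intro sum_mono) (auto simp: abs_le_iff intro: sum_nonneg)
    show "p (grid_point n \<delta> k) \<le> C1 * real m" if "k \<in> grid n \<delta>" for k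
      using upper[OF that] by (simp add: p_def dt_def)
  qed
  have V_le: "V u \<le> 2 * (real m * \<kappa>)" if "(\<Sum>j<n. (u j)\<^sup>2) \<le> 1" for u
  proof (rule sublinear_grid_bound[where f = V, OF assms(2-4) _ _ _ _ that])
    show "V (\<lambda>j. u j + v j) \<le> V u + V v" for u v
      by (simp add: V_def dt_add sum.distrib sum_negf sum_subtractf algebra_simps)
    show "V (\<lambda>j. r * u j) = r * V u" for r u
      by (simp add: V_def dt_scale sum_distrib_left distrib_left sum_negf algebra_simps)
    show "V u \<le> (\<Sum>i<m. w i * (\<Sum>j<n. \<bar>a i j\<bar>)) + real m * (\<bar>\<theta>\<bar> * (\<Sum>j<n. \<bar>c j\<bar>))"
      if "(\<Sum>j<n. (u j)\<^sup>2) \<le> 1" for u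
      unfolding V_def dt_def
    proof (intro add_mono sum_mono mult_left_mono)
      show "- (\<Sum>j<n. a i j * u j) \<le> (\<Sum>j<n. \<bar>a i j\<bar>)" for i using lin_bd[OF that, of "a i"] by linarith
      show "0 \<le> w i" if "i \<in> {..<m}" for i using w(1) that by simp
      have "\<theta> * (\<Sum>j<n. c j * u j) \<le> \<bar>\<theta>\<bar> * \<bar>\<Sum>j<n. c j * u j\<bar>" by (simp add: abs_mult[symmetric])
      also have "\<dots> \<le> \<bar>\<theta>\<bar> * (\<Sum>j<n. \<bar>c j\<bar>)" by (intro mult_left_mono lin_bd that) auto
      finally show "\<theta> * (\<Sum>j<n. c j * u j) \<le> \<bar>\<theta>\<bar> * (\<Sum>j<n. \<bar>c j\<bar>)" .
    qed simp
    show "V (grid_point n \<delta> k) \<le> real m * \<kappa>" if "k \<in> grid n \<delta>" for k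
      using resid[OF that] by (simp add: V_def dt_def algebra_simps)
  qed
  \<comment> \<open>The nearest grid point has norm at least 1 - \<delta>, hence squared norm at
    least 1/4, and \<open>lower\<close> applies to it. Moving back to u costs at most half of this
    bound, by the condition on \<open>4 * \<delta> * C1\<close>.\<close>
  have p_ge: "c1 / 2 * real m \<le> p u" if u: "(\<Sum>j<n. (u j)\<^sup>2) = 1" for u
  proof -
    obtain k where k: "k \<in> grid n \<delta>" "(\<Sum>j<n. (u j - grid_point n \<delta> k j)\<^sup>2) \<le> \<delta>\<^sup>2"
      using grid_approximation[OF assms(2,3)] u by (metis order_refl)
    let ?g = "grid_point n \<delta> k"
    have "L2_set u {..<n} = L2_set (\<lambda>j. ?g j + (u j - ?g j)) {..<n}" by simp
    also have "\<dots> \<le> L2_set ?g {..<n} + L2_set (\<lambda>j. u j - ?g j) {..<n}" by (rule L2_set_triangle_ineq)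
    also have "L2_set (\<lambda>j. u j - ?g j) {..<n} \<le> \<delta>"
      unfolding L2_set_def using k(2) assms(3) by (intro real_le_lsqrt) (auto intro: sum_nonneg)
    finally have "1 / 2 \<le> L2_set ?g {..<n}" using u assms(4) by (simp add: L2_set_def)
    then have "(1 / 2)\<^sup>2 \<le> (L2_set ?g {..<n})\<^sup>2" by (intro power_mono) auto
    then have "1 / 4 \<le> (\<Sum>j<n. (?g j)\<^sup>2)" by (simp add: L2_set_def sum_nonneg power2_eq_square)
    then have ge: "c1 * real m \<le> p ?g" using lower[OF k(1)] by (simp add: p_def dt_def)
    define v where "v j = (?g j - u j) / \<delta>" for j
    have "(\<Sum>j<n. (v j)\<^sup>2) = (\<Sum>j<n. (u j - ?g j)\<^sup>2) / \<delta>\<^sup>2"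
      by (simp add: v_def power_divide sum_divide_distrib power2_commute)
    then have v: "(\<Sum>j<n. (v j)\<^sup>2) \<le> 1" using k(2) assms(3) by (simp add: divide_le_eq)
    have "?g = (\<lambda>j. u j + \<delta> * v j)" using assms(3) by (auto simp: v_def)
    then have "p ?g \<le> p u + p (\<lambda>j. \<delta> * v j)" using p_add[of u "\<lambda>j. \<delta> * v j"] by simp
    also have "\<dots> = p u + \<delta> * p v" using p_scale[of \<delta> v] assms(3) by simp
    also have "\<dots> \<le> p u + \<delta> * (2 * (C1 * real m))" using p_le[OF v] assms(3) by (intro add_left_mono mult_left_mono) auto
    also have "\<delta> * (2 * (C1 * real m)) = (4 * \<delta> * C1) * real m / 2" by simp
    also have "\<dots> \<le> c1 * real m / 2" using assms(7) by (intro divide_right_mono mult_right_mono) auto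
    finally show ?thesis using ge by simp
  qed
  have feas: "dt i x \<le> 1" if "i < m" for i using x that by (simp add: lp_feasible_def dt_def)
  define \<rho> where "\<rho> = L2_set x {..<n}"
  have \<rho>: "0 \<le> \<rho>" "\<rho>\<^sup>2 = (\<Sum>j<n. (x j)\<^sup>2)" by (simp_all add: \<rho>_def L2_set_def sum_nonneg)
  show ?thesis
  proof (cases "\<rho> = 0")
    case True
    then have "(\<Sum>j<n. (x j)\<^sup>2) = 0" using \<rho> by simp
    then have "x j = 0" if "j < n" for j using that by (simp add: sum_nonneg_eq_0_iff)
    then have "(\<Sum>j<n. c j * x j) = 0" by simp
    moreover have "0 \<le> 4 * \<kappa> / c1" using assms by simp
    ultimately show ?thesis using assms by simp
  next
    case False
    then have \<rho>0: "0 < \<rho>" using \<rho> by simp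
    define u where "u j = x j / \<rho>" for j
    have "(\<Sum>j<n. (u j)\<^sup>2) = (\<Sum>j<n. (x j)\<^sup>2) / \<rho>\<^sup>2"
      by (simp add: u_def power_divide sum_divide_distrib)
    then have u: "(\<Sum>j<n. (u j)\<^sup>2) = 1" unfolding \<rho>(2)[symmetric] using \<rho>0 by simp
    have xu: "x = (\<lambda>j. \<rho> * u j)" using \<rho>0 by (auto simp: u_def)
    \<comment> \<open>Feasible points have every positive part at most 1, so \<open>p x\<close> is
      at most m, whereas \<open>p\<close> grows at least like c1 m / 2 times the norm. This bounds
      the norm by 2 / c1.\<close>
    have "p x \<le> (\<Sum>i<m. 1)" unfolding p_def using feas by (intro sum_mono) auto
    then have "\<rho> * p u \<le> real m" using p_scale[of \<rho> u] xu \<rho> by simp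
    moreover have "\<rho> * (c1 / 2 * real m) \<le> \<rho> * p u" using p_ge[OF u] \<rho> by (intro mult_left_mono) auto
    ultimately have "(\<rho> * c1 / 2) * real m \<le> 1 * real m" by simp
    then have "\<rho> * c1 / 2 \<le> 1" using assms(1) by (simp only: mult_le_cancel_right)
    then have \<rho>le: "\<rho> \<le> 2 / c1" using assms(5) by (simp add: field_simps)
    have Vx: "V x = \<rho> * V u"
      by (subst xu) (simp add: V_def dt_scale sum_distrib_left distrib_left sum_negf algebra_simps)
    \<comment> \<open>Weak duality with a residual: the weighted constraints contribute at most the
      mass of the weights, and \<open>V x\<close> is at most the norm of x times the residual
      bound.\<close>
    have "real m * (\<theta> * (\<Sum>j<n. c j * x j)) = (\<Sum>i<m. w i * dt i x) + V x"
      by (simp add: V_def sum_negf)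
    also have "\<dots> \<le> (\<Sum>i<m. w i * 1) + \<rho> * (2 * (real m * \<kappa>))"
      unfolding Vx using feas w(1) V_le[of u] u \<rho> by (intro add_mono sum_mono mult_left_mono) auto
    also have "\<dots> \<le> real m * (1 + \<kappa>) + 2 / c1 * (2 * (real m * \<kappa>))"
      using w(2) \<rho>le assms by (intro add_mono mult_right_mono) auto
    also have "\<dots> = real m * (1 + \<kappa> + 4 * \<kappa> / c1)" by (simp add: algebra_simps)
    finally show ?thesis using assms(1) by simp
  qed
qed

section \<open>Truncated exponential tilts\<close>

text \<open>The density of the exponential tilt would have a second moment of order \<open>(m / n)\<^sup>2\<close>, too large
  to beat a union bound over the grid; capping it at \<open>W = (m / n) powr (1 - \<epsilon>)\<close> changes its mean by \<open>o(1)\<close> only.\<close>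

definition trunc_tilt :: "real \<Rightarrow> real \<Rightarrow> real \<Rightarrow> real \<Rightarrow> real" where
  "trunc_tilt P \<theta> W g = (if exp (\<theta> * g) / P \<le> W then exp (\<theta> * g) / P else 0)"

lemma trunc_tilt_measurable[measurable]: "trunc_tilt P \<theta> W \<in> borel_measurable borel"
  unfolding trunc_tilt_def[abs_def] by measurable

lemma trunc_tilt_bounds:
  assumes "0 < P" "0 \<le> W"
  shows "0 \<le> trunc_tilt P \<theta> W g" "trunc_tilt P \<theta> W g \<le> W" "trunc_tilt P \<theta> W g \<le> exp (\<theta> * g) / P"
  using assms by (auto simp: trunc_tilt_def)

context prob_space
begin

text \<open>A Bernstein-type bound for weights with a large maximum: w^2 \<le> W w spends one factor
  \<open>W\<close>, and the remaining weight acts as a change of measure under which exp (2 |f|) has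
  the moderate moment \<open>Z\<close>. The condition s W \<le> 1 keeps the exponent below
  |f|.\<close>

lemma weighted_exp_bound:
  assumes [measurable]: "w \<in> borel_measurable M" "f \<in> borel_measurable M"
    and w: "\<And>\<omega>. 0 \<le> w \<omega>" "\<And>\<omega>. w \<omega> \<le> W" and s: "0 \<le> s" "s * W \<le> 1"
    and int: "integrable M (\<lambda>\<omega>. w \<omega> * f \<omega>)" and \<mu>: "expectation (\<lambda>\<omega>. w \<omega> * f \<omega>) \<le> \<mu>"
    and Z: "(\<integral>\<^sup>+ \<omega>. ennreal (w \<omega> * exp (2 * \<bar>f \<omega>\<bar>)) \<partial>M) \<le> ennreal Z" "0 \<le> Z"
  shows "(\<integral>\<^sup>+ \<omega>. ennreal (exp (s * (w \<omega> * f \<omega>))) \<partial>M) \<le> ennreal (exp (s * \<mu> + 2 * s\<^sup>2 * W * Z))"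
proof -
  have W: "0 \<le> W" using w[of undefined] by linarith
  have pt: "exp (s * (w \<omega> * f \<omega>)) \<le> 1 + s * (w \<omega> * f \<omega>) + 2 * s\<^sup>2 * W * (w \<omega> * exp (2 * \<bar>f \<omega>\<bar>))" for \<omega>
  proof -
    define y where "y = s * (w \<omega> * f \<omega>)"
    have "s * w \<omega> \<le> 1" using mult_left_mono[OF w(2) s(1)] s(2) by (rule order_trans)
    then have "s * w \<omega> * \<bar>f \<omega>\<bar> \<le> 1 * \<bar>f \<omega>\<bar>" by (intro mult_right_mono) auto
    then have "\<bar>y\<bar> \<le> \<bar>f \<omega>\<bar>" using s w by (simp add: y_def abs_mult mult.assoc)
    then have "exp \<bar>y\<bar> \<le> exp \<bar>f \<omega>\<bar>" by simp
    moreover have "(f \<omega>)\<^sup>2 \<le> 2 * exp \<bar>f \<omega>\<bar>" using power_le_fact_exp[of "\<bar>f \<omega>\<bar>" 2] by simp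
    ultimately have "(f \<omega>)\<^sup>2 * exp \<bar>y\<bar> \<le> 2 * exp \<bar>f \<omega>\<bar> * exp \<bar>f \<omega>\<bar>" by (intro mult_mono) auto
    also have "\<dots> = 2 * exp (2 * \<bar>f \<omega>\<bar>)" by (simp add: exp_add[symmetric])
    finally have fy: "(f \<omega>)\<^sup>2 * exp \<bar>y\<bar> \<le> 2 * exp (2 * \<bar>f \<omega>\<bar>)" .
    have "w \<omega> * w \<omega> \<le> W * w \<omega>" using w by (intro mult_right_mono) auto
    then have "(w \<omega> * w \<omega>) * ((f \<omega>)\<^sup>2 * exp \<bar>y\<bar>) \<le> (W * w \<omega>) * (2 * exp (2 * \<bar>f \<omega>\<bar>))"
      by (rule mult_mono[OF _ fy]) (use w W in auto)
    then have "s\<^sup>2 * ((w \<omega> * w \<omega>) * ((f \<omega>)\<^sup>2 * exp \<bar>y\<bar>)) \<le> s\<^sup>2 * ((W * w \<omega>) * (2 * exp (2 * \<bar>f \<omega>\<bar>)))"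
      by (intro mult_left_mono) auto
    then have "y\<^sup>2 * exp \<bar>y\<bar> \<le> 2 * s\<^sup>2 * W * (w \<omega> * exp (2 * \<bar>f \<omega>\<bar>))"
      by (simp add: y_def power2_eq_square algebra_simps)
    moreover have "exp y \<le> 1 + y + y\<^sup>2 * exp \<bar>y\<bar>" using exp_minus_linear_bound[of y] by linarith
    ultimately show ?thesis by (simp add: y_def)
  qed
  have intZ: "integrable M (\<lambda>\<omega>. w \<omega> * exp (2 * \<bar>f \<omega>\<bar>))" and EZ: "expectation (\<lambda>\<omega>. w \<omega> * exp (2 * \<bar>f \<omega>\<bar>)) \<le> Z"
    using w Z by (auto intro!: nn_integral_bound_imp_integrable)
  have int': "integrable M (\<lambda>\<omega>. 1 + s * (w \<omega> * f \<omega>) + 2 * s\<^sup>2 * W * (w \<omega> * exp (2 * \<bar>f \<omega>\<bar>)))"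
    using int intZ by auto
  have "(\<integral>\<^sup>+ \<omega>. ennreal (exp (s * (w \<omega> * f \<omega>))) \<partial>M)
      \<le> (\<integral>\<^sup>+ \<omega>. ennreal (1 + s * (w \<omega> * f \<omega>) + 2 * s\<^sup>2 * W * (w \<omega> * exp (2 * \<bar>f \<omega>\<bar>))) \<partial>M)"
    using pt by (intro nn_integral_mono ennreal_leI)
  also have "\<dots> = ennreal (expectation (\<lambda>\<omega>. 1 + s * (w \<omega> * f \<omega>) + 2 * s\<^sup>2 * W * (w \<omega> * exp (2 * \<bar>f \<omega>\<bar>))))"
    using order_trans[OF exp_ge_zero pt] by (intro nn_integral_eq_integral int' AE_I2)
  also have "expectation (\<lambda>\<omega>. 1 + s * (w \<omega> * f \<omega>) + 2 * s\<^sup>2 * W * (w \<omega> * exp (2 * \<bar>f \<omega>\<bar>)))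
      = 1 + s * expectation (\<lambda>\<omega>. w \<omega> * f \<omega>) + 2 * s\<^sup>2 * W * expectation (\<lambda>\<omega>. w \<omega> * exp (2 * \<bar>f \<omega>\<bar>))"
    using int intZ by (simp add: prob_space)
  also have "\<dots> \<le> 1 + s * \<mu> + 2 * s\<^sup>2 * W * Z"
    using s W \<mu> EZ by (intro add_mono mult_left_mono) auto
  also have "\<dots> \<le> exp (s * \<mu> + 2 * s\<^sup>2 * W * Z)"
    using exp_ge_add_one_self[of "s * \<mu> + 2 * s\<^sup>2 * W * Z"] by linarith
  finally show ?thesis by (simp add: ennreal_leI)
qed

end

section \<open>Moments under the truncated tilt\<close>

context random_matrix
begin

lemma row_exp_square_expectation:
  assumes "i < m" "(\<Sum>j<n. (u j)\<^sup>2) \<le> 1"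
  shows "integrable M (\<lambda>\<omega>. exp ((row i u \<omega>)\<^sup>2 / (16 * K\<^sup>2)))"
    and "expectation (\<lambda>\<omega>. exp ((row i u \<omega>)\<^sup>2 / (16 * K\<^sup>2))) \<le> 2"
proof -
  have [measurable]: "row i u \<in> borel_measurable M" using assms by measurable
  note b = nn_integral_bound_imp_integrable[OF _ _ row_exp_square_le[OF assms]]
  show "integrable M (\<lambda>\<omega>. exp ((row i u \<omega>)\<^sup>2 / (16 * K\<^sup>2)))"
    "expectation (\<lambda>\<omega>. exp ((row i u \<omega>)\<^sup>2 / (16 * K\<^sup>2))) \<le> 2"
    using b by auto
qed

lemma row_tail_factor:
  fixes y R :: real
  assumes "R \<le> \<bar>y\<bar>" "0 \<le> R"
  shows "exp (y\<^sup>2 / (32 * K\<^sup>2)) \<le> exp (- R\<^sup>2 / (32 * K\<^sup>2)) * exp (y\<^sup>2 / (16 * K\<^sup>2))"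
proof -
  have "R\<^sup>2 \<le> \<bar>y\<bar>\<^sup>2" using assms by (intro power_mono) auto
  then have "R\<^sup>2 / (32 * K\<^sup>2) \<le> y\<^sup>2 / (32 * K\<^sup>2)" by (intro divide_right_mono) auto
  moreover have "y\<^sup>2 / (16 * K\<^sup>2) = y\<^sup>2 / (32 * K\<^sup>2) + y\<^sup>2 / (32 * K\<^sup>2)" by (simp add: field_simps)
  ultimately have "y\<^sup>2 / (32 * K\<^sup>2) \<le> - R\<^sup>2 / (32 * K\<^sup>2) + y\<^sup>2 / (16 * K\<^sup>2)" by simp
  then show ?thesis by (simp only: exp_add[symmetric] exp_le_cancel_iff)
qed

definition tilt_norm :: "(nat \<Rightarrow> real) \<Rightarrow> real \<Rightarrow> nat \<Rightarrow> real" where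
  "tilt_norm c \<theta> i = expectation (\<lambda>\<omega>. exp (\<theta> * row i c \<omega>))"

lemma tilt_norm_ge_1: "i < m \<Longrightarrow> 1 \<le> tilt_norm c \<theta> i"
  unfolding tilt_norm_def row_lin by (intro exp_lin_pos row_subset)

lemma integrable_exp_row: "i < m \<Longrightarrow> integrable M (\<lambda>\<omega>. exp (\<theta> * row i c \<omega>))"
  unfolding row_lin by (intro exp_lin_integrable row_subset)

text \<open>For |y| \<le> R the exponential is at most exp (2 R) and the untruncated density has
  mean 1. For |y| > R the weight is bounded by \<open>W\<close>, which the tail factor exp (- R^2 /
  (32 K^2)) cancels by hypothesis.\<close>

lemma trunc_tilt_exp_moment:
  assumes i: "i < m" and u: "(\<Sum>j<n. (u j)\<^sup>2) \<le> 1" and R: "0 \<le> R" "W * exp (- R\<^sup>2 / (32 * K\<^sup>2)) \<le> 1" and W: "0 \<le> W"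
  shows "(\<integral>\<^sup>+ \<omega>. ennreal (trunc_tilt (tilt_norm c \<theta> i) \<theta> W (row i c \<omega>) * exp (2 * \<bar>row i u \<omega>\<bar>)) \<partial>M)
    \<le> ennreal (exp (2 * R) + 2 * exp (32 * K\<^sup>2))"
proof -
  define P where "P = tilt_norm c \<theta> i"
  have P: "1 \<le> P" using tilt_norm_ge_1[OF i] by (simp add: P_def)
  have [measurable]: "row i u \<in> borel_measurable M" "row i c \<in> borel_measurable M" using i by measurable
  have pt: "trunc_tilt P \<theta> W g * exp (2 * \<bar>y\<bar>) \<le> exp (2 * R) / P * exp (\<theta> * g) + exp (32 * K\<^sup>2) * exp (y\<^sup>2 / (16 * K\<^sup>2))"
    for g y
  proof -
    note tb = trunc_tilt_bounds[of P W \<theta> g]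
    show ?thesis
    proof (cases "\<bar>y\<bar> \<le> R")
      case True
      have "trunc_tilt P \<theta> W g * exp (2 * \<bar>y\<bar>) \<le> (exp (\<theta> * g) / P) * exp (2 * R)"
        using True tb P W by (intro mult_mono) auto
      moreover have "0 \<le> exp (32 * K\<^sup>2) * exp (y\<^sup>2 / (16 * K\<^sup>2))" by simp
      moreover have "(exp (\<theta> * g) / P) * exp (2 * R) = exp (2 * R) / P * exp (\<theta> * g)" by simp
      ultimately show ?thesis by linarith
    next
      case False
      have "0 \<le> (\<bar>y\<bar> - 32 * K\<^sup>2)\<^sup>2" by simp
      then have "2 * \<bar>y\<bar> * (32 * K\<^sup>2) \<le> (32 * K\<^sup>2 + y\<^sup>2 / (32 * K\<^sup>2)) * (32 * K\<^sup>2)"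
        using K_ge_1 by (simp add: power2_diff algebra_simps power2_eq_square)
      moreover have "0 < 32 * K\<^sup>2" using K_ge_1 by simp
      ultimately have "2 * \<bar>y\<bar> \<le> 32 * K\<^sup>2 + y\<^sup>2 / (32 * K\<^sup>2)" by (simp only: mult_le_cancel_right_pos)
      then have "exp (2 * \<bar>y\<bar>) \<le> exp (32 * K\<^sup>2) * exp (y\<^sup>2 / (32 * K\<^sup>2))" by (simp add: exp_add[symmetric])
      also have "\<dots> \<le> exp (32 * K\<^sup>2) * (exp (- R\<^sup>2 / (32 * K\<^sup>2)) * exp (y\<^sup>2 / (16 * K\<^sup>2)))"
        using False R by (intro mult_left_mono row_tail_factor) auto
      finally have "trunc_tilt P \<theta> W g * exp (2 * \<bar>y\<bar>)
          \<le> W * (exp (32 * K\<^sup>2) * (exp (- R\<^sup>2 / (32 * K\<^sup>2)) * exp (y\<^sup>2 / (16 * K\<^sup>2))))"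
        using tb P W by (intro mult_mono) auto
      also have "\<dots> = (W * exp (- R\<^sup>2 / (32 * K\<^sup>2))) * (exp (32 * K\<^sup>2) * exp (y\<^sup>2 / (16 * K\<^sup>2)))"
        by (simp add: algebra_simps)
      also have "\<dots> \<le> 1 * (exp (32 * K\<^sup>2) * exp (y\<^sup>2 / (16 * K\<^sup>2)))" using R by (intro mult_right_mono) auto
      finally have "trunc_tilt P \<theta> W g * exp (2 * \<bar>y\<bar>) \<le> exp (32 * K\<^sup>2) * exp (y\<^sup>2 / (16 * K\<^sup>2))" by simp
      moreover have "0 \<le> exp (2 * R) / P * exp (\<theta> * g)" using P by simp
      ultimately show ?thesis by linarith
    qed
  qed
  note e2 = row_exp_square_expectation[OF i u]
  have int: "integrable M (\<lambda>\<omega>. exp (2 * R) / P * exp (\<theta> * row i c \<omega>) + exp (32 * K\<^sup>2) * exp ((row i u \<omega>)\<^sup>2 / (16 * K\<^sup>2)))"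
    using integrable_exp_row[OF i] e2 by (intro Bochner_Integration.integrable_add integrable_mult_right) auto
  have nonneg: "0 \<le> trunc_tilt P \<theta> W g * exp (2 * \<bar>y\<bar>)" for g y
    using trunc_tilt_bounds(1)[of P W] P W by simp
  have "(\<integral>\<^sup>+ \<omega>. ennreal (trunc_tilt P \<theta> W (row i c \<omega>) * exp (2 * \<bar>row i u \<omega>\<bar>)) \<partial>M)
      \<le> (\<integral>\<^sup>+ \<omega>. ennreal (exp (2 * R) / P * exp (\<theta> * row i c \<omega>) + exp (32 * K\<^sup>2) * exp ((row i u \<omega>)\<^sup>2 / (16 * K\<^sup>2))) \<partial>M)"
    using pt by (intro nn_integral_mono ennreal_leI)
  also have "\<dots> = ennreal (expectation (\<lambda>\<omega>. exp (2 * R) / P * exp (\<theta> * row i c \<omega>) + exp (32 * K\<^sup>2) * exp ((row i u \<omega>)\<^sup>2 / (16 * K\<^sup>2))))"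
    using order_trans[OF nonneg pt] by (intro nn_integral_eq_integral int AE_I2)
  also have "expectation (\<lambda>\<omega>. exp (2 * R) / P * exp (\<theta> * row i c \<omega>) + exp (32 * K\<^sup>2) * exp ((row i u \<omega>)\<^sup>2 / (16 * K\<^sup>2)))
      = exp (2 * R) / P * P + exp (32 * K\<^sup>2) * expectation (\<lambda>\<omega>. exp ((row i u \<omega>)\<^sup>2 / (16 * K\<^sup>2)))"
    using integrable_exp_row[OF i] e2 by (simp add: P_def tilt_norm_def)
  also have "\<dots> \<le> exp (2 * R) + exp (32 * K\<^sup>2) * 2"
    using e2(2) P by (intro add_mono mult_left_mono) auto
  finally show ?thesis by (simp add: P_def ennreal_leI mult.commute)
qed

text \<open>The truncated density is the full one minus its part T above the level. The full density
  is treated by \<open>tilted_lin\<close>, which gives the first summand of \<open>err\<close>. The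
  contribution of T is split by the size of the second product: a moment of order 1 + \<alpha> of
  the density gives the summand with \<open>W\<close>, and the inequality between arithmetic and
  geometric means gives the two with \<open>Q\<close>.\<close>

lemma trunc_tilt_mean:
  assumes i: "i < m" and c: "(\<Sum>j<n. (c j)\<^sup>2) = 1" and u: "(\<Sum>j<n. (u j)\<^sup>2) \<le> 1"
    and r: "\<And>j. j < n \<Longrightarrow> \<bar>c j\<bar> \<le> r" "0 \<le> r" "4 * (cubic_const K + 1) * (\<theta> * r) \<le> \<zeta>" "\<zeta> \<le> 1"
    and par: "0 \<le> \<theta>" "0 \<le> \<alpha>" "\<alpha> \<le> 1" "0 < W" "0 \<le> R" "0 < Q"
  defines "err \<equiv> 3 * cubic_const K * \<theta>\<^sup>2 * r
     + (R * exp (((1 + \<alpha>) * \<theta>)\<^sup>2 / 2 * (1 + \<zeta>) - (1 + \<alpha>) * (\<theta>\<^sup>2 / 2 * (1 - \<zeta>)) - \<alpha> * ln W)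
        + (exp (4 * \<theta>\<^sup>2) / Q + 64 * K\<^sup>2 * Q * exp (- R\<^sup>2 / (32 * K\<^sup>2))))"
  shows "integrable M (\<lambda>\<omega>. trunc_tilt (tilt_norm c \<theta> i) \<theta> W (row i c \<omega>) * - row i u \<omega>)"
    and "expectation (\<lambda>\<omega>. trunc_tilt (tilt_norm c \<theta> i) \<theta> W (row i c \<omega>) * - row i u \<omega>) \<le> err - \<theta> * (\<Sum>j<n. c j * u j)"
proof -
  define P where "P = tilt_norm c \<theta> i"
  have P: "1 \<le> P" using tilt_norm_ge_1[OF i] by (simp add: P_def)
  define G where "G = row i c"
  define Y where "Y = row i u"
  have [measurable]: "G \<in> borel_measurable M" "Y \<in> borel_measurable M" using i by (auto simp: G_def Y_def)
  have C12: "12 \<le> cubic_const K" by (rule cubic_const_ge)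
  \<comment> \<open>Parameters up to 2 \<theta> occur, through the moments of order 1 + \<alpha> and
    2 of the density; hence the factor 4 in the hypothesis on \<open>r\<close>.\<close>
  have small: "2 * (cubic_const K + 1) * \<bar>s * c j\<bar> \<le> \<zeta>" if "0 \<le> s" "s \<le> 2 * \<theta>" "j < n" for s j
  proof -
    have "\<bar>s * c j\<bar> \<le> 2 * \<theta> * r" unfolding abs_mult using that r(1)[OF that(3)] by (intro mult_mono) auto
    then have "2 * (cubic_const K + 1) * \<bar>s * c j\<bar> \<le> 2 * (cubic_const K + 1) * (2 * \<theta> * r)"
      using C12 by (intro mult_left_mono) auto
    also have "\<dots> = 4 * (cubic_const K + 1) * (\<theta> * r)" by (simp add: algebra_simps)
    finally show ?thesis using r(3) by linarith
  qed
  note gb = row_exp_gaussian_bounds[OF i c r(4) small]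
  have lnP: "\<theta>\<^sup>2 / 2 * (1 - \<zeta>) \<le> ln P"
  proof -
    have "exp (\<theta>\<^sup>2 / 2 * (1 - \<zeta>)) \<le> P"
      using gb(1)[of \<theta>] par unfolding P_def tilt_norm_def by simp
    then show ?thesis using P by (subst ln_ge_iff) auto
  qed
  have tl: "integrable M (\<lambda>\<omega>. exp (\<theta> * G \<omega>) * Y \<omega>)"
    "\<bar>expectation (\<lambda>\<omega>. exp (\<theta> * G \<omega>) * Y \<omega>) / P - \<theta> * (\<Sum>j<n. c j * u j)\<bar> \<le> 3 * cubic_const K * \<theta>\<^sup>2 * r"
  proof -
    have tr: "\<bar>\<theta>\<bar> * r \<le> 1"
    proof -
      have "1 * (\<theta> * r) \<le> 4 * (cubic_const K + 1) * (\<theta> * r)" using C12 par r by (intro mult_right_mono) auto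
      then show ?thesis using r par by simp
    qed
    have *: "(\<Sum>p\<in>{i} \<times> {..<n}. ((\<lambda>(i, j). c j) p)\<^sup>2) \<le> 1" "(\<Sum>p\<in>{i} \<times> {..<n}. ((\<lambda>(i, j). u j) p)\<^sup>2) \<le> 1"
      "\<And>p. p \<in> {i} \<times> {..<n} \<Longrightarrow> \<bar>(\<lambda>(i, j). c j) p\<bar> \<le> r"
      using c u r by (auto simp: sum_row_index)
    note t = tilted_lin[OF row_subset[OF i] * r(2) tr]
    show "integrable M (\<lambda>\<omega>. exp (\<theta> * G \<omega>) * Y \<omega>)" using t(1) by (simp add: G_def Y_def row_lin)
    show "\<bar>expectation (\<lambda>\<omega>. exp (\<theta> * G \<omega>) * Y \<omega>) / P - \<theta> * (\<Sum>j<n. c j * u j)\<bar> \<le> 3 * cubic_const K * \<theta>\<^sup>2 * r"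
      using t(2) by (simp add: G_def Y_def P_def tilt_norm_def row_lin sum_row_index)
  qed
  define T where "T g = (if exp (\<theta> * g) / P \<le> W then 0 else exp (\<theta> * g) / P)" for g
  have [measurable]: "T \<in> borel_measurable borel" unfolding T_def[abs_def] by measurable
  have split: "trunc_tilt P \<theta> W g = exp (\<theta> * g) / P - T g" for g by (simp add: trunc_tilt_def T_def)
  define S where "S \<omega> = R * exp (- ((1 + \<alpha>) * ln P) - \<alpha> * ln W) * exp ((1 + \<alpha>) * \<theta> * G \<omega>)
      + (exp (2 * \<theta> * G \<omega>) / P\<^sup>2 / Q + 32 * K\<^sup>2 * Q * exp (- R\<^sup>2 / (32 * K\<^sup>2)) * exp ((Y \<omega>)\<^sup>2 / (16 * K\<^sup>2)))" for \<omega>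
  have pt: "\<bar>T (G \<omega>) * Y \<omega>\<bar> \<le> S \<omega>" for \<omega>
  proof (cases "exp (\<theta> * G \<omega>) / P \<le> W")
    case True
    then show ?thesis using par K_ge_1 P by (simp add: T_def S_def add_nonneg_nonneg)
  next
    case False
    define D where "D = exp (\<theta> * G \<omega>) / P"
    have D: "D = exp (\<theta> * G \<omega> - ln P)" using P by (simp add: D_def exp_diff)
    have T: "T (G \<omega>) = D" using False by (simp add: T_def D_def)
    have D0: "0 \<le> D" using P by (simp add: D_def)
    show ?thesis
    proof (cases "\<bar>Y \<omega>\<bar> \<le> R")
      case True
      have "W < exp (\<theta> * G \<omega> - ln P)" using False D D_def by simp
      then have "ln W \<le> \<theta> * G \<omega> - ln P" using par ln_less_cancel_iff[of W "exp (\<theta> * G \<omega> - ln P)"] by simp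
      \<comment> \<open>Rankin's trick: D exceeds \<open>W\<close> here, so D is at most D (D /
        W)^\<alpha>.\<close>
      then have "0 \<le> \<alpha> * (\<theta> * G \<omega> - ln P - ln W)" using par by simp
      then have "D \<le> exp ((\<theta> * G \<omega> - ln P) + \<alpha> * (\<theta> * G \<omega> - ln P - ln W))" by (simp add: D)
      also have "(\<theta> * G \<omega> - ln P) + \<alpha> * (\<theta> * G \<omega> - ln P - ln W) = (- ((1 + \<alpha>) * ln P) - \<alpha> * ln W) + (1 + \<alpha>) * \<theta> * G \<omega>"
        by (simp add: algebra_simps)
      finally have "D \<le> exp (- ((1 + \<alpha>) * ln P) - \<alpha> * ln W) * exp ((1 + \<alpha>) * \<theta> * G \<omega>)" by (simp only: exp_add)
      then have "D * \<bar>Y \<omega>\<bar> \<le> (exp (- ((1 + \<alpha>) * ln P) - \<alpha> * ln W) * exp ((1 + \<alpha>) * \<theta> * G \<omega>)) * R"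
        using True D0 by (intro mult_mono) auto
      moreover have "0 \<le> exp (2 * \<theta> * G \<omega>) / P\<^sup>2 / Q + 32 * K\<^sup>2 * Q * exp (- R\<^sup>2 / (32 * K\<^sup>2)) * exp ((Y \<omega>)\<^sup>2 / (16 * K\<^sup>2))"
        using par by (intro add_nonneg_nonneg) auto
      ultimately show ?thesis using D0 by (simp add: T abs_mult S_def algebra_simps)
    next
      case False
      \<comment> \<open>A weighted inequality of arithmetic and geometric means separates the
        density from the second product; \<open>Q\<close> balances the second moment of the density
        against the tail of Y beyond \<open>R\<close>.\<close>
      have "0 \<le> (D - Q * \<bar>Y \<omega>\<bar>)\<^sup>2" by simp
      then have "2 * Q * (D * \<bar>Y \<omega>\<bar>) \<le> D\<^sup>2 + Q\<^sup>2 * (Y \<omega>)\<^sup>2"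
        by (simp add: power2_diff power_mult_distrib ac_simps)
      also have "\<dots> \<le> 2 * (D\<^sup>2 + Q\<^sup>2 * (Y \<omega>)\<^sup>2)" by (simp add: sum_power2_ge_zero)
      finally have "Q * (D * \<bar>Y \<omega>\<bar>) \<le> Q * (D\<^sup>2 / Q + Q * (Y \<omega>)\<^sup>2)" using par by (simp add: power2_eq_square distrib_left)
      then have "D * \<bar>Y \<omega>\<bar> \<le> D\<^sup>2 / Q + Q * (Y \<omega>)\<^sup>2" using par by (simp only: mult_le_cancel_left_pos)
      moreover have "D\<^sup>2 = exp (2 * \<theta> * G \<omega>) / P\<^sup>2"
        by (simp add: D_def power_divide power2_eq_square exp_add[symmetric])
      moreover have "Q * (Y \<omega>)\<^sup>2 \<le> Q * (32 * K\<^sup>2 * (exp (- R\<^sup>2 / (32 * K\<^sup>2)) * exp ((Y \<omega>)\<^sup>2 / (16 * K\<^sup>2))))"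
      proof (rule mult_left_mono)
        have "(Y \<omega>)\<^sup>2 = 32 * K\<^sup>2 * ((Y \<omega>)\<^sup>2 / (32 * K\<^sup>2))" using K_ge_1 by simp
        also have "\<dots> \<le> 32 * K\<^sup>2 * exp ((Y \<omega>)\<^sup>2 / (32 * K\<^sup>2))"
        proof (rule mult_left_mono)
          show "(Y \<omega>)\<^sup>2 / (32 * K\<^sup>2) \<le> exp ((Y \<omega>)\<^sup>2 / (32 * K\<^sup>2))"
            using exp_ge_add_one_self[of "(Y \<omega>)\<^sup>2 / (32 * K\<^sup>2)"] by linarith
        qed simp
        also have "\<dots> \<le> 32 * K\<^sup>2 * (exp (- R\<^sup>2 / (32 * K\<^sup>2)) * exp ((Y \<omega>)\<^sup>2 / (16 * K\<^sup>2)))"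
          using False par by (intro mult_left_mono row_tail_factor) auto
        finally show "(Y \<omega>)\<^sup>2 \<le> 32 * K\<^sup>2 * (exp (- R\<^sup>2 / (32 * K\<^sup>2)) * exp ((Y \<omega>)\<^sup>2 / (16 * K\<^sup>2)))" .
      qed (use par in auto)
      moreover have "0 \<le> R * exp (- ((1 + \<alpha>) * ln P) - \<alpha> * ln W) * exp ((1 + \<alpha>) * \<theta> * G \<omega>)" using par by simp
      ultimately show ?thesis using D0 by (simp add: T abs_mult S_def algebra_simps)
    qed
  qed
  have iG: "integrable M (\<lambda>\<omega>. exp (s * G \<omega>))" for s unfolding G_def by (rule integrable_exp_row[OF i])
  note eY = row_exp_square_expectation[OF i u, folded Y_def]
  have iS: "integrable M S"
    unfolding S_def[abs_def] using iG eY(1)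
    by (intro Bochner_Integration.integrable_add integrable_mult_right integrable_divide_zero) auto
  have iT: "integrable M (\<lambda>\<omega>. T (G \<omega>) * Y \<omega>)"
    using pt order_trans[OF abs_ge_zero pt] by (intro Bochner_Integration.integrable_bound[OF iS] AE_I2) auto
  have ES: "expectation S \<le> R * exp (((1 + \<alpha>) * \<theta>)\<^sup>2 / 2 * (1 + \<zeta>) - (1 + \<alpha>) * (\<theta>\<^sup>2 / 2 * (1 - \<zeta>)) - \<alpha> * ln W)
        + (exp (4 * \<theta>\<^sup>2) / Q + 64 * K\<^sup>2 * Q * exp (- R\<^sup>2 / (32 * K\<^sup>2)))"
  proof -
    have "expectation S = R * exp (- ((1 + \<alpha>) * ln P) - \<alpha> * ln W) * expectation (\<lambda>\<omega>. exp ((1 + \<alpha>) * \<theta> * G \<omega>))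
      + (expectation (\<lambda>\<omega>. exp (2 * \<theta> * G \<omega>)) / P\<^sup>2 / Q
        + 32 * K\<^sup>2 * Q * exp (- R\<^sup>2 / (32 * K\<^sup>2)) * expectation (\<lambda>\<omega>. exp ((Y \<omega>)\<^sup>2 / (16 * K\<^sup>2))))"
      unfolding S_def[abs_def] using iG eY(1) by simp
    also have "\<dots> \<le> R * exp (((1 + \<alpha>) * \<theta>)\<^sup>2 / 2 * (1 + \<zeta>) - (1 + \<alpha>) * (\<theta>\<^sup>2 / 2 * (1 - \<zeta>)) - \<alpha> * ln W)
        + (exp (4 * \<theta>\<^sup>2) / Q + 64 * K\<^sup>2 * Q * exp (- R\<^sup>2 / (32 * K\<^sup>2)))"
    proof (intro add_mono)
      have "(1 + \<alpha>) * \<theta> \<le> 2 * \<theta>" using par by (intro mult_right_mono) auto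
      then have "expectation (\<lambda>\<omega>. exp ((1 + \<alpha>) * \<theta> * G \<omega>)) \<le> exp (((1 + \<alpha>) * \<theta>)\<^sup>2 / 2 * (1 + \<zeta>))"
        unfolding G_def using par by (intro gb(2)) auto
      then have "R * exp (- ((1 + \<alpha>) * ln P) - \<alpha> * ln W) * expectation (\<lambda>\<omega>. exp ((1 + \<alpha>) * \<theta> * G \<omega>))
          \<le> R * exp (- ((1 + \<alpha>) * ln P) - \<alpha> * ln W) * exp (((1 + \<alpha>) * \<theta>)\<^sup>2 / 2 * (1 + \<zeta>))"
        using par by (intro mult_left_mono) auto
      also have "\<dots> = R * exp (((1 + \<alpha>) * \<theta>)\<^sup>2 / 2 * (1 + \<zeta>) - (1 + \<alpha>) * ln P - \<alpha> * ln W)"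
        by (simp add: exp_add[symmetric] algebra_simps)
      also have "\<dots> \<le> R * exp (((1 + \<alpha>) * \<theta>)\<^sup>2 / 2 * (1 + \<zeta>) - (1 + \<alpha>) * (\<theta>\<^sup>2 / 2 * (1 - \<zeta>)) - \<alpha> * ln W)"
      proof -
        have "(1 + \<alpha>) * (\<theta>\<^sup>2 / 2 * (1 - \<zeta>)) \<le> (1 + \<alpha>) * ln P" using lnP par by (intro mult_left_mono) auto
        then show ?thesis using par by (intro mult_left_mono) auto
      qed
      finally show "R * exp (- ((1 + \<alpha>) * ln P) - \<alpha> * ln W) * expectation (\<lambda>\<omega>. exp ((1 + \<alpha>) * \<theta> * G \<omega>))
        \<le> R * exp (((1 + \<alpha>) * \<theta>)\<^sup>2 / 2 * (1 + \<zeta>) - (1 + \<alpha>) * (\<theta>\<^sup>2 / 2 * (1 - \<zeta>)) - \<alpha> * ln W)" .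
      have "expectation (\<lambda>\<omega>. exp (2 * \<theta> * G \<omega>)) \<le> exp ((2 * \<theta>)\<^sup>2 / 2 * (1 + \<zeta>))"
        unfolding G_def using par by (intro gb(2)) auto
      also have "\<dots> \<le> exp (4 * \<theta>\<^sup>2)"
        using mult_left_mono[of "1 + \<zeta>" 2 "2 * \<theta>\<^sup>2"] r(4) by (simp add: power_mult_distrib)
      finally have "expectation (\<lambda>\<omega>. exp (2 * \<theta> * G \<omega>)) / P\<^sup>2 \<le> exp (4 * \<theta>\<^sup>2) / 1"
        using P by (intro frac_le) auto
      then show "expectation (\<lambda>\<omega>. exp (2 * \<theta> * G \<omega>)) / P\<^sup>2 / Q \<le> exp (4 * \<theta>\<^sup>2) / Q"
        using par by (intro divide_right_mono) auto
      have "32 * K\<^sup>2 * Q * exp (- R\<^sup>2 / (32 * K\<^sup>2)) * expectation (\<lambda>\<omega>. exp ((Y \<omega>)\<^sup>2 / (16 * K\<^sup>2)))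
          \<le> 32 * K\<^sup>2 * Q * exp (- R\<^sup>2 / (32 * K\<^sup>2)) * 2"
        using eY(2) par by (intro mult_left_mono) auto
      then show "32 * K\<^sup>2 * Q * exp (- R\<^sup>2 / (32 * K\<^sup>2)) * expectation (\<lambda>\<omega>. exp ((Y \<omega>)\<^sup>2 / (16 * K\<^sup>2)))
          \<le> 64 * K\<^sup>2 * Q * exp (- R\<^sup>2 / (32 * K\<^sup>2))" by simp
    qed
    finally show ?thesis .
  qed
  have eq: "trunc_tilt P \<theta> W (G \<omega>) * - Y \<omega> = T (G \<omega>) * Y \<omega> - exp (\<theta> * G \<omega>) * Y \<omega> / P" for \<omega>
    by (simp add: split algebra_simps)
  show "integrable M (\<lambda>\<omega>. trunc_tilt (tilt_norm c \<theta> i) \<theta> W (row i c \<omega>) * - row i u \<omega>)"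
    unfolding P_def[symmetric] G_def[symmetric] Y_def[symmetric] eq using iT tl(1) by auto
  have "expectation (\<lambda>\<omega>. trunc_tilt P \<theta> W (G \<omega>) * - Y \<omega>)
      = expectation (\<lambda>\<omega>. T (G \<omega>) * Y \<omega>) - expectation (\<lambda>\<omega>. exp (\<theta> * G \<omega>) * Y \<omega>) / P"
    unfolding eq using iT tl(1) by simp
  moreover have "expectation (\<lambda>\<omega>. T (G \<omega>) * Y \<omega>) \<le> expectation S"
    using iT iS pt by (intro integral_mono) (auto intro: order_trans[OF abs_ge_self])
  ultimately show "expectation (\<lambda>\<omega>. trunc_tilt (tilt_norm c \<theta> i) \<theta> W (row i c \<omega>) * - row i u \<omega>) \<le> err - \<theta> * (\<Sum>j<n. c j * u j)"
    using tl(2) ES unfolding P_def[symmetric] G_def[symmetric] Y_def[symmetric] err_def by linarith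
qed

end

section \<open>The event for the upper bound\<close>

context random_matrix
begin

lemma grid_pos_part_upper:
  assumes u: "(\<Sum>j<n. (u j)\<^sup>2) \<le> 1"
  shows "prob {\<omega> \<in> space M. \<not> (\<Sum>i<m. max 0 (row i u \<omega>)) \<le> (1 + exp (K\<^sup>2)) * real m} \<le> exp (- real m)"
proof -
  have one: "(\<integral>\<^sup>+ \<omega>. ennreal (exp (max 0 (row i u \<omega>))) \<partial>M) \<le> ennreal (1 + exp (K\<^sup>2))" if i: "i < m" for i
  proof -
    have [measurable]: "row i u \<in> borel_measurable M" using i by measurable
    have "(\<integral>\<^sup>+ \<omega>. ennreal (exp (max 0 (row i u \<omega>))) \<partial>M) \<le> (\<integral>\<^sup>+ \<omega>. ennreal 1 + ennreal (exp (1 * row i u \<omega>)) \<partial>M)"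
      by (intro nn_integral_mono) (auto simp: max_def ennreal_plus[symmetric] simp del: ennreal_plus ennreal_1 intro!: ennreal_leI)
    also have "\<dots> = 1 + (\<integral>\<^sup>+ \<omega>. ennreal (exp (1 * row i u \<omega>)) \<partial>M)"
      by (simp add: nn_integral_add emeasure_space_1)
    also have "\<dots> \<le> 1 + ennreal (exp (K\<^sup>2 * 1 * 1\<^sup>2))"
      by (intro add_left_mono row_exp_le i u)
    also have "\<dots> = ennreal (1 + exp (K\<^sup>2))" by (simp add: ennreal_plus)
    finally show ?thesis .
  qed
  have "prob {\<omega> \<in> space M. \<not> (\<Sum>i<m. max 0 (row i u \<omega>)) \<le> (1 + exp (K\<^sup>2)) * real m}
      \<le> prob {\<omega> \<in> space M. (1 + exp (K\<^sup>2)) * real m \<le> (\<Sum>i<m. max 0 (row i u \<omega>))}"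
    by (intro finite_measure_mono) auto
  also have "\<dots> \<le> (1 + exp (K\<^sup>2)) ^ m * exp (- ((1 + exp (K\<^sup>2)) * real m))"
    using one by (intro rows_chernoff[where \<psi> = "\<lambda>_ x y. max 0 y" and u = u]) (auto intro: add_nonneg_nonneg)
  also have "\<dots> \<le> exp (exp (K\<^sup>2)) ^ m * exp (- ((1 + exp (K\<^sup>2)) * real m))"
    by (intro mult_right_mono power_mono exp_ge_add_one_self) (auto intro: add_nonneg_nonneg)
  also have "\<dots> = exp (- real m)"
    by (simp add: exp_of_nat_mult[symmetric] exp_add[symmetric] algebra_simps)
  finally show ?thesis .
qed

lemma grid_pos_part_lower:
  assumes u: "(\<Sum>j<n. (u j)\<^sup>2) \<le> 1" "1 / 4 \<le> (\<Sum>j<n. (u j)\<^sup>2)"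
  shows "prob {\<omega> \<in> space M. \<not> pos_part_const K / 4 * real m \<le> (\<Sum>i<m. max 0 (row i u \<omega>))}
    \<le> exp (- ((pos_part_const K)\<^sup>2 / 8 * real m))"
proof -
  define q where "q = pos_part_const K"
  have q: "0 < q" by (simp add: q_def pos_part_const_def)
  \<comment> \<open>At parameter q / 2 the first-order gain q^2 / 2 outweighs the second-order loss
    q^2 / 4. The modest threshold q / 4 then uses only half of the net gain.\<close>
  have one: "(\<integral>\<^sup>+ \<omega>. ennreal (exp (- (q / 2) * max 0 (row i u \<omega>))) \<partial>M) \<le> ennreal (exp (- (q\<^sup>2 / 4)))" if i: "i < m" for i
  proof -
    have [measurable]: "row i u \<in> borel_measurable M" using i by measurable
    have u': "(\<Sum>p\<in>{i} \<times> {..<n}. ((\<lambda>(i, j). u j) p)\<^sup>2) \<le> 1" "1 / 4 \<le> (\<Sum>p\<in>{i} \<times> {..<n}. ((\<lambda>(i, j). u j) p)\<^sup>2)"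
      using u by (auto simp: sum_row_index)
    have i1: "integrable M (row i u)" unfolding row_lin by (intro integrable_lin row_subset i)
    have i2: "integrable M (\<lambda>\<omega>. (row i u \<omega>)\<^sup>2)" unfolding row_lin by (intro lin_second_moment row_subset i)
    have E2: "expectation (\<lambda>\<omega>. (row i u \<omega>)\<^sup>2) \<le> 1"
      using u lin_second_moment(2)[OF row_subset[OF i]] by (simp add: row_lin sum_row_index)
    have E1: "q \<le> expectation (\<lambda>\<omega>. max 0 (row i u \<omega>))"
      unfolding row_lin q_def by (intro lin_pos_part_ge row_subset i u')
    have pt: "exp (- (q / 2) * max 0 y) \<le> 1 - q / 2 * max 0 y + (q / 2)\<^sup>2 * y\<^sup>2" for y :: real
    proof -
      have "0 \<le> q / 2 * max 0 y" using q by simp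
      then have "exp (- (q / 2) * max 0 y) \<le> 1 + (- (q / 2) * max 0 y) + (- (q / 2) * max 0 y)\<^sup>2"
        by (intro exp_le_quadratic) linarith
      moreover have "(- (q / 2) * max 0 y)\<^sup>2 \<le> (q / 2)\<^sup>2 * y\<^sup>2"
        by (simp add: power_mult_distrib power_divide max_def)
      ultimately show ?thesis by simp
    qed
    have int: "integrable M (\<lambda>\<omega>. 1 - q / 2 * max 0 (row i u \<omega>) + (q / 2)\<^sup>2 * (row i u \<omega>)\<^sup>2)"
      using i1 i2 by auto
    have "(\<integral>\<^sup>+ \<omega>. ennreal (exp (- (q / 2) * max 0 (row i u \<omega>))) \<partial>M)
        \<le> (\<integral>\<^sup>+ \<omega>. ennreal (1 - q / 2 * max 0 (row i u \<omega>) + (q / 2)\<^sup>2 * (row i u \<omega>)\<^sup>2) \<partial>M)"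
      using pt by (intro nn_integral_mono ennreal_leI)
    also have "\<dots> = ennreal (expectation (\<lambda>\<omega>. 1 - q / 2 * max 0 (row i u \<omega>) + (q / 2)\<^sup>2 * (row i u \<omega>)\<^sup>2))"
      using order_trans[OF exp_ge_zero pt] by (intro nn_integral_eq_integral int AE_I2)
    also have "expectation (\<lambda>\<omega>. 1 - q / 2 * max 0 (row i u \<omega>) + (q / 2)\<^sup>2 * (row i u \<omega>)\<^sup>2)
        = 1 - q / 2 * expectation (\<lambda>\<omega>. max 0 (row i u \<omega>)) + (q / 2)\<^sup>2 * expectation (\<lambda>\<omega>. (row i u \<omega>)\<^sup>2)"
      using i1 i2 by (simp add: prob_space)
    also have "\<dots> \<le> 1 - q / 2 * q + (q / 2)\<^sup>2 * 1"
      using E1 E2 q by (intro add_mono diff_left_mono mult_left_mono) auto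
    also have "\<dots> = 1 - q\<^sup>2 / 4" by (simp add: power2_eq_square)
    also have "\<dots> \<le> exp (- (q\<^sup>2 / 4))" using exp_ge_add_one_self[of "- (q\<^sup>2 / 4)"] by simp
    finally show ?thesis by (simp add: ennreal_leI)
  qed
  have "prob {\<omega> \<in> space M. \<not> q / 4 * real m \<le> (\<Sum>i<m. max 0 (row i u \<omega>))}
      \<le> prob {\<omega> \<in> space M. - (q\<^sup>2 / 8 * real m) \<le> (\<Sum>i<m. - (q / 2) * max 0 (row i u \<omega>))}"
  proof (rule finite_measure_mono)
    show "{\<omega> \<in> space M. \<not> q / 4 * real m \<le> (\<Sum>i<m. max 0 (row i u \<omega>))}
      \<subseteq> {\<omega> \<in> space M. - (q\<^sup>2 / 8 * real m) \<le> (\<Sum>i<m. - (q / 2) * max 0 (row i u \<omega>))}"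
    proof safe
      fix \<omega> assume "\<not> q / 4 * real m \<le> (\<Sum>i<m. max 0 (row i u \<omega>))"
      then have "q / 2 * (\<Sum>i<m. max 0 (row i u \<omega>)) \<le> q / 2 * (q / 4 * real m)"
        using q by (intro mult_left_mono) auto
      then show "- (q\<^sup>2 / 8 * real m) \<le> (\<Sum>i<m. - (q / 2) * max 0 (row i u \<omega>))"
        by (simp add: sum_distrib_left sum_negf power2_eq_square)
    qed
  qed measurable
  also have "\<dots> \<le> exp (- (q\<^sup>2 / 4)) ^ m * exp (- (- (q\<^sup>2 / 8 * real m)))"
    using one by (intro rows_chernoff[where \<psi> = "\<lambda>_ x y. - (q / 2) * max 0 y" and u = u]) auto
  also have "\<dots> = exp (- (q\<^sup>2 / 8 * real m))"
    by (simp add: exp_of_nat_mult[symmetric] exp_add[symmetric])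
  finally show ?thesis by (simp add: q_def)
qed

text \<open>The residual budget \<kappa> is split in two: \<open>err\<close> grants half to the bias
  of \<open>trunc_tilt_mean\<close>, the rest is left for fluctuations. The mesh \<delta> gives
  equality in the condition 4 \<delta> C1 \<le> c1 of \<open>lp_upper_certificate\<close> with C1 =
  1 + exp (K^2) and c1 = q / 4. It depends on \<open>K\<close> only, so the number of grid points is
  exponential in n at a rate fixed by \<open>K\<close>.\<close>

lemma upper_bound_event:
  assumes c: "(\<Sum>j<n. (c j)\<^sup>2) = 1"
    and r: "\<And>j. j < n \<Longrightarrow> \<bar>c j\<bar> \<le> r" "0 \<le> r" "4 * (cubic_const K + 1) * (\<theta> * r) \<le> \<zeta>" "\<zeta> \<le> 1"
    and par: "0 \<le> \<theta>" "0 \<le> \<alpha>" "\<alpha> \<le> 1" "0 < W" "0 \<le> R" "0 < Q" "W * exp (- R\<^sup>2 / (32 * K\<^sup>2)) \<le> 1"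
    and \<kappa>: "0 < \<kappa>" "\<kappa> \<le> 1"
    and err: "3 * cubic_const K * \<theta>\<^sup>2 * r
     + (R * exp (((1 + \<alpha>) * \<theta>)\<^sup>2 / 2 * (1 + \<zeta>) - (1 + \<alpha>) * (\<theta>\<^sup>2 / 2 * (1 - \<zeta>)) - \<alpha> * ln W)
        + (exp (4 * \<theta>\<^sup>2) / Q + 64 * K\<^sup>2 * Q * exp (- R\<^sup>2 / (32 * K\<^sup>2)))) \<le> \<kappa> / 2"
  defines "q \<equiv> pos_part_const K"
  defines "\<delta> \<equiv> q / (16 * (1 + exp (K\<^sup>2)))"
  defines "Z \<equiv> exp (2 * R) + 2 * exp (32 * K\<^sup>2)"
  shows "\<exists>E\<in>events. prob E \<le> 2 * exp (real n / \<delta> + 2 * real n) *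
      (exp (- (real m * \<kappa>\<^sup>2 / (32 * W * Z))) + exp (- real m) + exp (- (q\<^sup>2 / 8 * real m)))
    \<and> (\<forall>\<omega>\<in>space M - E. \<forall>x\<in>lp_feasible m n (\<lambda>i j. X i j \<omega>). \<theta> * (\<Sum>j<n. c j * x j) \<le> 1 + \<kappa> + 16 * \<kappa> / q)"
proof -
  define N where "N = exp (real n / \<delta> + 2 * real n)"
  have q: "0 < q" "q \<le> 1"
  proof -
    have "1 \<le> exp (K\<^sup>2)" by simp
    then have "1 \<le> 320 * exp (K\<^sup>2)" by linarith
    then show "0 < q" "q \<le> 1" by (auto simp: q_def pos_part_const_def)
  qed
  have \<delta>: "0 < \<delta>" "\<delta> \<le> 1 / 2"
  proof -
    have pos: "0 < 1 + exp (K\<^sup>2)" by (simp add: add_pos_pos)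
    then show "0 < \<delta>" using q by (simp add: \<delta>_def)
    have "q \<le> 8 * (1 + exp (K\<^sup>2))" 
    proof -
      have "q \<le> 8 * 1" using q by simp
      also have "\<dots> \<le> 8 * (1 + exp (K\<^sup>2))" by (intro mult_left_mono) auto
      finally show ?thesis .
    qed
    then show "\<delta> \<le> 1 / 2" using pos by (simp add: \<delta>_def divide_le_eq)
  qed
  define wt where "wt i g = trunc_tilt (tilt_norm c \<theta> i) \<theta> W g" for i g
  have [measurable]: "wt i \<in> borel_measurable borel" for i unfolding wt_def[abs_def] by simp
  have wt: "0 \<le> wt i g" "wt i g \<le> W" "wt i g \<le> exp (\<theta> * g) / tilt_norm c \<theta> i" if "i < m" for i g
    using trunc_tilt_bounds[of "tilt_norm c \<theta> i" W] tilt_norm_ge_1[OF that, of c \<theta>] par by (auto simp: wt_def)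
  have Z: "8 \<le> Z" "exp 2 \<le> Z"
  proof -
    have "exp 2 \<le> exp (32 * K\<^sup>2)"
    proof -
      have "1 \<le> K\<^sup>2" using K_ge_1 by simp
      then show ?thesis by (simp only: exp_le_cancel_iff)
    qed
    moreover have "4 \<le> exp (2 :: real)"
    proof -
      have "2 \<le> exp (1 :: real)" using exp_ge_add_one_self[of 1] by simp
      then have "2 * 2 \<le> exp (1 :: real) * exp 1" by (intro mult_mono) auto
      then show ?thesis by (simp add: exp_add[symmetric])
    qed
    moreover have "0 \<le> exp (2 * R)" "0 \<le> exp (32 * K\<^sup>2)" by simp_all
    ultimately show "8 \<le> Z" "exp 2 \<le> Z" unfolding Z_def by linarith+
  qed
  \<comment> \<open>The minimizer of 2 s^2 W Z - s \<kappa> / 2, with minimum - \<kappa>^2 / (32 W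
    Z).\<close>
  define s where "s = \<kappa> / (8 * W * Z)"
  have s: "0 < s" "s * W \<le> 1" "s * \<kappa> = \<kappa>\<^sup>2 / (8 * W * Z)" "2 * s\<^sup>2 * W * Z = \<kappa>\<^sup>2 / (32 * W * Z)"
    using \<kappa> par Z by (auto simp: s_def divide_simps power2_eq_square)
  define p where "p = exp (- (real m * \<kappa>\<^sup>2 / (32 * W * Z)))"
  define gp where "gp = grid_point n \<delta>"
  have gp1: "(\<Sum>j<n. (gp k j)\<^sup>2) \<le> 1" if "k \<in> grid n \<delta>" for k using that by (simp add: grid_def gp_def)
  define P1 where "P1 k \<omega> \<longleftrightarrow> \<not> (\<Sum>i<m. wt i (row i c \<omega>) * - row i (gp k) \<omega>) \<le> real m * (\<kappa> - \<theta> * (\<Sum>j<n. c j * gp k j))" for k \<omega>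
  define P2 where "P2 \<omega> \<longleftrightarrow> \<not> (\<Sum>i<m. wt i (row i c \<omega>)) \<le> real m * (1 + \<kappa>)" for \<omega>
  define P3 where "P3 k \<omega> \<longleftrightarrow> \<not> (\<Sum>i<m. max 0 (row i (gp k) \<omega>)) \<le> (1 + exp (K\<^sup>2)) * real m" for k \<omega>
  define P4 where "P4 k \<omega> \<longleftrightarrow> 1 / 4 \<le> (\<Sum>j<n. (gp k j)\<^sup>2) \<and> \<not> q / 4 * real m \<le> (\<Sum>i<m. max 0 (row i (gp k) \<omega>))" for k \<omega>
  have meas: "{\<omega> \<in> space M. P1 k \<omega>} \<in> events" "{\<omega> \<in> space M. P2 \<omega>} \<in> events"
    "{\<omega> \<in> space M. P3 k \<omega>} \<in> events" "{\<omega> \<in> space M. P4 k \<omega>} \<in> events" for k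
    unfolding P1_def P2_def P3_def P4_def by measurable
  have pr1: "prob {\<omega> \<in> space M. P1 k \<omega>} \<le> p" if k: "k \<in> grid n \<delta>" for k
  proof -
    define cg where "cg = \<theta> * (\<Sum>j<n. c j * gp k j)"
    have one: "(\<integral>\<^sup>+ \<omega>. ennreal (exp (s * (wt i (row i c \<omega>) * - row i (gp k) \<omega>))) \<partial>M)
        \<le> ennreal (exp (s * (\<kappa> / 2 - cg) + 2 * s\<^sup>2 * W * Z))" if i: "i < m" for i
    proof (rule weighted_exp_bound)
      note tm = trunc_tilt_mean[OF i c gp1[OF k] r par(1-6), folded wt_def cg_def]
      show "integrable M (\<lambda>\<omega>. wt i (row i c \<omega>) * - row i (gp k) \<omega>)" by (rule tm(1))
      show "expectation (\<lambda>\<omega>. wt i (row i c \<omega>) * - row i (gp k) \<omega>) \<le> \<kappa> / 2 - cg"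
        using tm(2) err by linarith
      show "(\<integral>\<^sup>+ \<omega>. ennreal (wt i (row i c \<omega>) * exp (2 * \<bar>- row i (gp k) \<omega>\<bar>)) \<partial>M) \<le> ennreal Z"
        using trunc_tilt_exp_moment[OF i gp1[OF k] par(5,7)] par by (simp add: wt_def Z_def)
    qed (use i wt s Z in auto)
    have "{\<omega> \<in> space M. P1 k \<omega>} \<subseteq> {\<omega> \<in> space M. s * (real m * (\<kappa> - cg)) \<le> (\<Sum>i<m. s * (wt i (row i c \<omega>) * - row i (gp k) \<omega>))}"
    proof safe
      fix \<omega> assume "P1 k \<omega>"
      then have "real m * (\<kappa> - cg) \<le> (\<Sum>i<m. wt i (row i c \<omega>) * - row i (gp k) \<omega>)"
        unfolding P1_def cg_def[symmetric] by linarith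
      then show "s * (real m * (\<kappa> - cg)) \<le> (\<Sum>i<m. s * (wt i (row i c \<omega>) * - row i (gp k) \<omega>))"
        unfolding sum_distrib_left[symmetric] using s by (intro mult_left_mono) auto
    qed
    then have "prob {\<omega> \<in> space M. P1 k \<omega>}
        \<le> prob {\<omega> \<in> space M. s * (real m * (\<kappa> - cg)) \<le> (\<Sum>i<m. s * (wt i (row i c \<omega>) * - row i (gp k) \<omega>))}"
      by (intro finite_measure_mono) auto
    also have "\<dots> \<le> exp (s * (\<kappa> / 2 - cg) + 2 * s\<^sup>2 * W * Z) ^ m * exp (- (s * (real m * (\<kappa> - cg))))"
      using one by (intro rows_chernoff[where \<psi> = "\<lambda>i x y. s * (wt i x * - y)"]) auto
    also have "\<dots> = exp (real m * (2 * s\<^sup>2 * W * Z - s * \<kappa> / 2))"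
      by (simp add: exp_of_nat_mult[symmetric] exp_add[symmetric] algebra_simps)
    also have "2 * s\<^sup>2 * W * Z - s * \<kappa> / 2 = - (\<kappa>\<^sup>2 / (32 * W * Z))"
      unfolding s by (simp add: field_simps)
    finally show ?thesis by (simp add: p_def)
  qed
  have pr2: "prob {\<omega> \<in> space M. P2 \<omega>} \<le> p"
  proof -
    \<comment> \<open>The total mass is the same estimate for the constant form 1. Truncation only
      decreases the density, so its mean is at most 1.\<close>
    have one: "(\<integral>\<^sup>+ \<omega>. ennreal (exp (s * (wt i (row i c \<omega>) * 1))) \<partial>M) \<le> ennreal (exp (s * 1 + 2 * s\<^sup>2 * W * Z))" if i: "i < m" for i
    proof (rule weighted_exp_bound)
      have P: "1 \<le> tilt_norm c \<theta> i" by (rule tilt_norm_ge_1[OF i])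
      have [measurable]: "row i c \<in> borel_measurable M" using i by measurable
      have int: "integrable M (\<lambda>\<omega>. exp (\<theta> * row i c \<omega>) / tilt_norm c \<theta> i)"
        using integrable_exp_row[OF i] by auto
      show iw: "integrable M (\<lambda>\<omega>. wt i (row i c \<omega>) * 1)"
        using wt[OF i] P by (intro Bochner_Integration.integrable_bound[OF int] AE_I2) auto
      have "expectation (\<lambda>\<omega>. wt i (row i c \<omega>) * 1) \<le> expectation (\<lambda>\<omega>. exp (\<theta> * row i c \<omega>) / tilt_norm c \<theta> i)"
        using iw int wt[OF i] by (intro integral_mono) auto
      also have "\<dots> = 1" using P by (simp add: tilt_norm_def)
      finally show E: "expectation (\<lambda>\<omega>. wt i (row i c \<omega>) * 1) \<le> 1" .
      have "(\<integral>\<^sup>+ \<omega>. ennreal (wt i (row i c \<omega>) * exp (2 * \<bar>1\<bar>)) \<partial>M) = ennreal (expectation (\<lambda>\<omega>. wt i (row i c \<omega>) * exp 2))"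
        using iw wt[OF i] by (subst nn_integral_eq_integral) auto
      also have "\<dots> \<le> ennreal Z"
      proof (rule ennreal_leI)
        have "expectation (\<lambda>\<omega>. wt i (row i c \<omega>) * exp 2) = expectation (\<lambda>\<omega>. wt i (row i c \<omega>) * 1) * exp 2" by simp
        also have "\<dots> \<le> 1 * exp 2" using E by (intro mult_right_mono) auto
        also have "\<dots> \<le> Z" using Z by simp
        finally show "expectation (\<lambda>\<omega>. wt i (row i c \<omega>) * exp 2) \<le> Z" .
      qed
      finally show "(\<integral>\<^sup>+ \<omega>. ennreal (wt i (row i c \<omega>) * exp (2 * \<bar>1\<bar>)) \<partial>M) \<le> ennreal Z" .
    qed (use i wt s Z in auto)
    have "{\<omega> \<in> space M. P2 \<omega>} \<subseteq> {\<omega> \<in> space M. s * (real m * (1 + \<kappa>)) \<le> (\<Sum>i<m. s * (wt i (row i c \<omega>) * 1))}"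
    proof safe
      fix \<omega> assume "P2 \<omega>"
      then have "real m * (1 + \<kappa>) \<le> (\<Sum>i<m. wt i (row i c \<omega>) * 1)"
        unfolding P2_def by simp
      then show "s * (real m * (1 + \<kappa>)) \<le> (\<Sum>i<m. s * (wt i (row i c \<omega>) * 1))"
        unfolding sum_distrib_left[symmetric] using s by (intro mult_left_mono) auto
    qed
    then have "prob {\<omega> \<in> space M. P2 \<omega>} \<le> prob {\<omega> \<in> space M. s * (real m * (1 + \<kappa>)) \<le> (\<Sum>i<m. s * (wt i (row i c \<omega>) * 1))}"
      by (intro finite_measure_mono) auto
    also have "\<dots> \<le> exp (s * 1 + 2 * s\<^sup>2 * W * Z) ^ m * exp (- (s * (real m * (1 + \<kappa>))))"
      using one by (intro rows_chernoff[where \<psi> = "\<lambda>i x y. s * (wt i x * 1)" and v = c]) auto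
    also have "\<dots> = exp (real m * (2 * s\<^sup>2 * W * Z - s * \<kappa>))"
      by (simp add: exp_of_nat_mult[symmetric] exp_add[symmetric] algebra_simps)
    also have "\<dots> \<le> p"
    proof -
      have "s * \<kappa> = 4 * (\<kappa>\<^sup>2 / (32 * W * Z))" unfolding s by simp
      moreover have "0 \<le> \<kappa>\<^sup>2 / (32 * W * Z)" using par Z by simp
      ultimately have "2 * s\<^sup>2 * W * Z - s * \<kappa> \<le> - (\<kappa>\<^sup>2 / (32 * W * Z))" unfolding s(4) by linarith
      then have "real m * (2 * s\<^sup>2 * W * Z - s * \<kappa>) \<le> real m * - (\<kappa>\<^sup>2 / (32 * W * Z))" by (intro mult_left_mono) auto
      then show ?thesis by (simp add: p_def)
    qed
    finally show ?thesis .
  qed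
  have pr3: "prob {\<omega> \<in> space M. P3 k \<omega>} \<le> exp (- real m)" if k: "k \<in> grid n \<delta>" for k
    unfolding P3_def by (rule grid_pos_part_upper[OF gp1[OF k]])
  have pr4: "prob {\<omega> \<in> space M. P4 k \<omega>} \<le> exp (- (q\<^sup>2 / 8 * real m))" if k: "k \<in> grid n \<delta>" for k
  proof (cases "1 / 4 \<le> (\<Sum>j<n. (gp k j)\<^sup>2)")
    case True
    then show ?thesis using grid_pos_part_lower[OF gp1[OF k] True] by (simp add: P4_def q_def)
  next
    case False
    then have "{\<omega> \<in> space M. P4 k \<omega>} = {}" by (auto simp: P4_def)
    then show ?thesis by (simp only: measure_empty exp_ge_zero)
  qed
  have fin: "finite (grid n \<delta>)" and card: "real (card (grid n \<delta>)) \<le> N"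
    using card_grid_le[OF \<delta>(1)] by (auto simp: N_def)
  have N1: "1 \<le> N" using \<delta> by (simp add: N_def)
  define E1 where "E1 = {\<omega> \<in> space M. \<exists>k\<in>grid n \<delta>. P1 k \<omega>}"
  define E2 where "E2 = {\<omega> \<in> space M. P2 \<omega>}"
  define E3 where "E3 = {\<omega> \<in> space M. \<exists>k\<in>grid n \<delta>. P3 k \<omega>}"
  define E4 where "E4 = {\<omega> \<in> space M. \<exists>k\<in>grid n \<delta>. P4 k \<omega>}"
  have ev: "E1 \<in> events" "E2 \<in> events" "E3 \<in> events" "E4 \<in> events"
    unfolding E1_def E2_def E3_def E4_def using meas fin by (auto intro!: sets.sets_Collect_finite_Ex)
  have union: "prob {\<omega> \<in> space M. \<exists>k\<in>grid n \<delta>. P k \<omega>} \<le> N * x"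
    if "\<And>k. {\<omega> \<in> space M. P k \<omega>} \<in> events" "\<And>k. k \<in> grid n \<delta> \<Longrightarrow> prob {\<omega> \<in> space M. P k \<omega>} \<le> x" "0 \<le> x" for P x
    using prob_finite_union_le[of "grid n \<delta>" P x, OF fin that(1,2)] mult_right_mono[OF card that(3)] by linarith
  have e1: "prob E1 \<le> N * p" unfolding E1_def by (rule union[OF meas(1) pr1]) (auto simp: p_def)
  have e2: "prob E2 \<le> N * p"
  proof -
    have "1 * p \<le> N * p" using N1 by (intro mult_right_mono) (auto simp: p_def)
    then show ?thesis using pr2 by (simp add: E2_def)
  qed
  have e3: "prob E3 \<le> N * exp (- real m)" unfolding E3_def by (rule union[OF meas(3) pr3]) auto
  have e4: "prob E4 \<le> N * exp (- (q\<^sup>2 / 8 * real m))" unfolding E4_def by (rule union[OF meas(4) pr4]) auto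
  show ?thesis
  proof (intro bexI[of _ "E1 \<union> E2 \<union> E3 \<union> E4"] conjI ballI)
    have "prob (E1 \<union> E2 \<union> E3 \<union> E4) \<le> prob E1 + prob E2 + prob E3 + prob E4"
      using ev by (intro order_trans[OF measure_Un_le] add_mono) auto
    also have "\<dots> \<le> N * p + N * p + N * exp (- real m) + N * exp (- (q\<^sup>2 / 8 * real m))"
      using e1 e2 e3 e4 by (intro add_mono)
    also have "\<dots> \<le> 2 * N * (p + exp (- real m) + exp (- (q\<^sup>2 / 8 * real m)))"
      using N1 by (simp add: algebra_simps)
    finally show "prob (E1 \<union> E2 \<union> E3 \<union> E4) \<le> 2 * exp (real n / \<delta> + 2 * real n) *
      (exp (- (real m * \<kappa>\<^sup>2 / (32 * W * Z))) + exp (- real m) + exp (- (q\<^sup>2 / 8 * real m)))"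
      by (simp add: N_def p_def)
    fix \<omega> x assume \<omega>: "\<omega> \<in> space M - (E1 \<union> E2 \<union> E3 \<union> E4)" and x: "x \<in> lp_feasible m n (\<lambda>i j. X i j \<omega>)"
    have "\<theta> * (\<Sum>j<n. c j * x j) \<le> 1 + \<kappa> + 4 * \<kappa> / (q / 4)"
    proof (rule lp_upper_certificate[where w = "\<lambda>i. wt i (row i c \<omega>)" and \<delta> = \<delta> and ?C1.0 = "1 + exp (K\<^sup>2)", OF m_pos n_pos \<delta>])
      define e where "e = 1 + exp (K\<^sup>2)"
      have "0 < e" by (simp add: e_def add_pos_pos)
      then have "4 * (q / (16 * e)) * e \<le> q / 4" by simp
      then show "4 * \<delta> * (1 + exp (K\<^sup>2)) \<le> q / 4" by (simp only: \<delta>_def e_def)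
      show "(\<Sum>i<m. wt i (row i c \<omega>)) \<le> real m * (1 + \<kappa>)" using \<omega> by (auto simp: E2_def P2_def)
      fix k assume k: "k \<in> grid n \<delta>"
      show "(\<Sum>i<m. wt i (row i c \<omega>) * - (\<Sum>j<n. X i j \<omega> * grid_point n \<delta> k j))
          \<le> real m * (\<kappa> - \<theta> * (\<Sum>j<n. c j * grid_point n \<delta> k j))"
        using \<omega> k unfolding gp_def[symmetric] row_def[symmetric] by (auto simp: E1_def P1_def)
      show "(\<Sum>i<m. max 0 (\<Sum>j<n. X i j \<omega> * grid_point n \<delta> k j)) \<le> (1 + exp (K\<^sup>2)) * real m"
        using \<omega> k unfolding gp_def[symmetric] row_def[symmetric] by (auto simp: E3_def P3_def)
      show "q / 4 * real m \<le> (\<Sum>i<m. max 0 (\<Sum>j<n. X i j \<omega> * grid_point n \<delta> k j))"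
        if "1 / 4 \<le> (\<Sum>j<n. (grid_point n \<delta> k j)\<^sup>2)"
        using \<omega> k that unfolding gp_def[symmetric] row_def[symmetric] by (auto simp: E4_def P4_def)
    qed (use q \<kappa> wt x in auto)
    then show "\<theta> * (\<Sum>j<n. c j * x j) \<le> 1 + \<kappa> + 16 * \<kappa> / q" by simp
  qed (use ev in auto)
qed

end

section \<open>High-probability bounds on the optimal value\<close>

lemma lp_feasible_zero: "restrict (\<lambda>_. 0) {..<n} \<in> lp_feasible m n a"
  by (auto simp: lp_feasible_def)

text \<open>Shrinking a feasible point towards the origin makes its constraints strict, so the
  supremum can be taken over rational points.\<close>

lemma lp_value_rational:
  "lp_value m n a c = (SUP q\<in>({..<n} \<rightarrow>\<^sub>E \<rat>).
     if \<forall>i<m. (\<Sum>j<n. a i j * q j) \<le> 1 then ereal (\<Sum>j<n. c j * q j) else 0)"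
  (is "_ = (SUP q\<in>?Q. ?F q)")
proof (rule antisym)
  \<comment> \<open>The origin is feasible, so the value 0 assigned to infeasible rational points
    cannot raise the supremum.\<close>
  have ge0: "0 \<le> lp_value m n a c"
    unfolding lp_value_def by (rule SUP_upper2[OF lp_feasible_zero]) simp
  show "(SUP q\<in>?Q. ?F q) \<le> lp_value m n a c"
  proof (rule SUP_least)
    fix q assume q: "q \<in> ?Q"
    show "?F q \<le> lp_value m n a c"
    proof (cases "\<forall>i<m. (\<Sum>j<n. a i j * q j) \<le> 1")
      case True
      then have "q \<in> lp_feasible m n a" using q by (auto simp: lp_feasible_def PiE_def)
      then show ?thesis using True unfolding lp_value_def by (auto intro: SUP_upper)
    next
      case False
      then have "?F q = 0" by (simp only: if_False)
      then show ?thesis using ge0 by simp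
    qed
  qed
  show "lp_value m n a c \<le> (SUP q\<in>?Q. ?F q)"
    unfolding lp_value_def
  proof (rule SUP_least)
    fix x assume x: "x \<in> lp_feasible m n a"
    define v where "v = (\<Sum>j<n. c j * x j)"
    have "ereal y \<le> (SUP q\<in>?Q. ?F q)" if y: "y < v" for y
    proof -
      \<comment> \<open>Contracting by 1 - s leaves slack s in every constraint and costs at most (v
        - y) / 2 in the objective. The mesh \<eta> below is so fine that rounding changes a
        constraint by at most s and the objective by at most (v - y) / 2.\<close>
      define s where "s = min (1 / 2) ((v - y) / (2 * (\<bar>v\<bar> + 1)))"
      have s: "0 < s" "s \<le> 1 / 2" "s * (2 * (\<bar>v\<bar> + 1)) \<le> v - y"
        using y by (auto simp: s_def min_def divide_simps)
      have sv: "s * v \<le> (v - y) / 2"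
      proof -
        define w where "w = \<bar>v\<bar> + 1"
        have "2 * (s * v) \<le> 2 * (s * w)" using s by (intro mult_left_mono) (auto simp: w_def)
        also have "\<dots> \<le> v - y" using s(3) by (simp only: w_def mult.left_commute[of s 2])
        finally show ?thesis by simp
      qed
      define T where "T = 1 + (\<Sum>i<m. \<Sum>j<n. \<bar>a i j\<bar>) + (\<Sum>j<n. \<bar>c j\<bar>)"
      have T0: "0 \<le> (\<Sum>i<m. \<Sum>j<n. \<bar>a i j\<bar>)" "0 \<le> (\<Sum>j<n. \<bar>c j\<bar>)" by (auto intro!: sum_nonneg)
      then have T: "1 \<le> T" by (simp add: T_def)
      define \<eta> where "\<eta> = min s ((v - y) / 2) / T"
      have "\<eta> * T = min s ((v - y) / 2)" using T by (simp add: \<eta>_def)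
      then have \<eta>: "0 < \<eta>" "\<eta> * T \<le> s" "\<eta> * T \<le> (v - y) / 2"
        using T s(1) y min.cobounded1[of s "(v - y) / 2"] min.cobounded2[of s "(v - y) / 2"]
        by (auto simp: \<eta>_def simp del: min.cobounded1 min.cobounded2)
      have "\<exists>q. q \<in> \<rat> \<and> (1 - s) * x j < q \<and> q < (1 - s) * x j + \<eta>" for j
        using Rats_dense_in_real[of "(1 - s) * x j" "(1 - s) * x j + \<eta>"] \<eta> by auto
      then obtain q0 where q0: "\<And>j. q0 j \<in> \<rat>" "\<And>j. (1 - s) * x j < q0 j" "\<And>j. q0 j < (1 - s) * x j + \<eta>"
        by metis
      define q where "q = restrict q0 {..<n}"
      have diff: "\<bar>(\<Sum>j<n. b j * q j) - (1 - s) * (\<Sum>j<n. b j * x j)\<bar> \<le> \<eta> * T"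
        if b: "(\<Sum>j<n. \<bar>b j\<bar>) \<le> T" for b
      proof -
        have "(\<Sum>j<n. b j * q j) - (1 - s) * (\<Sum>j<n. b j * x j) = (\<Sum>j<n. b j * (q0 j - (1 - s) * x j))"
          by (simp add: q_def sum_distrib_left sum_subtractf sum.distrib algebra_simps)
        also have "\<bar>\<dots>\<bar> \<le> (\<Sum>j<n. \<bar>b j\<bar> * \<eta>)"
        proof (intro order_trans[OF sum_abs] sum_mono)
          fix j
          have "\<bar>q0 j - (1 - s) * x j\<bar> \<le> \<eta>" using q0(2,3)[of j] by simp
          then show "\<bar>b j * (q0 j - (1 - s) * x j)\<bar> \<le> \<bar>b j\<bar> * \<eta>"
            unfolding abs_mult by (intro mult_left_mono) auto
        qed
        also have "\<dots> = \<eta> * (\<Sum>j<n. \<bar>b j\<bar>)" by (simp add: sum_distrib_left mult.commute)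
        also have "\<dots> \<le> \<eta> * T" using b \<eta> by (intro mult_left_mono) auto
        finally show ?thesis .
      qed
      have feas: "(\<Sum>j<n. a i j * q j) \<le> 1" if i: "i < m" for i
      proof -
        have "(\<Sum>j<n. \<bar>a i j\<bar>) \<le> (\<Sum>i<m. \<Sum>j<n. \<bar>a i j\<bar>)"
          using i by (intro member_le_sum[of i "{..<m}" "\<lambda>i. \<Sum>j<n. \<bar>a i j\<bar>"]) (auto intro: sum_nonneg)
        then have "(\<Sum>j<n. \<bar>a i j\<bar>) \<le> T" using T0 unfolding T_def by linarith
        then have "(\<Sum>j<n. a i j * q j) \<le> (1 - s) * (\<Sum>j<n. a i j * x j) + s"
          using diff[of "a i"] \<eta> by linarith
        also have "\<dots> \<le> (1 - s) * 1 + s"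
          using x i s by (intro add_mono mult_left_mono) (auto simp: lp_feasible_def)
        finally show ?thesis by simp
      qed
      have "(\<Sum>j<n. \<bar>c j\<bar>) \<le> T" using T0 by (simp add: T_def)
      then have "(1 - s) * v - (v - y) / 2 \<le> (\<Sum>j<n. c j * q j)"
        using diff[of c] \<eta> unfolding v_def by linarith
      then have "y \<le> (\<Sum>j<n. c j * q j)" using sv by (simp add: algebra_simps) argo
      then have "ereal y \<le> ?F q" using feas by simp
      moreover have "q \<in> ?Q" using q0(1) by (auto simp: q_def)
      ultimately show ?thesis by (rule SUP_upper2[rotated])
    qed
    then have "z \<le> (SUP q\<in>?Q. ?F q)" if "z < ereal v" for z using that by (cases z) auto
    then show "ereal (\<Sum>j<n. c j * x j) \<le> (SUP q\<in>?Q. ?F q)" unfolding v_def[symmetric] by (rule dense_le)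
  qed
qed

context random_matrix
begin

lemma lp_value_measurable: "(\<lambda>\<omega>. lp_value m n (\<lambda>i j. X i j \<omega>) c) \<in> borel_measurable M"
  unfolding lp_value_rational
proof (rule borel_measurable_SUP)
  show "countable ({..<n} \<rightarrow>\<^sub>E (\<rat> :: real set))" by (intro countable_PiE countable_rat) auto
  show "(\<lambda>\<omega>. if \<forall>i<m. (\<Sum>j<n. X i j \<omega> * q j) \<le> 1 then ereal (\<Sum>j<n. c j * q j) else 0) \<in> borel_measurable M" for q
    by measurable
qed

lemma lower_bound_whp:
  fixes \<epsilon> r :: real
  defines "L \<equiv> ln (real m / real n)"
  assumes c: "(\<Sum>j<n. (c j)\<^sup>2) = 1" and r: "\<And>j. j < n \<Longrightarrow> \<bar>c j\<bar> \<le> r"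
    and \<epsilon>: "0 < \<epsilon>" "\<epsilon> \<le> 1 / 2"
    and L: "2 \<le> L" "256 * K\<^sup>2 \<le> \<epsilon>\<^sup>2 * L" "560000 * K^4 \<le> L" "L^3 \<le> real n"
    and small: "8 * (cubic_const K + 1) * (sqrt L * r) \<le> \<epsilon> / 4"
    and tail: "(exp (512 * K\<^sup>2 / \<epsilon>\<^sup>2 - \<epsilon> / 2 * L) + 2 * exp (- L)) * (2 * L\<^sup>2) \<le> 1"
  shows "\<exists>E\<in>events. prob E \<le> exp (ln (real n) + real n powr (1 / 3) - real n / (64 * K^4))
      + exp (- (real n / (20000 * K^4))) + exp (- (real n / (8 * K\<^sup>2))) + exp (- (real n powr (1 / 3) / 2))
    \<and> (\<forall>\<omega>\<in>space M - E. \<exists>x\<in>lp_feasible m n (\<lambda>i j. X i j \<omega>). 1 - 2 * \<epsilon> \<le> sqrt (2 * L) * (\<Sum>j<n. c j * x j))"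
proof -
  define t where "t = sqrt (2 * L)"
  define \<beta> where "\<beta> = (1 - \<epsilon>) / t"
  define \<delta> where "\<delta> = \<epsilon> / 4"
  \<comment> \<open>Three demands on the budget: it is at least twice the quantity m p of
    \<open>excess_prob\<close>, the logarithm of the number of integer vectors stays of order n / L,
    and L^3 \<le> n makes it at least n to the power 1/3.\<close>
  define B where "B = real n / L\<^sup>2"
  \<comment> \<open>Now R^2 / (32 K^2) = 2 L, so the tail term summed over m rows is 2 n exp (- L),
    while (\<beta> / \<delta>)^2 R^2 stays bounded independently of L.\<close>
  define R where "R = sqrt (64 * K\<^sup>2 * L)"
  define N where "N = exp (4 * B * ln (real m / B) + 2 * B)"
  have n0: "0 < real n" and m0: "0 < real m" using n_pos m_pos by auto
  have K1: "1 \<le> K\<^sup>2" "1 \<le> K^4" using K_ge_1 by auto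
  have t0: "0 < t" "t\<^sup>2 = 2 * L" using L by (auto simp: t_def)
  have mL: "real m = real n * exp L" using n0 m0 by (simp add: L_def)
  have B0: "0 < B" using n0 L by (simp add: B_def)
  have L2: "4 \<le> L\<^sup>2" using power_mono[of 2 L 2] L by simp
  have expL: "1 \<le> exp L" using L by simp
  have B2: "2 * B \<le> real m"
  proof -
    have "2 * B \<le> real n * 1" using L2 n0 by (simp add: B_def divide_le_eq)
    also have "\<dots> \<le> real n * exp L" using expL n0 by (intro mult_left_mono) auto
    finally show ?thesis by (simp add: mL)
  qed
  have bd: "(\<beta> / \<delta>)\<^sup>2 \<le> 8 / (\<epsilon>\<^sup>2 * L)"
  proof -
    have "\<beta> / \<delta> = (4 * (1 - \<epsilon>)) / (\<epsilon> * t)" by (simp add: \<beta>_def \<delta>_def mult.commute)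
    then have "(\<beta> / \<delta>)\<^sup>2 = 16 * (1 - \<epsilon>)\<^sup>2 / (\<epsilon>\<^sup>2 * (2 * L))"
      by (simp only: power_divide power_mult_distrib t0(2)) simp
    also have "\<dots> \<le> 16 * 1 / (\<epsilon>\<^sup>2 * (2 * L))"
      using \<epsilon> L power_mono[of "1 - \<epsilon>" 1 2] by (intro divide_right_mono mult_left_mono) auto
    finally show ?thesis by (simp add: mult.commute)
  qed
  have bd32: "32 * K\<^sup>2 * (\<beta> / \<delta>)\<^sup>2 \<le> 1"
  proof -
    have "32 * K\<^sup>2 * (\<beta> / \<delta>)\<^sup>2 \<le> 32 * K\<^sup>2 * (8 / (\<epsilon>\<^sup>2 * L))" using bd by (intro mult_left_mono) auto
    also have "\<dots> = 256 * K\<^sup>2 / (\<epsilon>\<^sup>2 * L)" by simp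
    also have "\<dots> \<le> 1" using L \<epsilon> by (simp add: divide_le_eq)
    finally show ?thesis .
  qed
  \<comment> \<open>The violation threshold exceeds t by a factor of at least 1 + \<epsilon> / 2, so
    the expected squared violation, summed over m = n exp L rows, is n times a quantity
    exponentially small in L.\<close>
  define \<tau> where "\<tau> = (1 - 2 * \<delta>) / \<beta>"
  have \<tau>: "\<tau> = (1 - \<epsilon> / 2) / (1 - \<epsilon>) * t" using \<epsilon> t0 by (simp add: \<tau>_def \<beta>_def \<delta>_def)
  have fr: "1 + \<epsilon> / 2 \<le> (1 - \<epsilon> / 2) / (1 - \<epsilon>)" "(1 - \<epsilon> / 2) / (1 - \<epsilon>) \<le> 2"
    using \<epsilon> by (auto simp: field_simps)
  have sm: "2 * (cubic_const K + 1) * \<bar>\<tau> * c j\<bar> \<le> \<epsilon> / 4" if "j < n" for j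
  proof -
    have r0: "0 \<le> r" using r[OF n_pos] by linarith
    have "t \<le> 2 * sqrt L"
      unfolding t_def real_sqrt_mult using L by (intro mult_right_mono) (auto intro: real_le_lsqrt)
    then have "\<tau> \<le> 2 * (2 * sqrt L)" unfolding \<tau> using fr(2) t0 \<epsilon> by (intro mult_mono) auto
    moreover have "0 \<le> \<tau>" unfolding \<tau> using fr(1) t0 \<epsilon> by (intro mult_nonneg_nonneg) auto
    ultimately have "\<bar>\<tau> * c j\<bar> \<le> 4 * sqrt L * r"
      unfolding abs_mult using r[OF that] L by (intro mult_mono) auto
    then have "2 * (cubic_const K + 1) * \<bar>\<tau> * c j\<bar> \<le> 2 * (cubic_const K + 1) * (4 * sqrt L * r)"
      using cubic_const_ge[of K] by (intro mult_left_mono) auto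
    also have "\<dots> = 8 * (cubic_const K + 1) * (sqrt L * r)" by simp
    finally show ?thesis using small by linarith
  qed
  have "\<exists>E\<in>events. prob E \<le> real m * exp (- (real n / (64 * K^4))) + N * N * exp (- (real n / (10000 * K^4)))
      + N * exp (- (real n / (4 * K\<^sup>2)))
      + exp (real m * (exp ((\<beta> / \<delta>)\<^sup>2 * R\<^sup>2 - ((1 - 2 * \<delta>) / \<beta>)\<^sup>2 / 2 * (1 - \<epsilon> / 4)) + 2 * exp (- R\<^sup>2 / (32 * K\<^sup>2))) - B)
    \<and> (\<forall>\<omega>\<in>space M - E. \<exists>x\<in>lp_feasible m n (\<lambda>i j. X i j \<omega>). \<beta> - 4 * \<delta> * sqrt (B / real n) \<le> (\<Sum>j<n. c j * x j))"
    unfolding N_def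
  proof (rule lower_bound_event[OF c B0 B2])
    show "0 < \<beta>" "0 < \<delta>" "3 * \<delta> \<le> 1" using \<epsilon> t0 by (auto simp: \<beta>_def \<delta>_def)
    show "0 \<le> R" using L by (simp add: R_def)
    show "\<epsilon> / 4 \<le> 1" using \<epsilon> by simp
  qed (use bd32 sm in \<open>auto simp: \<tau>_def\<close>)
  then obtain E where E: "E \<in> events" and
    pE: "prob E \<le> real m * exp (- (real n / (64 * K^4))) + N * N * exp (- (real n / (10000 * K^4)))
      + N * exp (- (real n / (4 * K\<^sup>2)))
      + exp (real m * (exp ((\<beta> / \<delta>)\<^sup>2 * R\<^sup>2 - \<tau>\<^sup>2 / 2 * (1 - \<epsilon> / 4)) + 2 * exp (- R\<^sup>2 / (32 * K\<^sup>2))) - B)"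
    and gE: "\<And>\<omega>. \<omega> \<in> space M - E \<Longrightarrow> \<exists>x\<in>lp_feasible m n (\<lambda>i j. X i j \<omega>). \<beta> - 4 * \<delta> * sqrt (B / real n) \<le> (\<Sum>j<n. c j * x j)"
    unfolding \<tau>_def by blast
  have Lroot: "L \<le> real n powr (1 / 3)"
  proof -
    have "(L^3) powr (1 / 3) = L" using L powr_powr[of L 3 "1 / 3"] by (simp add: powr_numeral)
    then show ?thesis using L powr_mono2[of "1/3" "L^3" "real n"] by simp
  qed
  have t1: "real m * exp (- (real n / (64 * K^4))) \<le> exp (ln (real n) + real n powr (1 / 3) - real n / (64 * K^4))"
  proof -
    have "real m = exp (ln (real n) + L)" using n0 by (simp add: mL exp_add)
    then have "real m * exp (- (real n / (64 * K^4))) = exp (ln (real n) + L - real n / (64 * K^4))"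
      by (simp add: exp_add[symmetric])
    then show ?thesis using Lroot by simp
  qed
  have lnmB: "ln (real m / B) \<le> 3 * L"
  proof -
    have "real m / B = exp L * L\<^sup>2" using n0 L by (simp add: mL B_def)
    then have "ln (real m / B) = L + 2 * ln L" using L by (simp add: ln_mult ln_realpow)
    moreover have "ln L \<le> L" using L by (simp add: ln_bound)
    ultimately show ?thesis by simp
  qed
  have Nle: "N \<le> exp (14 * (real n / L))"
  proof -
    have "4 * B * ln (real m / B) \<le> 4 * B * (3 * L)" using lnmB B0 by (intro mult_left_mono) auto
    also have "\<dots> = 12 * (real n / L)" using L by (simp add: B_def power2_eq_square)
    finally have "4 * B * ln (real m / B) \<le> 12 * (real n / L)" .
    moreover have "B \<le> real n / L"
    proof -
      have "real n / L\<^sup>2 \<le> real n / L" using L n0 by (intro divide_left_mono) (auto simp: power2_eq_square)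
      then show ?thesis by (simp add: B_def)
    qed
    ultimately show ?thesis by (simp add: N_def)
  qed
  have nL: "28 * (real n / L) \<le> real n / (20000 * K^4)"
  proof -
    have "0 < L * K^4" using L K_ge_1 by (intro mult_pos_pos) auto
    then have "28 * (real n / L) \<le> 28 * (real n / (560000 * K^4))"
      using L K1 n0 by (intro mult_left_mono divide_left_mono) auto
    then show ?thesis by simp
  qed
  have t2: "N * N * exp (- (real n / (10000 * K^4))) \<le> exp (- (real n / (20000 * K^4)))"
  proof -
    have "N * N * exp (- (real n / (10000 * K^4))) \<le> exp (14 * (real n / L)) * exp (14 * (real n / L)) * exp (- (real n / (10000 * K^4)))"
      using Nle by (intro mult_mono) (auto simp: N_def)
    also have "\<dots> = exp (28 * (real n / L) - real n / (10000 * K^4))" by (simp add: exp_add[symmetric])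
    also have "\<dots> \<le> exp (- (real n / (20000 * K^4)))" using nL by simp
    finally show ?thesis .
  qed
  have t3: "N * exp (- (real n / (4 * K\<^sup>2))) \<le> exp (- (real n / (8 * K\<^sup>2)))"
  proof -
    have "N * exp (- (real n / (4 * K\<^sup>2))) \<le> exp (14 * (real n / L)) * exp (- (real n / (4 * K\<^sup>2)))"
      using Nle by (intro mult_right_mono) auto
    also have "\<dots> = exp (14 * (real n / L) - real n / (4 * K\<^sup>2))" by (simp add: exp_add[symmetric])
    also have "14 * (real n / L) \<le> real n / (8 * K\<^sup>2)"
    proof -
      have "real n / (20000 * K^4) \<le> real n / (8 * K\<^sup>2)"
      proof (rule divide_left_mono)
        have "8 * K\<^sup>2 * 1 \<le> 20000 * K\<^sup>2 * K\<^sup>2" using K1 by (intro mult_mono) auto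
        then show "8 * K\<^sup>2 \<le> 20000 * K^4" by (simp add: power2_eq_square power4_eq_xxxx mult.assoc)
      qed (use n0 K1 in auto)
      then have "28 * (real n / L) \<le> real n / (8 * K\<^sup>2)" using nL by linarith
      moreover have "0 \<le> real n / L" using n0 L by simp
      ultimately show ?thesis by linarith
    qed
    then have "exp (14 * (real n / L) - real n / (4 * K\<^sup>2)) \<le> exp (- (real n / (8 * K\<^sup>2)))"
    proof -
      assume "14 * (real n / L) \<le> real n / (8 * K\<^sup>2)"
      moreover have "real n / (4 * K\<^sup>2) = real n / (8 * K\<^sup>2) + real n / (8 * K\<^sup>2)" by (simp add: field_simps)
      ultimately show ?thesis by simp
    qed
    finally show ?thesis .
  qed
  have t4: "exp (real m * (exp ((\<beta> / \<delta>)\<^sup>2 * R\<^sup>2 - \<tau>\<^sup>2 / 2 * (1 - \<epsilon> / 4)) + 2 * exp (- R\<^sup>2 / (32 * K\<^sup>2))) - B)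
      \<le> exp (- (real n powr (1 / 3) / 2))"
  proof -
    have R2: "R\<^sup>2 = 64 * K\<^sup>2 * L" using L by (simp add: R_def)
    have a1: "(\<beta> / \<delta>)\<^sup>2 * R\<^sup>2 \<le> 512 * K\<^sup>2 / \<epsilon>\<^sup>2"
    proof -
      have "(\<beta> / \<delta>)\<^sup>2 * R\<^sup>2 \<le> 8 / (\<epsilon>\<^sup>2 * L) * (64 * K\<^sup>2 * L)" unfolding R2 using bd L by (intro mult_right_mono) auto
      then show ?thesis using L by simp
    qed
    have a2: "(1 + \<epsilon> / 2) * L \<le> \<tau>\<^sup>2 / 2 * (1 - \<epsilon> / 4)"
    proof -
      define f where "f = (1 - \<epsilon> / 2) / (1 - \<epsilon>)"
      have "(1 + \<epsilon> / 2) * (1 + \<epsilon> / 2) \<le> f * f" using fr \<epsilon> by (intro mult_mono) (auto simp: f_def)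
      then have "(1 + \<epsilon> / 2) * (1 + \<epsilon> / 2) * (1 - \<epsilon> / 4) \<le> f * f * (1 - \<epsilon> / 4)"
        using \<epsilon> by (intro mult_right_mono) auto
      moreover have "(1 + \<epsilon> / 2) * 1 \<le> (1 + \<epsilon> / 2) * ((1 + \<epsilon> / 2) * (1 - \<epsilon> / 4))"
      proof (rule mult_left_mono)
        have "\<epsilon> * \<epsilon> \<le> \<epsilon> * 1" using \<epsilon> by (intro mult_left_mono) auto
        then show "1 \<le> (1 + \<epsilon> / 2) * (1 - \<epsilon> / 4)" using \<epsilon> by (simp add: algebra_simps)
      qed (use \<epsilon> in auto)
      ultimately have "1 + \<epsilon> / 2 \<le> f * f * (1 - \<epsilon> / 4)" by (simp add: mult.assoc)
      then have "(1 + \<epsilon> / 2) * L \<le> f * f * (1 - \<epsilon> / 4) * L" using L by (intro mult_right_mono) auto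
      also have "\<dots> = \<tau>\<^sup>2 / 2 * (1 - \<epsilon> / 4)"
        unfolding \<tau> f_def[symmetric] power_mult_distrib t0(2) by (simp add: power2_eq_square)
      finally show ?thesis .
    qed
    have "exp ((\<beta> / \<delta>)\<^sup>2 * R\<^sup>2 - \<tau>\<^sup>2 / 2 * (1 - \<epsilon> / 4)) \<le> exp (512 * K\<^sup>2 / \<epsilon>\<^sup>2 - (1 + \<epsilon> / 2) * L)"
      using a1 a2 by (simp only: exp_le_cancel_iff)
    moreover have "- R\<^sup>2 / (32 * K\<^sup>2) = - 2 * L" using K_ge_1 by (simp add: R2)
    ultimately have "real m * (exp ((\<beta> / \<delta>)\<^sup>2 * R\<^sup>2 - \<tau>\<^sup>2 / 2 * (1 - \<epsilon> / 4)) + 2 * exp (- R\<^sup>2 / (32 * K\<^sup>2)))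
        \<le> real m * (exp (512 * K\<^sup>2 / \<epsilon>\<^sup>2 - (1 + \<epsilon> / 2) * L) + 2 * exp (- 2 * L))"
      using m0 by (intro mult_left_mono add_mono) auto
    also have "\<dots> = real n * (exp (512 * K\<^sup>2 / \<epsilon>\<^sup>2 - \<epsilon> / 2 * L) + 2 * exp (- L))"
    proof -
      have "exp L * exp (512 * K\<^sup>2 / \<epsilon>\<^sup>2 - (1 + \<epsilon> / 2) * L) = exp (512 * K\<^sup>2 / \<epsilon>\<^sup>2 - \<epsilon> / 2 * L)"
        "exp L * exp (- 2 * L) = exp (- L)" by (simp_all add: exp_add[symmetric] algebra_simps)
      then show ?thesis unfolding mL by (simp add: distrib_left mult.assoc mult.left_commute[of _ "2::real"])
    qed
    also have "\<dots> \<le> real n * (1 / (2 * L\<^sup>2))"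
      using tail L n0 by (intro mult_left_mono) (auto simp: pos_le_divide_eq)
    also have "\<dots> = B / 2" by (simp add: B_def)
    finally have "real m * (exp ((\<beta> / \<delta>)\<^sup>2 * R\<^sup>2 - \<tau>\<^sup>2 / 2 * (1 - \<epsilon> / 4)) + 2 * exp (- R\<^sup>2 / (32 * K\<^sup>2))) - B \<le> - (B / 2)"
      by simp
    moreover have "real n powr (1 / 3) \<le> B"
    proof -
      have "real n powr (1 / 3) * L\<^sup>2 \<le> real n powr (1 / 3) * (real n powr (1 / 3))\<^sup>2"
        using Lroot L by (intro mult_left_mono power_mono) auto
      also have "\<dots> = real n powr (1 / 3 + 1 / 3 + 1 / 3)" by (simp only: powr_add power2_eq_square mult.assoc)
      also have "\<dots> = real n" using n0 by simp
      finally have "real n powr (1 / 3) * L\<^sup>2 \<le> real n" .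
      moreover have "0 < L\<^sup>2" using L2 by linarith
      ultimately show ?thesis by (simp add: B_def pos_le_divide_eq)
    qed
    ultimately show ?thesis by simp
  qed
  have "1 - 2 * \<epsilon> \<le> t * (\<beta> - 4 * \<delta> * sqrt (B / real n))"
  proof -
    have "sqrt (B / real n) = 1 / L" using n0 L by (simp add: B_def real_sqrt_divide)
    then have "t * (\<beta> - 4 * \<delta> * sqrt (B / real n)) = t * \<beta> - \<epsilon> * (t / L)"
      by (simp add: \<delta>_def right_diff_distrib)
    moreover have "t * \<beta> = 1 - \<epsilon>" using t0 by (simp add: \<beta>_def)
    moreover have "t / L \<le> 1"
    proof -
      have "2 * L \<le> L\<^sup>2" using L by (simp add: power2_eq_square)
      then have "t \<le> L" unfolding t_def using L by (intro real_le_lsqrt) auto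
      then show ?thesis using L by simp
    qed
    then have "\<epsilon> * (t / L) \<le> \<epsilon> * 1" using \<epsilon> by (intro mult_left_mono) auto
    ultimately show ?thesis by simp
  qed
  note obj = this
  show ?thesis
  proof (intro bexI[OF _ E] conjI ballI)
    show "prob E \<le> exp (ln (real n) + real n powr (1 / 3) - real n / (64 * K^4))
      + exp (- (real n / (20000 * K^4))) + exp (- (real n / (8 * K\<^sup>2))) + exp (- (real n powr (1 / 3) / 2))"
      using pE t1 t2 t3 t4 by linarith
    fix \<omega> assume "\<omega> \<in> space M - E"
    then obtain x where x: "x \<in> lp_feasible m n (\<lambda>i j. X i j \<omega>)" "\<beta> - 4 * \<delta> * sqrt (B / real n) \<le> (\<Sum>j<n. c j * x j)"
      using gE by blast
    have "t * (\<beta> - 4 * \<delta> * sqrt (B / real n)) \<le> t * (\<Sum>j<n. c j * x j)" using x(2) t0 by (intro mult_left_mono) auto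
    then show "\<exists>x\<in>lp_feasible m n (\<lambda>i j. X i j \<omega>). 1 - 2 * \<epsilon> \<le> sqrt (2 * L) * (\<Sum>j<n. c j * x j)"
      using obj x(1) unfolding t_def by (intro bexI[OF _ x(1)]) linarith
  qed
qed

lemma upper_bound_whp:
  fixes \<epsilon> r :: real
  defines "L \<equiv> ln (real m / real n)"
  defines "q \<equiv> pos_part_const K"
  defines "D \<equiv> 16 * (1 + exp (K\<^sup>2)) / q + 3"
  assumes c: "(\<Sum>j<n. (c j)\<^sup>2) = 1" and r: "\<And>j. j < n \<Longrightarrow> \<bar>c j\<bar> \<le> r"
    and \<epsilon>: "0 < \<epsilon>" "\<epsilon> \<le> 1 / 4" and L: "1 \<le> L"
    and \<kappa>: "\<kappa> = \<epsilon> / (1 + 16 / q)"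
    and small: "4 * (cubic_const K + 1) * (sqrt (2 * L) * r) \<le> \<epsilon>\<^sup>2 / 100"
    and err: "6 * cubic_const K * (L * r) + (sqrt (384 * K\<^sup>2 * L) * exp (- (\<epsilon>\<^sup>2 / 16 * L)) + (exp (- L) + 64 * K\<^sup>2 * exp (- 3 * L))) \<le> \<kappa> / 2"
    and big: "D \<le> exp (\<epsilon> * L) * \<kappa>\<^sup>2 / (32 * (exp (2 * sqrt (384 * K\<^sup>2 * L)) + 2 * exp (32 * K\<^sup>2)))"
      "D \<le> exp L" "D \<le> q\<^sup>2 / 8 * exp L"
  shows "\<exists>E\<in>events. prob E \<le> 6 * exp (- real n)
    \<and> (\<forall>\<omega>\<in>space M - E. \<forall>x\<in>lp_feasible m n (\<lambda>i j. X i j \<omega>). sqrt (2 * L) * (\<Sum>j<n. c j * x j) \<le> 1 + 4 * \<epsilon>)"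
proof -
  define t where "t = sqrt (2 * L)"
  define \<theta> where "\<theta> = (1 - \<epsilon>) * t"
  define W where "W = exp ((1 - \<epsilon>) * L)"
  define R where "R = sqrt (384 * K\<^sup>2 * L)"
  \<comment> \<open>Since 4 \<theta>^2 \<le> 8 L and R^2 / (32 K^2) = 12 L, any rate strictly
    between 8 and 12 makes both terms containing \<open>Q\<close> small.\<close>
  define Q where "Q = exp (9 * L)"
  define \<delta> where "\<delta> = q / (16 * (1 + exp (K\<^sup>2)))"
  define Z where "Z = exp (2 * R) + 2 * exp (32 * K\<^sup>2)"
  have n0: "0 < real n" and m0: "0 < real m" using n_pos m_pos by auto
  have K1: "1 \<le> K\<^sup>2" using K_ge_1 by auto
  have r0: "0 \<le> r" using r[OF n_pos] by linarith
  have q: "0 < q" by (simp add: q_def pos_part_const_def)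
  have mL: "real m = real n * exp L" using n0 m0 by (simp add: L_def)
  have t0: "0 < t" "t\<^sup>2 = 2 * L" using L by (auto simp: t_def)
  have \<theta>: "0 < \<theta>" "\<theta> \<le> t" "\<theta>\<^sup>2 = 2 * ((1 - \<epsilon>)\<^sup>2 * L)"
    using t0 \<epsilon> by (auto simp: \<theta>_def power_mult_distrib)
  have \<theta>2: "\<theta>\<^sup>2 \<le> 2 * L" using power_mono[OF \<theta>(2), of 2] \<theta>(1) t0 by simp
  have R2: "R\<^sup>2 = 384 * K\<^sup>2 * L" using L by (simp add: R_def)
  have R12: "- R\<^sup>2 / (32 * K\<^sup>2) = - 12 * L" using K_ge_1 by (simp add: R2)
  have \<kappa>1: "0 < \<kappa>" "\<kappa> \<le> 1" and \<kappa>q: "\<kappa> + 16 * \<kappa> / q = \<epsilon>"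
  proof -
    have pos: "0 < 1 + 16 / q" using q by (simp add: add_pos_pos)
    then show "0 < \<kappa>" using \<epsilon> by (simp add: \<kappa>)
    have "\<kappa> * (1 + 16 / q) = \<epsilon>" using pos by (simp add: \<kappa>)
    then show s: "\<kappa> + 16 * \<kappa> / q = \<epsilon>" by (simp add: distrib_left mult.commute)
    have "0 \<le> 16 * \<kappa> / q" using \<open>0 < \<kappa>\<close> q by simp
    then show "\<kappa> \<le> 1" using s \<epsilon> by linarith
  qed
  \<comment> \<open>Without the perturbations by \<epsilon>^2 / 100 the exponent is (\<epsilon> / 2)
    (1 - \<epsilon>) L ((1 + \<epsilon> / 2) (1 - \<epsilon>) - 1), of order - \<epsilon>^2 L; the
    flatness tolerance \<epsilon>^2 / 100 is chosen small enough to preserve the sign.\<close>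
  have expo: "((1 + \<epsilon> / 2) * \<theta>)\<^sup>2 / 2 * (1 + \<epsilon>\<^sup>2 / 100) - (1 + \<epsilon> / 2) * (\<theta>\<^sup>2 / 2 * (1 - \<epsilon>\<^sup>2 / 100)) - \<epsilon> / 2 * ln W
      \<le> - (\<epsilon>\<^sup>2 / 16 * L)"
  proof -
    define y where "y = \<epsilon> / 2 + \<epsilon>\<^sup>2 / 50 + \<epsilon>^3 / 200"
    define I where "I = y - \<epsilon> / 2 - (\<epsilon> / 2 + \<epsilon>\<^sup>2 / 2) * y"
    have "((1 + \<epsilon> / 2) * \<theta>)\<^sup>2 / 2 * (1 + \<epsilon>\<^sup>2 / 100) - (1 + \<epsilon> / 2) * (\<theta>\<^sup>2 / 2 * (1 - \<epsilon>\<^sup>2 / 100)) - \<epsilon> / 2 * ln W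
        = (1 - \<epsilon>) * L * I"
      unfolding power_mult_distrib \<theta>(3) W_def I_def y_def
      by (simp add: power2_eq_square power3_eq_cube field_simps)
    also have "\<dots> \<le> (1 - \<epsilon>) * L * (- (\<epsilon>\<^sup>2 / 8))"
    proof (rule mult_left_mono)
      have e3: "\<epsilon>^3 \<le> \<epsilon>\<^sup>2 * (1 / 4)"
        using mult_left_mono[OF \<epsilon>(2), of "\<epsilon>\<^sup>2"] by (simp add: power2_eq_square power3_eq_cube)
      have "\<epsilon> / 2 \<le> y" using \<epsilon> by (simp add: y_def)
      then have "(\<epsilon> / 2) * (\<epsilon> / 2) \<le> (\<epsilon> / 2 + \<epsilon>\<^sup>2 / 2) * y" using \<epsilon> by (intro mult_mono) auto
      then have "\<epsilon>\<^sup>2 / 4 \<le> (\<epsilon> / 2 + \<epsilon>\<^sup>2 / 2) * y" by (simp add: power2_eq_square)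
      then have "I \<le> \<epsilon>\<^sup>2 / 50 + \<epsilon>^3 / 200 - \<epsilon>\<^sup>2 / 4" unfolding I_def by (simp add: y_def)
      also have "\<dots> \<le> - (\<epsilon>\<^sup>2 / 8)" using e3 zero_le_power2[of \<epsilon>] by linarith
      finally show "I \<le> - (\<epsilon>\<^sup>2 / 8)" .
    qed (use \<epsilon> L in auto)
    also have "\<dots> \<le> - (\<epsilon>\<^sup>2 / 16 * L)"
    proof -
      have "(1 / 2) * (L * (\<epsilon>\<^sup>2 / 8)) \<le> (1 - \<epsilon>) * (L * (\<epsilon>\<^sup>2 / 8))" using \<epsilon> L by (intro mult_right_mono) auto
      then show ?thesis by (simp add: algebra_simps)
    qed
    finally show ?thesis .
  qed
  have "\<exists>E\<in>events. prob E \<le> 2 * exp (real n / \<delta> + 2 * real n) *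
      (exp (- (real m * \<kappa>\<^sup>2 / (32 * W * Z))) + exp (- real m) + exp (- (q\<^sup>2 / 8 * real m)))
    \<and> (\<forall>\<omega>\<in>space M - E. \<forall>x\<in>lp_feasible m n (\<lambda>i j. X i j \<omega>). \<theta> * (\<Sum>j<n. c j * x j) \<le> 1 + \<kappa> + 16 * \<kappa> / q)"
    unfolding \<delta>_def q_def Z_def
  proof (rule upper_bound_event[where \<theta> = \<theta> and \<alpha> = "\<epsilon> / 2" and \<zeta> = "\<epsilon>\<^sup>2 / 100" and W = W and R = R and Q = Q and \<kappa> = \<kappa>, OF c r r0])
    have "4 * (cubic_const K + 1) * (\<theta> * r) \<le> 4 * (cubic_const K + 1) * (t * r)"
      using \<theta>(2) r0 cubic_const_ge[of K] by (intro mult_left_mono mult_right_mono) auto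
    then show "4 * (cubic_const K + 1) * (\<theta> * r) \<le> \<epsilon>\<^sup>2 / 100" using small by (simp add: t_def)
    have "\<epsilon>\<^sup>2 \<le> 1\<^sup>2" using \<epsilon> by (intro power_mono) auto
    then show "\<epsilon>\<^sup>2 / 100 \<le> 1" by simp
    have "W * exp (- R\<^sup>2 / (32 * K\<^sup>2)) = exp ((1 - \<epsilon>) * L - 12 * L)"
      unfolding R12 W_def by (simp add: exp_add[symmetric])
    also have "\<dots> \<le> 1"
    proof -
      have "(1 - \<epsilon>) * L \<le> 12 * L" using \<epsilon> L by (intro mult_right_mono) auto
      then show ?thesis by simp
    qed
    finally show "W * exp (- R\<^sup>2 / (32 * K\<^sup>2)) \<le> 1" .
    show "3 * cubic_const K * \<theta>\<^sup>2 * r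
     + (R * exp (((1 + \<epsilon> / 2) * \<theta>)\<^sup>2 / 2 * (1 + \<epsilon>\<^sup>2 / 100) - (1 + \<epsilon> / 2) * (\<theta>\<^sup>2 / 2 * (1 - \<epsilon>\<^sup>2 / 100)) - \<epsilon> / 2 * ln W)
        + (exp (4 * \<theta>\<^sup>2) / Q + 64 * K\<^sup>2 * Q * exp (- R\<^sup>2 / (32 * K\<^sup>2)))) \<le> \<kappa> / 2"
    proof (rule order_trans[OF _ err], intro add_mono)
      have "3 * cubic_const K * \<theta>\<^sup>2 * r \<le> 3 * cubic_const K * (2 * L) * r"
        using \<theta>2 r0 cubic_const_ge[of K] by (intro mult_right_mono mult_left_mono) auto
      then show "3 * cubic_const K * \<theta>\<^sup>2 * r \<le> 6 * cubic_const K * (L * r)" by simp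
      show "R * exp (((1 + \<epsilon> / 2) * \<theta>)\<^sup>2 / 2 * (1 + \<epsilon>\<^sup>2 / 100) - (1 + \<epsilon> / 2) * (\<theta>\<^sup>2 / 2 * (1 - \<epsilon>\<^sup>2 / 100)) - \<epsilon> / 2 * ln W)
          \<le> sqrt (384 * K\<^sup>2 * L) * exp (- (\<epsilon>\<^sup>2 / 16 * L))"
        unfolding R_def[symmetric] using expo L by (intro mult_left_mono) (auto simp: R_def)
      have "exp (4 * \<theta>\<^sup>2) / Q = exp (4 * \<theta>\<^sup>2 - 9 * L)" by (simp add: Q_def exp_diff)
      then show "exp (4 * \<theta>\<^sup>2) / Q \<le> exp (- L)" using \<theta>2 by simp
      show "64 * K\<^sup>2 * Q * exp (- R\<^sup>2 / (32 * K\<^sup>2)) \<le> 64 * K\<^sup>2 * exp (- 3 * L)"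
        unfolding R12 Q_def by (simp add: mult.assoc exp_add[symmetric])
    qed
  qed (use \<epsilon> L \<theta> \<kappa>1 in \<open>auto simp: W_def R_def Q_def\<close>)
  then obtain E where E: "E \<in> events" and
    pE: "prob E \<le> 2 * exp (real n / \<delta> + 2 * real n) *
      (exp (- (real m * \<kappa>\<^sup>2 / (32 * W * Z))) + exp (- real m) + exp (- (q\<^sup>2 / 8 * real m)))"
    and gE: "\<And>\<omega> x. \<omega> \<in> space M - E \<Longrightarrow> x \<in> lp_feasible m n (\<lambda>i j. X i j \<omega>) \<Longrightarrow> \<theta> * (\<Sum>j<n. c j * x j) \<le> 1 + \<kappa> + 16 * \<kappa> / q"
    by blast
  \<comment> \<open>The grid has at most exp (n (D - 1)) points, so failure probabilities of exp (-
    n D) per point leave exp (- n) after the union bound.\<close>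
  have D: "real n / \<delta> + 2 * real n = real n * (D - 1)"
    by (simp add: D_def \<delta>_def algebra_simps)
  have exp_D: "exp (- (real n * x)) \<le> exp (- (real n * D))" if "D \<le> x" for x
    using that n0 by simp
  have "exp (- (real m * \<kappa>\<^sup>2 / (32 * W * Z))) \<le> exp (- (real n * D))"
  proof -
    have W: "exp L / W = exp (\<epsilon> * L)" by (simp add: W_def exp_diff[symmetric] algebra_simps)
    have "real m * \<kappa>\<^sup>2 / (32 * W * Z) = real n * (exp L / W * \<kappa>\<^sup>2 / (32 * Z))"
      unfolding mL by (simp add: ac_simps)
    then have "real m * \<kappa>\<^sup>2 / (32 * W * Z) = real n * (exp (\<epsilon> * L) * \<kappa>\<^sup>2 / (32 * Z))"
      unfolding W .
    then show ?thesis using exp_D[OF big(1)] by (simp add: Z_def R_def)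
  qed
  moreover have "exp (- real m) \<le> exp (- (real n * D))" using exp_D[OF big(2)] by (simp add: mL)
  moreover have "exp (- (q\<^sup>2 / 8 * real m)) \<le> exp (- (real n * D))"
    using exp_D[OF big(3)] by (simp add: mL mult.left_commute)
  ultimately have "exp (- (real m * \<kappa>\<^sup>2 / (32 * W * Z))) + exp (- real m) + exp (- (q\<^sup>2 / 8 * real m)) \<le> 3 * exp (- (real n * D))"
    by linarith
  then have "2 * exp (real n / \<delta> + 2 * real n) * (exp (- (real m * \<kappa>\<^sup>2 / (32 * W * Z))) + exp (- real m) + exp (- (q\<^sup>2 / 8 * real m)))
      \<le> 2 * exp (real n * (D - 1)) * (3 * exp (- (real n * D)))"
    unfolding D by (intro mult_left_mono) auto
  also have "\<dots> = 6 * exp (- real n)" by (simp add: exp_add[symmetric] algebra_simps)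
  finally have p6: "prob E \<le> 6 * exp (- real n)" using pE by linarith
  show ?thesis
  proof (intro bexI[OF _ E] conjI ballI p6)
    fix \<omega> x assume "\<omega> \<in> space M - E" "x \<in> lp_feasible m n (\<lambda>i j. X i j \<omega>)"
    then have "\<theta> * (\<Sum>j<n. c j * x j) \<le> 1 + \<epsilon>" using gE \<kappa>q by fastforce
    then have "(1 - \<epsilon>) * (t * (\<Sum>j<n. c j * x j)) \<le> 1 + \<epsilon>" by (simp add: \<theta>_def mult.assoc)
    also have "\<dots> \<le> (1 - \<epsilon>) * (1 + 4 * \<epsilon>)"
    proof -
      have "\<epsilon> * \<epsilon> \<le> \<epsilon> * (1 / 4)" using \<epsilon> by (intro mult_left_mono) auto
      then show ?thesis using \<epsilon> by (simp add: algebra_simps)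
    qed
    finally show "sqrt (2 * L) * (\<Sum>j<n. c j * x j) \<le> 1 + 4 * \<epsilon>"
      using \<epsilon> unfolding t_def by (simp only: mult_le_cancel_left_pos)
  qed
qed

end

section \<open>Asymptotics\<close>

lemma eventually_lower_tail:
  assumes "0 < (a :: real)"
  shows "eventually (\<lambda>x. (exp (b - a * x) + 2 * exp (- x)) * (2 * x\<^sup>2) \<le> 1) at_top"
proof -
  have "((\<lambda>x. exp (b - a * x) * (2 * x\<^sup>2) + 2 * (exp (- x) * (2 * x\<^sup>2))) \<longlongrightarrow> 0 + 2 * 0) at_top"
    using assms by (intro tendsto_add tendsto_mult tendsto_const) real_asymp+
  then have "eventually (\<lambda>x. exp (b - a * x) * (2 * x\<^sup>2) + 2 * (exp (- x) * (2 * x\<^sup>2)) < 1) at_top"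
    by (rule order_tendstoD) simp
  then show ?thesis by eventually_elim (simp add: algebra_simps)
qed

lemma eventually_truncation_error:
  assumes "0 < (a :: real)" "0 < e" "0 < d"
  shows "eventually (\<lambda>x. sqrt (a * x) * exp (- (e * x)) + (exp (- x) + b * exp (- 3 * x)) \<le> d) at_top"
proof -
  have "((\<lambda>x. sqrt (a * x) * exp (- (e * x))) \<longlongrightarrow> 0) at_top" using assms by real_asymp
  moreover have "((\<lambda>x :: real. exp (- x)) \<longlongrightarrow> 0) at_top" by real_asymp
  moreover have "((\<lambda>x. b * exp (- 3 * x)) \<longlongrightarrow> 0) at_top" by real_asymp
  ultimately have "((\<lambda>x. sqrt (a * x) * exp (- (e * x)) + (exp (- x) + b * exp (- 3 * x))) \<longlongrightarrow> 0 + (0 + 0)) at_top"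
    by (intro tendsto_add)
  then have "eventually (\<lambda>x. sqrt (a * x) * exp (- (e * x)) + (exp (- x) + b * exp (- 3 * x)) < d) at_top"
    by (rule order_tendstoD) (use assms in simp)
  then show ?thesis by eventually_elim simp
qed

text \<open>The slowest term is the one with n to the power 1/3 in the exponent, from the budget of
  violations; it still beats every power of n.\<close>

lemma eventually_failure_prob:
  assumes "0 < (a1 :: real)" "0 < a2" "0 < a3" "0 < C"
  shows "eventually (\<lambda>n. exp (ln (real n) + real n powr (1 / 3) - real n / a1) + exp (- (real n / a2))
    + exp (- (real n / a3)) + exp (- (real n powr (1 / 3) / 2)) + 6 * exp (- real n) \<le> real n powr (- C)) sequentially"
proof -
  have "eventually (\<lambda>n. exp (ln (real n) + real n powr (1 / 3) - real n / a1) \<le> real n powr (- C) / 5) sequentially"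
    using assms(1,4) by real_asymp
  moreover have "eventually (\<lambda>n. exp (- (real n / a2)) \<le> real n powr (- C) / 5) sequentially"
    using assms(2,4) by real_asymp
  moreover have "eventually (\<lambda>n. exp (- (real n / a3)) \<le> real n powr (- C) / 5) sequentially"
    using assms(3,4) by real_asymp
  moreover have "eventually (\<lambda>n. exp (- (real n powr (1 / 3) / 2)) \<le> real n powr (- C) / 5) sequentially"
    using assms(4) by real_asymp
  moreover have "eventually (\<lambda>n. 6 * exp (- real n) \<le> real n powr (- C) / 5) sequentially"
    using assms(4) by real_asymp
  ultimately show ?thesis by eventually_elim linarith
qed

section \<open>Passage to the limit along the sequence\<close>

locale random_lp_sequence = prob_space M for M :: "'a measure" +
  fixes K :: real and m :: "nat \<Rightarrow> nat" and A :: "nat \<Rightarrow> nat \<Rightarrow> nat \<Rightarrow> 'a \<Rightarrow> real" and c :: "nat \<Rightarrow> nat \<Rightarrow> real"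
  assumes matrix: "\<And>n. n \<ge> 1 \<Longrightarrow> random_matrix M K (m n) n (A n)"
    and K_pos: "0 < K"
    and aspect: "filterlim (\<lambda>n. real (m n) / real n) at_top sequentially"
    and unit: "\<And>n. n \<ge> 1 \<Longrightarrow> L2_set (c n) {..<n} = 1"
    and flat: "(\<lambda>n. ln (real (m n) / real n) powr (3 / 2) * (MAX j\<in>{..<n}. \<bar>c n j\<bar>)) \<longlonglongrightarrow> 0"
begin

definition L :: "nat \<Rightarrow> real" where "L n = ln (real (m n) / real n)"
definition r :: "nat \<Rightarrow> real" where "r n = (MAX j\<in>{..<n}. \<bar>c n j\<bar>)"
definition z :: "nat \<Rightarrow> 'a \<Rightarrow> ereal" where "z n \<omega> = lp_value (m n) n (\<lambda>i j. A n i j \<omega>) (c n)"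

lemma unit_sum: "n \<ge> 1 \<Longrightarrow> (\<Sum>j<n. (c n j)\<^sup>2) = 1"
  using unit[of n] by (simp add: L2_set_def)

lemma abs_le_r: "j < n \<Longrightarrow> \<bar>c n j\<bar> \<le> r n"
  unfolding r_def by (intro Max_ge) auto

lemma L_at_top: "filterlim L at_top sequentially"
  unfolding L_def[abs_def] by (rule filterlim_compose[OF ln_at_top aspect])

lemma eventually_L: "eventually P at_top \<Longrightarrow> eventually (\<lambda>n. P (L n)) sequentially"
  using L_at_top by (simp add: filterlim_iff)

text \<open>For L \<ge> 1 both sqrt L and L are at most L to the power 3/2. These two products are
  the only forms in which flatness enters the error terms.\<close>

lemma eventually_flat:
  assumes "0 < a" "0 \<le> b"
  shows "eventually (\<lambda>n. b * (sqrt (L n) * r n) \<le> a \<and> b * (L n * r n) \<le> a) sequentially"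
proof -
  have "eventually (\<lambda>n. L n powr (3 / 2) * r n < a / (b + 1)) sequentially"
    using flat assms unfolding L_def r_def by (intro order_tendstoD(2)) auto
  moreover have "eventually (\<lambda>n. 1 \<le> L n) sequentially" by (intro eventually_L eventually_ge_at_top)
  ultimately show ?thesis using eventually_ge_at_top[of 1]
  proof eventually_elim
    case (elim n)
    have r0: "0 \<le> r n" using abs_le_r[of 0 n] elim by auto
    have "L n powr 1 \<le> L n powr (3 / 2)" "L n powr (1 / 2) \<le> L n powr (3 / 2)"
      using elim by (intro powr_mono; simp)+
    then have le: "L n \<le> L n powr (3 / 2)" "sqrt (L n) \<le> L n powr (3 / 2)"
      using elim by (simp_all add: powr_half_sqrt)
    have "b * (L n powr (3 / 2) * r n) \<le> b * (a / (b + 1))" using elim assms by (intro mult_left_mono) auto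
    also have "\<dots> \<le> a" using assms by (simp add: field_simps)
    finally have fin: "b * (L n powr (3 / 2) * r n) \<le> a" .
    have "b * (sqrt (L n) * r n) \<le> b * (L n powr (3 / 2) * r n)" "b * (L n * r n) \<le> b * (L n powr (3 / 2) * r n)"
      using le r0 assms by (intro mult_left_mono mult_right_mono; simp)+
    then show ?case using fin by linarith
  qed
qed

text \<open>A unit vector has n r^2 \<ge> 1, while the flatness hypothesis eventually gives L^3 r^2
  \<le> 1. This is where the full power 3/2 is spent.\<close>

lemma eventually_L_cube: "eventually (\<lambda>n. L n ^ 3 \<le> real n) sequentially"
proof -
  have "eventually (\<lambda>n. L n powr (3 / 2) * r n < 1) sequentially"
    using flat unfolding L_def r_def by (intro order_tendstoD(2)) auto
  moreover have "eventually (\<lambda>n. 1 \<le> L n) sequentially" by (intro eventually_L eventually_ge_at_top)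
  ultimately show ?thesis using eventually_ge_at_top[of 1]
  proof eventually_elim
    case (elim n)
    have r0: "0 \<le> r n" using abs_le_r[of 0 n] elim by auto
    have "(c n j)\<^sup>2 \<le> (r n)\<^sup>2" if "j < n" for j
      using power_mono[OF abs_le_r[OF that] abs_ge_zero, of 2] by simp
    then have "(\<Sum>j<n. (c n j)\<^sup>2) \<le> (\<Sum>j<n. (r n)\<^sup>2)" by (intro sum_mono) auto
    then have one: "1 \<le> real n * (r n)\<^sup>2" using unit_sum elim by simp
    have "(L n powr (3 / 2))\<^sup>2 = L n powr 3"
      using powr_add[of "L n" "3 / 2" "3 / 2"] by (simp add: power2_eq_square)
    then have "(L n powr (3 / 2))\<^sup>2 = L n ^ 3" using elim by (simp add: powr_numeral)
    moreover have "(L n powr (3 / 2) * r n)\<^sup>2 \<le> 1\<^sup>2" using elim r0 by (intro power_mono) auto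
    ultimately have le: "L n ^ 3 * (r n)\<^sup>2 \<le> 1" by (simp add: power_mult_distrib)
    have "L n ^ 3 * 1 \<le> L n ^ 3 * (real n * (r n)\<^sup>2)" using one elim by (intro mult_left_mono) auto
    also have "\<dots> = real n * (L n ^ 3 * (r n)\<^sup>2)" by simp
    also have "\<dots> \<le> real n * 1" using le by (intro mult_left_mono) auto
    finally show ?case by simp
  qed
qed

lemma eventually_lower:
  assumes \<epsilon>: "0 < \<epsilon>" "\<epsilon> \<le> 1 / 2"
  shows "eventually (\<lambda>n. \<exists>E\<in>events. prob E \<le> exp (ln (real n) + real n powr (1 / 3) - real n / (64 * K^4))
      + exp (- (real n / (20000 * K^4))) + exp (- (real n / (8 * K\<^sup>2))) + exp (- (real n powr (1 / 3) / 2))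
    \<and> (\<forall>\<omega>\<in>space M - E. ereal (1 - 2 * \<epsilon>) \<le> ereal (sqrt (2 * L n)) * z n \<omega>)) sequentially"
proof -
  have "0 \<le> 8 * (cubic_const K + 1)" using cubic_const_ge[of K] by simp
  then have e1: "eventually (\<lambda>n. 8 * (cubic_const K + 1) * (sqrt (L n) * r n) \<le> \<epsilon> / 4
      \<and> 8 * (cubic_const K + 1) * (L n * r n) \<le> \<epsilon> / 4) sequentially"
    using \<epsilon> by (intro eventually_flat) auto
  have e2: "eventually (\<lambda>n. (exp (512 * K\<^sup>2 / \<epsilon>\<^sup>2 - \<epsilon> / 2 * L n) + 2 * exp (- L n)) * (2 * (L n)\<^sup>2) \<le> 1) sequentially"
    using \<epsilon> by (intro eventually_L eventually_lower_tail) auto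
  have e3: "eventually (\<lambda>n. 2 \<le> L n) sequentially" "eventually (\<lambda>n. 256 * K\<^sup>2 / \<epsilon>\<^sup>2 \<le> L n) sequentially"
    "eventually (\<lambda>n. 560000 * K^4 \<le> L n) sequentially"
    by (intro eventually_L eventually_ge_at_top)+
  show ?thesis
    using e1 e2 e3 eventually_L_cube eventually_ge_at_top[of 1]
  proof eventually_elim
    case (elim n)
    interpret random_matrix M K "m n" n "A n" using matrix elim by simp
    have "256 * K\<^sup>2 \<le> \<epsilon>\<^sup>2 * L n" using elim(4) \<epsilon> by (simp add: divide_le_eq mult.commute)
    then obtain E where E: "E \<in> events" "prob E \<le> exp (ln (real n) + real n powr (1 / 3) - real n / (64 * K^4))
      + exp (- (real n / (20000 * K^4))) + exp (- (real n / (8 * K\<^sup>2))) + exp (- (real n powr (1 / 3) / 2))"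
      and g: "\<And>\<omega>. \<omega> \<in> space M - E \<Longrightarrow> \<exists>x\<in>lp_feasible (m n) n (\<lambda>i j. A n i j \<omega>). 1 - 2 * \<epsilon> \<le> sqrt (2 * L n) * (\<Sum>j<n. c n j * x j)"
      using lower_bound_whp[OF unit_sum abs_le_r \<epsilon>, folded L_def] elim by blast
    have "ereal (1 - 2 * \<epsilon>) \<le> ereal (sqrt (2 * L n)) * z n \<omega>" if \<omega>: "\<omega> \<in> space M - E" for \<omega>
    proof -
      obtain x where x: "x \<in> lp_feasible (m n) n (\<lambda>i j. A n i j \<omega>)" "1 - 2 * \<epsilon> \<le> sqrt (2 * L n) * (\<Sum>j<n. c n j * x j)"
        using g[OF \<omega>] by blast
      have "ereal (1 - 2 * \<epsilon>) \<le> ereal (sqrt (2 * L n)) * ereal (\<Sum>j<n. c n j * x j)" using x(2) by simp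
      also have "\<dots> \<le> ereal (sqrt (2 * L n)) * z n \<omega>"
        unfolding z_def lp_value_def using x(1) elim by (intro ereal_mult_left_mono SUP_upper) auto
      finally show ?thesis .
    qed
    then show ?case using E by blast
  qed
qed

lemma eventually_upper:
  assumes \<epsilon>: "0 < \<epsilon>" "\<epsilon> \<le> 1 / 4"
  shows "eventually (\<lambda>n. \<exists>E\<in>events. prob E \<le> 6 * exp (- real n)
    \<and> (\<forall>\<omega>\<in>space M - E. ereal (sqrt (2 * L n)) * z n \<omega> \<le> ereal (1 + 4 * \<epsilon>))) sequentially"
proof -
  define q where "q = pos_part_const K"
  define \<kappa> where "\<kappa> = \<epsilon> / (1 + 16 / q)"
  define D where "D = 16 * (1 + exp (K\<^sup>2)) / q + 3"
  have q: "0 < q" by (simp add: q_def pos_part_const_def)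
  then have \<kappa>: "0 < \<kappa>" using \<epsilon> by (simp add: \<kappa>_def add_pos_pos)
  have C: "0 \<le> 8 * (cubic_const K + 1)" "0 \<le> 6 * cubic_const K" using cubic_const_ge[of K] by simp_all
  have e1: "eventually (\<lambda>n. 8 * (cubic_const K + 1) * (sqrt (L n) * r n) \<le> \<epsilon>\<^sup>2 / 100
      \<and> 8 * (cubic_const K + 1) * (L n * r n) \<le> \<epsilon>\<^sup>2 / 100) sequentially"
    using \<epsilon> C by (intro eventually_flat) auto
  have e2: "eventually (\<lambda>n. 6 * cubic_const K * (sqrt (L n) * r n) \<le> \<kappa> / 4
      \<and> 6 * cubic_const K * (L n * r n) \<le> \<kappa> / 4) sequentially"
    using \<kappa> C by (intro eventually_flat) auto
  have e3: "eventually (\<lambda>n. sqrt (384 * K\<^sup>2 * L n) * exp (- (\<epsilon>\<^sup>2 / 16 * L n)) + (exp (- L n) + 64 * K\<^sup>2 * exp (- 3 * L n)) \<le> \<kappa> / 4) sequentially"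
    using \<epsilon> \<kappa> K_pos by (intro eventually_L eventually_truncation_error) auto
  have "0 < 384 * K\<^sup>2" "0 < \<kappa>\<^sup>2" "0 < 2 * exp (32 * K\<^sup>2)" "0 < q\<^sup>2 / 8" using K_pos \<kappa> q by auto
  then have "eventually (\<lambda>x. D \<le> exp (\<epsilon> * x) * \<kappa>\<^sup>2 / (32 * (exp (2 * sqrt (384 * K\<^sup>2 * x)) + 2 * exp (32 * K\<^sup>2)))) at_top"
    and "eventually (\<lambda>x. D \<le> q\<^sup>2 / 8 * exp x) at_top" and "eventually (\<lambda>x. D \<le> exp x) at_top"
    using \<epsilon>(1) by real_asymp+
  then have e4: "eventually (\<lambda>n. D \<le> exp (\<epsilon> * L n) * \<kappa>\<^sup>2 / (32 * (exp (2 * sqrt (384 * K\<^sup>2 * L n)) + 2 * exp (32 * K\<^sup>2)))) sequentially"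
    "eventually (\<lambda>n. D \<le> q\<^sup>2 / 8 * exp (L n)) sequentially" "eventually (\<lambda>n. D \<le> exp (L n)) sequentially"
    by (intro eventually_L; simp)+
  have e5: "eventually (\<lambda>n. 1 \<le> L n) sequentially" by (intro eventually_L eventually_ge_at_top)
  show ?thesis
    using e1 e2 e3 e4 e5 eventually_ge_at_top[of 1]
  proof eventually_elim
    case (elim n)
    interpret random_matrix M K "m n" n "A n" using matrix elim by simp
    have r0: "0 \<le> r n" using abs_le_r[of 0 n] elim by auto
    have "sqrt (2 * L n) \<le> 2 * sqrt (L n)"
      unfolding real_sqrt_mult using elim by (intro mult_right_mono) (auto intro: real_le_lsqrt)
    then have "4 * (cubic_const K + 1) * (sqrt (2 * L n) * r n) \<le> 4 * (cubic_const K + 1) * (2 * sqrt (L n) * r n)"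
      using r0 C by (intro mult_left_mono mult_right_mono) auto
    also have "\<dots> = 8 * (cubic_const K + 1) * (sqrt (L n) * r n)" by simp
    also have "\<dots> \<le> \<epsilon>\<^sup>2 / 100" using elim by simp
    finally have small: "4 * (cubic_const K + 1) * (sqrt (2 * L n) * r n) \<le> \<epsilon>\<^sup>2 / 100" .
    have err: "6 * cubic_const K * (L n * r n) + (sqrt (384 * K\<^sup>2 * L n) * exp (- (\<epsilon>\<^sup>2 / 16 * L n))
        + (exp (- L n) + 64 * K\<^sup>2 * exp (- 3 * L n))) \<le> \<kappa> / 2"
      using elim by linarith
    obtain E where E: "E \<in> events" "prob E \<le> 6 * exp (- real n)"
      and g: "\<And>\<omega> x. \<omega> \<in> space M - E \<Longrightarrow> x \<in> lp_feasible (m n) n (\<lambda>i j. A n i j \<omega>) \<Longrightarrow> sqrt (2 * L n) * (\<Sum>j<n. c n j * x j) \<le> 1 + 4 * \<epsilon>"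
      using upper_bound_whp[OF unit_sum[OF elim(8)] abs_le_r \<epsilon>, folded L_def q_def, folded D_def,
        OF _ elim(7) \<kappa>_def small err elim(4) elim(6) elim(5)] by blast
    have t: "0 < sqrt (2 * L n)" using elim by simp
    have "ereal (sqrt (2 * L n)) * z n \<omega> \<le> ereal (1 + 4 * \<epsilon>)" if \<omega>: "\<omega> \<in> space M - E" for \<omega>
    proof -
      \<comment> \<open>A common bound for all feasible points also excludes an unbounded program,
        so the value is not infinite on this event.\<close>
      have "z n \<omega> \<le> ereal ((1 + 4 * \<epsilon>) / sqrt (2 * L n))"
        unfolding z_def lp_value_def
      proof (rule SUP_least)
        fix x assume "x \<in> lp_feasible (m n) n (\<lambda>i j. A n i j \<omega>)"
        then show "ereal (\<Sum>j<n. c n j * x j) \<le> ereal ((1 + 4 * \<epsilon>) / sqrt (2 * L n))"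
          using g[OF \<omega>] t by (simp add: pos_le_divide_eq mult.commute)
      qed
      then have "ereal (sqrt (2 * L n)) * z n \<omega> \<le> ereal (sqrt (2 * L n)) * ereal ((1 + 4 * \<epsilon>) / sqrt (2 * L n))"
        using t by (intro ereal_mult_left_mono) auto
      also have "\<dots> = ereal (1 + 4 * \<epsilon>)" using t by simp
      finally show ?thesis .
    qed
    then show ?case using E by blast
  qed
qed

definition good :: "real \<Rightarrow> nat \<Rightarrow> 'a set" where
  "good \<epsilon> n = {\<omega> \<in> space M. ereal (1 - \<epsilon>) \<le> ereal (sqrt (2 * L n)) * z n \<omega> \<and> ereal (sqrt (2 * L n)) * z n \<omega> \<le> ereal (1 + \<epsilon>)}"

lemma good_measurable: "n \<ge> 1 \<Longrightarrow> good \<epsilon> n \<in> events"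
proof -
  assume "n \<ge> 1"
  then interpret random_matrix M K "m n" n "A n" using matrix by simp
  have [measurable]: "z n \<in> borel_measurable M" unfolding z_def[abs_def] by (rule lp_value_measurable)
  show ?thesis unfolding good_def by measurable
qed

lemma eventually_good:
  assumes "0 < \<epsilon>" "0 < C"
  shows "eventually (\<lambda>n. 1 - real n powr (- C) \<le> prob (good \<epsilon> n)) sequentially"
proof -
  \<comment> \<open>The upper estimate loses 4 e and the lower one 2 e; the minimum with 1 keeps e
    within the range of both lemmas.\<close>
  define e where "e = min \<epsilon> 1 / 4"
  have e: "0 < e" "e \<le> 1 / 4" "4 * e \<le> \<epsilon>" "e \<le> 1 / 2" using assms by (auto simp: e_def)
  have "eventually (\<lambda>n. exp (ln (real n) + real n powr (1 / 3) - real n / (64 * K^4)) + exp (- (real n / (20000 * K^4)))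
    + exp (- (real n / (8 * K\<^sup>2))) + exp (- (real n powr (1 / 3) / 2)) + 6 * exp (- real n) \<le> real n powr (- C)) sequentially"
    using K_pos assms by (intro eventually_failure_prob) auto
  then show ?thesis using eventually_lower[OF e(1,4)] eventually_upper[OF e(1,2)] eventually_ge_at_top[of 1]
  proof eventually_elim
    case (elim n)
    obtain E1 where E1: "E1 \<in> events" "prob E1 \<le> exp (ln (real n) + real n powr (1 / 3) - real n / (64 * K^4))
      + exp (- (real n / (20000 * K^4))) + exp (- (real n / (8 * K\<^sup>2))) + exp (- (real n powr (1 / 3) / 2))"
      "\<And>\<omega>. \<omega> \<in> space M - E1 \<Longrightarrow> ereal (1 - 2 * e) \<le> ereal (sqrt (2 * L n)) * z n \<omega>"
      using elim(2) by blast
    obtain E2 where E2: "E2 \<in> events" "prob E2 \<le> 6 * exp (- real n)"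
      "\<And>\<omega>. \<omega> \<in> space M - E2 \<Longrightarrow> ereal (sqrt (2 * L n)) * z n \<omega> \<le> ereal (1 + 4 * e)"
      using elim(3) by blast
    have "space M - (E1 \<union> E2) \<subseteq> good \<epsilon> n"
    proof
      fix \<omega> assume \<omega>: "\<omega> \<in> space M - (E1 \<union> E2)"
      have "ereal (1 - \<epsilon>) \<le> ereal (1 - 2 * e)" "ereal (1 + 4 * e) \<le> ereal (1 + \<epsilon>)" using e by simp_all
      moreover have "ereal (1 - 2 * e) \<le> ereal (sqrt (2 * L n)) * z n \<omega>"
        "ereal (sqrt (2 * L n)) * z n \<omega> \<le> ereal (1 + 4 * e)" "\<omega> \<in> space M"
        using \<omega> E1(3)[of \<omega>] E2(3)[of \<omega>] by simp_all
      ultimately show "\<omega> \<in> good \<epsilon> n" unfolding good_def by (blast intro: order_trans)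
    qed
    then have "prob (space M - (E1 \<union> E2)) \<le> prob (good \<epsilon> n)"
      using good_measurable elim E1 E2 by (intro finite_measure_mono) auto
    moreover have "prob (space M - (E1 \<union> E2)) = 1 - prob (E1 \<union> E2)" using E1 E2 by (intro prob_compl) auto
    moreover have "prob (E1 \<union> E2) \<le> prob E1 + prob E2" using E1 E2 by (intro measure_Un_le) auto
    ultimately show ?case using E1(2) E2(2) elim(1) by linarith
  qed
qed

lemma AE_eventually_good:
  assumes "0 < \<epsilon>"
  shows "AE \<omega> in M. eventually (\<lambda>n. \<omega> \<in> good \<epsilon> n) sequentially"
proof -
  obtain N where N: "\<And>n. n \<ge> N \<Longrightarrow> 1 - real n powr (- 2) \<le> prob (good \<epsilon> n)"
    using eventually_good[OF assms, of 2] by (auto simp: eventually_sequentially)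
  \<comment> \<open>The exponent 2 makes the failure probabilities summable. The finitely many
    indices without the probability bound or a matrix get the empty set.\<close>
  define B where "B n = (if n \<ge> max N 1 then space M - good \<epsilon> n else {})" for n
  have B: "B n \<in> events" for n using good_measurable by (auto simp: B_def)
  have "AE \<omega> in M. eventually (\<lambda>n. \<omega> \<in> space M - B n) sequentially"
  proof (rule borel_cantelli_AE1[OF B])
    show "emeasure M (B n) < \<infinity>" for n by (simp add: emeasure_eq_measure)
    show "summable (\<lambda>n. prob (B n))"
    proof (rule summable_comparison_test)
      show "summable (\<lambda>n. real n powr (- 2))" by (simp add: summable_real_powr_iff)
      have "norm (prob (B n)) \<le> real n powr (- 2)" for n
        using N[of n] prob_compl[OF good_measurable[of n \<epsilon>]] by (auto simp: B_def)
      then show "\<exists>N. \<forall>n\<ge>N. norm (prob (B n)) \<le> real n powr (- 2)" by blast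
    qed
  qed
  then show ?thesis
  proof eventually_elim
    case (elim \<omega>)
    then show ?case using eventually_ge_at_top[of "max N 1"]
      by eventually_elim (auto simp: B_def)
  qed
qed

lemma AE_tendsto: "AE \<omega> in M. (\<lambda>n. ereal (sqrt (2 * L n)) * z n \<omega>) \<longlonglongrightarrow> 1"
proof -
  have "AE \<omega> in M. \<forall>k. eventually (\<lambda>n. \<omega> \<in> good (1 / real (Suc k)) n) sequentially"
    unfolding AE_all_countable by (intro allI AE_eventually_good) simp
  then show ?thesis
  proof eventually_elim
    case (elim \<omega>)
    have near: "eventually (\<lambda>n. ereal (1 - e) \<le> ereal (sqrt (2 * L n)) * z n \<omega> \<and> ereal (sqrt (2 * L n)) * z n \<omega> \<le> ereal (1 + e)) sequentially"
      if e: "0 < e" for e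
    proof -
      obtain k where k: "1 / real (Suc k) < e" using reals_Archimedean[OF e] by (auto simp: inverse_eq_divide)
      have "eventually (\<lambda>n. \<omega> \<in> good (1 / real (Suc k)) n) sequentially" using elim by blast
      then show ?thesis
      proof eventually_elim
        case (elim n)
        have "ereal (1 - e) \<le> ereal (1 - 1 / real (Suc k))" "ereal (1 + 1 / real (Suc k)) \<le> ereal (1 + e)" using k by simp_all
        moreover have "ereal (1 - 1 / real (Suc k)) \<le> ereal (sqrt (2 * L n)) * z n \<omega>"
          "ereal (sqrt (2 * L n)) * z n \<omega> \<le> ereal (1 + 1 / real (Suc k))"
          using elim by (simp_all add: good_def)
        ultimately show ?case by (meson order_trans)
      qed
    qed
    show ?case
    proof (rule order_tendstoI)
      fix a :: ereal assume "a < 1"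
      then obtain b where b: "a < ereal b" "ereal b < 1" using ereal_dense2 by blast
      have "0 < 1 - b" using b(2) by simp
      from near[OF this] show "eventually (\<lambda>n. a < ereal (sqrt (2 * L n)) * z n \<omega>) sequentially"
        by eventually_elim (use b(1) in \<open>auto intro: less_le_trans\<close>)
    next
      fix a :: ereal assume "1 < a"
      then obtain b where b: "1 < ereal b" "ereal b < a" using ereal_dense2 by blast
      have "0 < b - 1" using b(1) by simp
      from near[OF this] show "eventually (\<lambda>n. ereal (sqrt (2 * L n)) * z n \<omega> < a) sequentially"
        by eventually_elim (use b(2) in \<open>auto intro: le_less_trans\<close>)
    qed
  qed
qed

end

theorem theorem1p2:
  fixes M :: "'a measure"
    and K :: real
    and m :: "nat \<Rightarrow> nat"
    and A :: "nat \<Rightarrow> nat \<Rightarrow> nat \<Rightarrow> 'a \<Rightarrow> real"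
    and c :: "nat \<Rightarrow> nat \<Rightarrow> real"
    and z :: "nat \<Rightarrow> 'a \<Rightarrow> ereal"
  defines "z \<equiv> \<lambda>n \<omega>. lp_value (m n) n (\<lambda>i j. A n i j \<omega>) (c n)"
  assumes "prob_space M"
    and "K > 0"
    and "\<And>n. n \<ge> 1 \<Longrightarrow> m n > 0"
    and "filterlim (\<lambda>n. real (m n) / real n) at_top sequentially"
    and "\<And>n. n \<ge> 1 \<Longrightarrow>
           prob_space.indep_vars M (\<lambda>_. borel) (\<lambda>(i, j). A n i j) ({..<m n} \<times> {..<n})"
    and "\<And>n i j. n \<ge> 1 \<Longrightarrow> i < m n \<Longrightarrow> j < n \<Longrightarrow> subgaussian M K (A n i j)"
    and "\<And>n i j. n \<ge> 1 \<Longrightarrow> i < m n \<Longrightarrow> j < n \<Longrightarrow> prob_space.expectation M (A n i j) = 0"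
    and "\<And>n i j. n \<ge> 1 \<Longrightarrow> i < m n \<Longrightarrow> j < n \<Longrightarrow> prob_space.variance M (A n i j) = 1"
    and "\<And>n. n \<ge> 1 \<Longrightarrow> L2_set (c n) {..<n} = 1"
    and "(\<lambda>n. ln (real (m n) / real n) powr (3 / 2) * (MAX j\<in>{..<n}. \<bar>c n j\<bar>)) \<longlonglongrightarrow> 0"
  shows "(\<forall>\<epsilon>>0. \<forall>C>0. \<exists>n0. \<forall>n\<ge>n0.
            measure M {\<omega> \<in> space M.
                ereal (1 - \<epsilon>) \<le> ereal (sqrt (2 * ln (real (m n) / real n))) * z n \<omega> \<and>
                ereal (sqrt (2 * ln (real (m n) / real n))) * z n \<omega> \<le> ereal (1 + \<epsilon>)}
              \<ge> 1 - real n powr (- C))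
       \<and> (AE \<omega> in M.
            (\<lambda>n. ereal (sqrt (2 * ln (real (m n) / real n))) * z n \<omega>) \<longlonglongrightarrow> 1)"
proof -
  have matrix: "random_matrix M K (m n) n (A n)" if n: "n \<ge> 1" for n
  proof -
    have "std_subgaussian M K (A n i j)" if "i < m n" "j < n" for i j
      using assms(2,3,7-9) n that by (simp add: std_subgaussian_def std_subgaussian_axioms_def)
    then show ?thesis
      using assms(2,4,6) n
      by (auto simp: random_matrix_def random_matrix_axioms_def subgaussian_family_def subgaussian_family_axioms_def)
  qed
  interpret S: random_lp_sequence M K m A c
    using assms(2,3,5,10,11) matrix
    by (auto simp: random_lp_sequence_def random_lp_sequence_axioms_def)
  have z: "z = S.z" by (simp add: assms(1) S.z_def fun_eq_iff)
  show ?thesis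
    using S.eventually_good S.AE_tendsto
    unfolding z S.good_def S.L_def eventually_sequentially by auto
qed

end
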